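(* Let $W\times T\subset\mathbb{R}^2\times\mathbb{R}$ be a bounded non-empty open set, let $\boldsymbol\theta_0\in\boldsymbol\Theta$ be the true parameter value, and assume: (i) $\{Y_i\}_{i\ge1}$ and $\{E_i\}_{i\ge1}$ are two independent sequences of independent and identically distributed point processes on $W\times T$, defined on the same underlying probability space; $X_n=\bigcup_{i=1}^nY_i$ and $D_n=\bigcup_{i=1}^nE_i$. (ii) Each $Y_i$ is a Poisson point process with intensity function $\lambda(u;\boldsymbol\theta)=b(u)\exp(\boldsymbol\theta^\top\boldsymbol z(u))$, where $b:W\times T\to(0,\infty)$ is absolutely integrable, $\boldsymbol z=[z^{(1)},\dots,z^{(m)}]^\top:W\times T\to\mathbb{R}^m$ is measurable, and $\boldsymbol\theta$ lies in an open set $\boldsymbol\Theta\subset\mathbb{R}^m$; each $E_i$ has an absolutely integrable intensity function $\rho(u)>0$. (iii) $E_i$ has a bounded pair correlation function $g$: $\sup_{(u,v)\in(W\times T)^2}g(u,v)<\infty$. (iv) For every $\boldsymbol\theta\in\boldsymbol\Theta$ there exist $\epsilon_1(\boldsymbol\theta),\epsilon_2(\boldsymbol\theta)>0$ with $\epsilon_1(\boldsymbol\theta)<\inf_{u}\rho(u)/\lambda(u;\boldsymbol\theta)$ and $\sup_{u}\rho(u)/\lambda(u;\boldsymbol\theta)<\epsilon_2(\boldsymbol\theta)$, where $u$ ranges over $W\times T$. (v) $\sup_{u\in W\times T}\|\boldsymbol z(u)\|<\infty$. (vi) $\boldsymbol\Theta$ is convex. (vii) For $\boldsymbol\theta,\tilde{\boldsymbol\theta}\in\boldsymbol\Theta$,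 if $\lambda(u;\boldsymbol\theta)=\lambda(u;\tilde{\boldsymbol\theta})$ for almost every $u\in W\times T$, then $\boldsymbol\theta=\tilde{\boldsymbol\theta}$. (viii) The matrix $$\boldsymbol U=\left[\int_{W\times T}\frac{\lambda(u;\boldsymbol\theta_0)\rho(u)}{\lambda(u;\boldsymbol\theta_0)+\rho(u)}z^{(k)}(u)z^{(l)}(u)\,du\right]_{k,l=1}^m$$ is positive definite. For $\boldsymbol\theta\in\boldsymbol\Theta$ let $$\boldsymbol s_n(\boldsymbol\theta)=\sum_{x\in X_n}\frac{\rho(x)}{\lambda(x;\boldsymbol\theta)+\rho(x)}\boldsymbol z(x)-\sum_{x\in D_n}\frac{\lambda(x;\boldsymbol\theta)}{\lambda(x;\boldsymbol\theta)+\rho(x)}\boldsymbol z(x),$$ and let $\widehat{\boldsymbol\theta}_n$ be the logistic regression estimator, for which $\boldsymbol s_n(\widehat{\boldsymbol\theta}_n)=\boldsymbol 0$. If $\widehat{\boldsymbol\theta}_n$ is attained (such a solution in $\boldsymbol\Theta$ exists), then, as $n\to\infty$, $n^{1/2}(\widehat{\boldsymbol\theta}_n-\boldsymbol\theta_0)$ converges in distribution under $P_{\boldsymbol\theta_0}$ to an $m$-dimensional normally distributed random vector with mean zero and covariance matrix $\boldsymbol U^{-1}\boldsymbol V(\boldsymbol U^{-1})^\top$, where $$\boldsymbol V=\boldsymbol U+\left[\int_{W\times T}\int_{W\times T}\frac{\lambda(u;\boldsymbol\theta_0)\lambda(v;\boldsymbol\theta_0)\rho(u)\rho(v)z^{(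k)}(u)z^{(l)}(v)}{(\lambda(u;\boldsymbol\theta_0)+\rho(u))(\lambda(v;\boldsymbol\theta_0)+\rho(v))}(g(u,v)-1)\,du\,dv\right]_{k,l=1}^m.$$
   Context: A point process $Z$ on $W\times T$ has intensity function $\kappa:W\times T\to[0,\infty)$ if $\mathbb{E}\{\sum_{x\in Z}1(x\in B)\}=\int_B\kappa(u)\,du$ for every Borel set $B\subset W\times T$. It has second-order product density $\kappa^{(2)}$ if $\mathbb{E}\{\sum^{\neq}_{x,y\in Z}1(x\in B_1,y\in B_2)\}=\int_{B_1}\int_{B_2}\kappa^{(2)}(u,v)\,du\,dv$ for all Borel $B_1,B_2$ (sum over ordered pairs of distinct points, the left-hand side defining a $\sigma$-finite measure); the pair correlation function is then $\kappa^{(2)}(u,v)/(\kappa(u)\kappa(v))$. A Poisson point process with intensity function $\kappa$ is one for which the number of points in each Borel $B$ is Poisson distributed with mean $\int_B\kappa(u)\,du$ and numbers of points in disjoint Borel sets are independent. Unions of point processes are superpositions, so $\sum_{x\in X_n}=\sum_{i=1}^n\sum_{x\in Y_i}$ and likewise for $D_n$. $P_{\boldsymbol\theta_0}$ denotes the probability distribution under the true parameter value $\boldsymbol\theta_0$, i.e. when each $Y_i$ has intensity function $\lambda(\cdot;\boldsymbol\theta_0)$; the law of the $E_i$ does not depend on $\boldsymbol\theta$. The function $\boldsymbol s_n$ is the gradient in $\boldsymbol\theta$ of the logistic log-likelihood $l_n(\boldsymbol\theta)=\sum_{x\in X_n}\log[\lambda(x;\boldsymbol\theta)/(\lambda(x;\boldsymbol\theta)+\rho(x))]+\sum_{x\in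 D_n}\log[\rho(x)/(\lambda(x;\boldsymbol\theta)+\rho(x))]$. *)

theory Defs
  imports "HOL-Probability.Probability" "HOL-Library.Multiset"
begin

section \<open>Point processes\<close>

text \<open>Only bounded windows \<open>S\<close> are used, so locally finite configurations are finite ones.
  Configurations are sets of points: every point process that has a (diffuse) Poisson law or
  a second-order product density is almost surely without multiple points.\<close>

definition config_space :: "'a::euclidean_space set \<Rightarrow> 'a set measure" where
  "config_space S = sigma (Fpow S)
     {{A \<in> Fpow S. card (A \<inter> B) = k} | B k. B \<in> sets borel}"

definition point_process :: "'w measure \<Rightarrow> 'a::euclidean_space set \<Rightarrow> ('w \<Rightarrow> 'a set) \<Rightarrow> bool" where
  "point_process M S Z \<longleftrightarrow> Z \<in> measurable M (config_space S)"

definition has_intensity ::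
    "'w measure \<Rightarrow> 'a::euclidean_space set \<Rightarrow> ('a \<Rightarrow> real) \<Rightarrow> ('w \<Rightarrow> 'a set) \<Rightarrow> bool" where
  "has_intensity M S \<kappa> Z \<longleftrightarrow>
     point_process M S Z \<and> set_borel_measurable borel S \<kappa> \<and> (\<forall>u\<in>S. 0 \<le> \<kappa> u) \<and>
     (\<forall>B\<in>sets borel. B \<subseteq> S \<longrightarrow>
        (\<integral>\<^sup>+\<omega>. (\<Sum>x\<in>Z \<omega>. indicator B x) \<partial>M) = (\<integral>\<^sup>+u\<in>B. ennreal (\<kappa> u) \<partial>lborel))"

definition factorial_moment ::
    "'w measure \<Rightarrow> ('w \<Rightarrow> 'a::euclidean_space set) \<Rightarrow> ('a \<times> 'a) set \<Rightarrow> ennreal" where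
  "factorial_moment M Z C = (\<integral>\<^sup>+\<omega>. (\<Sum>p\<in>Z \<omega> \<times> Z \<omega> - Id. indicator C p) \<partial>M)"

definition has_second_order_density ::
    "'w measure \<Rightarrow> 'a::euclidean_space set \<Rightarrow> ('a \<Rightarrow> 'a \<Rightarrow> real) \<Rightarrow> ('w \<Rightarrow> 'a set) \<Rightarrow> bool" where
  "has_second_order_density M S \<kappa>2 Z \<longleftrightarrow>
     point_process M S Z \<and> set_borel_measurable borel (S \<times> S) (\<lambda>(u, v). \<kappa>2 u v) \<and>
     (\<forall>u\<in>S. \<forall>v\<in>S. 0 \<le> \<kappa>2 u v) \<and>
     sigma_finite_measure (measure_of UNIV (sets borel) (factorial_moment M Z)) \<and>
     (\<forall>B1\<in>sets borel. \<forall>B2\<in>sets borel. B1 \<subseteq> S \<longrightarrow> B2 \<subseteq> S \<longrightarrow>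
        factorial_moment M Z (B1 \<times> B2) =
          (\<integral>\<^sup>+u\<in>B1. (\<integral>\<^sup>+v\<in>B2. ennreal (\<kappa>2 u v) \<partial>lborel) \<partial>lborel))"

definition has_pair_correlation ::
    "'w measure \<Rightarrow> 'a::euclidean_space set \<Rightarrow> ('a \<Rightarrow> real) \<Rightarrow> ('a \<Rightarrow> 'a \<Rightarrow> real) \<Rightarrow>
     ('w \<Rightarrow> 'a set) \<Rightarrow> bool" where
  "has_pair_correlation M S \<kappa> g Z \<longleftrightarrow> has_intensity M S \<kappa> Z \<and>
     (\<exists>\<kappa>2. has_second_order_density M S \<kappa>2 Z \<and>
        (\<forall>u\<in>S. \<forall>v\<in>S. g u v = \<kappa>2 u v / (\<kappa> u * \<kappa> v)))"

text \<open>Counts of a finite point process are finite, so the intensity is necessarily integrable.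
  The Poisson masses are written out because the library's Poisson distribution is specified
  for strictly positive rates only, and the mean count of a null set is 0.\<close>

definition poisson_process ::
    "'w measure \<Rightarrow> 'a::euclidean_space set \<Rightarrow> ('a \<Rightarrow> real) \<Rightarrow> ('w \<Rightarrow> 'a set) \<Rightarrow> bool" where
  "poisson_process M S \<kappa> Z \<longleftrightarrow>
     point_process M S Z \<and> set_integrable lborel S \<kappa> \<and> (\<forall>u\<in>S. 0 \<le> \<kappa> u) \<and>
     (\<forall>B\<in>sets borel. B \<subseteq> S \<longrightarrow> (\<forall>k.
        measure M {\<omega> \<in> space M. card (Z \<omega> \<inter> B) = k} =
          (LINT u:B|lborel. \<kappa> u) ^ k / fact k * exp (- (LINT u:B|lborel. \<kappa> u)))) \<and>
     (\<forall>B :: nat \<Rightarrow> 'a set. (\<forall>j. B j \<in> sets borel \<and> B j \<subseteq> S) \<longrightarrow> disjoint_family B \<longrightarrow>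
        prob_space.indep_vars M (\<lambda>_. count_space UNIV) (\<lambda>j \<omega>. card (Z \<omega> \<inter> B j)) UNIV)"

definition iid_point_processes ::
    "'w measure \<Rightarrow> 'a::euclidean_space set \<Rightarrow> (nat \<Rightarrow> 'w \<Rightarrow> 'a set) \<Rightarrow> bool" where
  "iid_point_processes M S Z \<longleftrightarrow>
     prob_space.indep_vars M (\<lambda>_. config_space S) Z UNIV \<and>
     (\<forall>i. distr M (config_space S) (Z i) = distr M (config_space S) (Z 0))"

definition superposition :: "(nat \<Rightarrow> 'w \<Rightarrow> 'a set) \<Rightarrow> nat \<Rightarrow> 'w \<Rightarrow> 'a multiset" where
  "superposition Z n \<omega> = (\<Sum>i<n. mset_set (Z i \<omega>))"

section \<open>Logistic regression for the log-linear intensity\<close>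

definition loglin ::
    "('a \<Rightarrow> real) \<Rightarrow> ('a \<Rightarrow> real^'m) \<Rightarrow> real^'m \<Rightarrow> 'a \<Rightarrow> real" where
  "loglin b z \<theta> u = b u * exp (\<theta> \<bullet> z u)"

definition logistic_score ::
    "('a \<Rightarrow> real) \<Rightarrow> ('a \<Rightarrow> real^'m) \<Rightarrow> ('a \<Rightarrow> real) \<Rightarrow> 'a multiset \<Rightarrow> 'a multiset \<Rightarrow>
     real^'m \<Rightarrow> real^'m" where
  "logistic_score b z \<rho> X D \<theta> =
     (\<Sum>x\<in>#X. (\<rho> x / (loglin b z \<theta> x + \<rho> x)) *\<^sub>R z x) -
     (\<Sum>x\<in>#D. (loglin b z \<theta> x / (loglin b z \<theta> x + \<rho> x)) *\<^sub>R z x)"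

definition U_matrix ::
    "'a::euclidean_space set \<Rightarrow> ('a \<Rightarrow> real) \<Rightarrow> ('a \<Rightarrow> real^'m) \<Rightarrow> ('a \<Rightarrow> real) \<Rightarrow> real^'m \<Rightarrow>
     real^'m^'m" where
  "U_matrix S b z \<rho> \<theta> = (\<chi> k l. LINT u:S|lborel.
     loglin b z \<theta> u * \<rho> u / (loglin b z \<theta> u + \<rho> u) * z u $ k * z u $ l)"

definition V_matrix ::
    "'a::euclidean_space set \<Rightarrow> ('a \<Rightarrow> real) \<Rightarrow> ('a \<Rightarrow> real^'m) \<Rightarrow> ('a \<Rightarrow> real) \<Rightarrow>
     ('a \<Rightarrow> 'a \<Rightarrow> real) \<Rightarrow> real^'m \<Rightarrow> real^'m^'m" where
  "V_matrix S b z \<rho> g \<theta> = U_matrix S b z \<rho> \<theta> +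
     (\<chi> k l. LINT u:S|lborel. LINT v:S|lborel.
        loglin b z \<theta> u * loglin b z \<theta> v * \<rho> u * \<rho> v * z u $ k * z v $ l /
        ((loglin b z \<theta> u + \<rho> u) * (loglin b z \<theta> v + \<rho> v)) * (g u v - 1))"

definition positive_definite :: "real^'m^'m \<Rightarrow> bool" where
  "positive_definite A \<longleftrightarrow> transpose A = A \<and> (\<forall>x. x \<noteq> 0 \<longrightarrow> 0 < x \<bullet> (A *v x))"

section \<open>Convergence in distribution and multivariate normal laws\<close>

definition converges_in_distribution ::
    "(nat \<Rightarrow> 'a::topological_space measure) \<Rightarrow> 'a measure \<Rightarrow> bool" where
  "converges_in_distribution \<mu> N \<longleftrightarrow>
     (\<forall>f :: 'a \<Rightarrow> real. continuous_on UNIV f \<longrightarrow> bounded (range f) \<longrightarrow>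
        (\<lambda>n. integral\<^sup>L (\<mu> n) f) \<longlonglongrightarrow> integral\<^sup>L N f)"

text \<open>A law on \<open>\<real>\<^sup>m\<close> is normal if all linear functionals have (possibly degenerate) univariate
  normal laws; it is identified by its mean vector and covariance matrix.\<close>

definition univariate_normal :: "real measure \<Rightarrow> bool" where
  "univariate_normal N \<longleftrightarrow>
     (\<exists>\<mu>. N = return borel \<mu>) \<or>
     (\<exists>\<mu> \<sigma>. 0 < \<sigma> \<and> N = density lborel (normal_density \<mu> \<sigma>))"

definition multivariate_normal :: "(real^'m) measure \<Rightarrow> real^'m \<Rightarrow> real^'m^'m \<Rightarrow> bool" where
  "multivariate_normal N \<mu> \<Sigma> \<longleftrightarrow>
     prob_space N \<and> sets N = sets borel \<and>
     (\<forall>a. univariate_normal (distr N borel (\<lambda>x. a \<bullet> x))) \<and>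
     (\<forall>k. (LINT x|N. x $ k) = \<mu> $ k) \<and>
     (\<forall>k l. (LINT x|N. (x $ k - \<mu> $ k) * (x $ l - \<mu> $ l)) = \<Sigma> $ k $ l)"

end

theory Submission
  imports Defs
begin

text \<open>
  Write \<open>\<lambda> = \<lambda>(\<cdot>; \<theta>\<^sub>0)\<close>. The estimator solves \<open>s\<^sub>n(\<theta>) = 0\<close>, and the proof compares it with one
  Newton step from the true parameter: with \<open>\<xi>\<^sub>n = n\<^sup>-\<^sup>1\<^sup>/\<^sup>2 U\<^sup>-\<^sup>1 s\<^sub>n(\<theta>\<^sub>0)\<close>, the difference
  \<open>n\<^sup>1\<^sup>/\<^sup>2 (\<theta>hat\<^sub>n - \<theta>\<^sub>0) - \<xi>\<^sub>n\<close> tends to 0 in probability, and \<open>\<xi>\<^sub>n\<close> is a normalised sum of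
  independent, identically distributed vectors.

  \<^emph>\<open>The limit of the Newton step.\<close> The score at \<open>\<theta>\<^sub>0\<close> is a sum over the \<open>Y\<^sub>i\<close> of the factor
  \<open>\<rho>/(\<lambda> + \<rho>)\<close> times \<open>z\<close>, minus a sum over the \<open>E\<^sub>i\<close> of the factor \<open>\<lambda>/(\<lambda> + \<rho>)\<close> times \<open>z\<close>. Campbell
  formulas for the points and for the ordered pairs of distinct points give means and covariances
  of such sums for any process with a bounded pair correlation function
  (\<open>pair_correlation_covariance\<close>). A Poisson process has pair correlation 1
  (\<open>poisson_process_pair_correlation\<close>), so both sequences fall under the same formula. The two
  means cancel, and the two variances of a linear functional add up to the quadratic form of \<open>V\<close>
  (\<open>quadratic_form_V\<close>): the diagonal terms combine to \<open>U\<close> because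
  \<open>\<rho>\<^sup>2\<lambda> + \<lambda>\<^sup>2\<rho> = \<lambda>\<rho>(\<lambda> + \<rho>)\<close>. The real central limit theorem is applied to the two independent
  sums separately, and the characteristic functions are multiplied (\<open>score_char_tendsto\<close>).

  \<^emph>\<open>From characteristic functions to laws.\<close> Convergence against bounded continuous functions on
  a Euclidean space follows from pointwise convergence of characteristic functions
  (\<open>char_vec_tendsto_imp_converges_in_distribution\<close>): the coordinates are tight by the
  one-dimensional theorem, and on compact sets continuous functions are uniform limits of
  trigonometric polynomials that keep almost the same global bound. The limiting normal law is built by
  eliminating one coordinate of the covariance form at a time (\<open>gaussian_exists\<close>).

  \<^emph>\<open>The estimator.\<close> The map \<open>\<theta> \<mapsto> s\<^sub>n(\<theta>)\<close> is monotone decreasing, since the logistic log-likelihood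
  is concave, and near \<open>\<theta>\<^sub>0\<close> it differs from the affine map with slope \<open>-nU\<close> by a quadratic
  Taylor remainder and by the error in the law of large numbers for its derivative. A
  decreasing map that is close to such an affine map on a small ball around the zero of the latter
  has a zero in that ball by Brouwer's theorem, and none outside it by monotonicity
  (\<open>zero_of_monotone_near_linear\<close>). Hence, with probability tending to one, a root \<open>\<theta>\<close> of the score
  exists in \<open>\<Theta>\<close>, and \<open>n\<^sup>1\<^sup>/\<^sup>2 (\<theta> - \<theta>\<^sub>0)\<close> is close to \<open>\<xi>\<^sub>n\<close> for every root
  (\<open>logistic_score_zero_near\<close>, \<open>estimator_newton_step_close\<close>).
\<close>

section \<open>Random finite sets and Campbell formulas\<close>

text \<open>
  This applies both to a point process and to the set of its ordered pairs of distinct points, so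
  that a single Campbell formula covers first and second moments. The measurability of the counts
  is included because the integral, a supremum over simple functions, is additive only on measurable
  functions.
\<close>
definition has_mean_measure :: "'w measure \<Rightarrow> ('w \<Rightarrow> 'b set) \<Rightarrow> 'b measure \<Rightarrow> bool" where
  "has_mean_measure M A \<nu> \<longleftrightarrow>
     (\<forall>\<omega>\<in>space M. finite (A \<omega>) \<and> A \<omega> \<subseteq> space \<nu>) \<and>
     (\<forall>B\<in>sets \<nu>. (\<lambda>\<omega>. \<Sum>x\<in>A \<omega>. indicator B x :: ennreal) \<in> borel_measurable M \<and>
        (\<integral>\<^sup>+\<omega>. (\<Sum>x\<in>A \<omega>. indicator B x) \<partial>M) = emeasure \<nu> B)"

text \<open>
  Sums over a finite set commute with the monotone limits by which a nonnegative function is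
  built from indicators, so measurable counts suffice.
\<close>
lemma measurable_sum_over_random_set:
  fixes f :: "'b \<Rightarrow> ennreal"
  assumes fin: "\<And>\<omega>. \<omega> \<in> space M \<Longrightarrow> finite (A \<omega>) \<and> A \<omega> \<subseteq> space N"
    and count: "\<And>B. B \<in> sets N \<Longrightarrow> (\<lambda>\<omega>. \<Sum>x\<in>A \<omega>. indicator B x :: ennreal) \<in> borel_measurable M"
    and f: "f \<in> borel_measurable N"
  shows "(\<lambda>\<omega>. \<Sum>x\<in>A \<omega>. f x) \<in> borel_measurable M"
  using f
proof (induction rule: borel_measurable_induct)
  case (cong f g)
  then have "(\<Sum>x\<in>A \<omega>. f x) = (\<Sum>x\<in>A \<omega>. g x)" if "\<omega> \<in> space M" for \<omega>
    using fin[OF that] by (intro sum.cong) auto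
  with cong show ?case by (simp cong: measurable_cong)
next
  case (seq U)
  have "(\<Sum>x\<in>A \<omega>. (SUP i. U i) x) = (SUP i. \<Sum>x\<in>A \<omega>. U i x)" for \<omega>
    using \<open>incseq U\<close> by (subst ennreal_SUP_sum) (auto simp: incseq_def le_fun_def image_comp)
  with seq show ?case by simp
qed (auto simp: count sum.distrib sum_distrib_left[symmetric])

lemma has_mean_measure_measurable:
  fixes f :: "'b \<Rightarrow> ennreal"
  assumes "has_mean_measure M A \<nu>" "f \<in> borel_measurable \<nu>"
  shows "(\<lambda>\<omega>. \<Sum>x\<in>A \<omega>. f x) \<in> borel_measurable M"
proof (rule measurable_sum_over_random_set[OF _ _ assms(2)])
  show "finite (A \<omega>) \<and> A \<omega> \<subseteq> space \<nu>" if "\<omega> \<in> space M" for \<omega>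
    using assms(1) that unfolding has_mean_measure_def by blast
  show "(\<lambda>\<omega>. \<Sum>x\<in>A \<omega>. indicator B x :: ennreal) \<in> borel_measurable M" if "B \<in> sets \<nu>" for B
    using assms(1) that unfolding has_mean_measure_def by blast
qed

text \<open>
  Campbell's formula: for indicators it is the definition of the mean measure, and both sides
  respect sums, multiples and monotone limits.
\<close>
lemma campbell_nn_integral:
  fixes f :: "'b \<Rightarrow> ennreal"
  assumes A: "has_mean_measure M A \<nu>" and f: "f \<in> borel_measurable \<nu>"
  shows "(\<integral>\<^sup>+\<omega>. (\<Sum>x\<in>A \<omega>. f x) \<partial>M) = (\<integral>\<^sup>+x. f x \<partial>\<nu>)"
  using f
proof (induction rule: borel_measurable_induct)
  case (cong f g)
  have "(\<Sum>x\<in>A \<omega>. f x) = (\<Sum>x\<in>A \<omega>. g x)" if "\<omega> \<in> space M" for \<omega>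
    using A that cong(3) by (intro sum.cong) (auto simp: has_mean_measure_def)
  moreover have "(\<integral>\<^sup>+x. f x \<partial>\<nu>) = (\<integral>\<^sup>+x. g x \<partial>\<nu>)"
    using cong(3) by (rule nn_integral_cong)
  ultimately show ?case using cong by (simp cong: nn_integral_cong)
next
  case (set B)
  then show ?case using A by (auto simp: has_mean_measure_def)
next
  case (mult u c)
  then show ?case
    using has_mean_measure_measurable[OF A]
    by (simp add: sum_distrib_left[symmetric] nn_integral_cmult)
next
  case (add u v)
  then show ?case
    using has_mean_measure_measurable[OF A]
    by (simp add: sum.distrib nn_integral_add)
next
  case (seq U)
  have "(\<Sum>x\<in>A \<omega>. (SUP i. U i) x) = (SUP i. \<Sum>x\<in>A \<omega>. U i x)" for \<omega>
    using \<open>incseq U\<close> by (subst ennreal_SUP_sum) (auto simp: incseq_def le_fun_def image_comp)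
  then have "(\<integral>\<^sup>+\<omega>. (\<Sum>x\<in>A \<omega>. (SUP i. U i) x) \<partial>M) = (SUP i. \<integral>\<^sup>+\<omega>. (\<Sum>x\<in>A \<omega>. U i x) \<partial>M)"
    using seq has_mean_measure_measurable[OF A]
    by (simp, subst nn_integral_monotone_convergence_SUP)
       (auto simp: incseq_def le_fun_def intro!: sum_mono)
  also have "\<dots> = (SUP i. \<integral>\<^sup>+x. U i x \<partial>\<nu>)" using seq by simp
  also have "\<dots> = (\<integral>\<^sup>+x. (SUP i. U i x) \<partial>\<nu>)"
    using seq by (subst nn_integral_monotone_convergence_SUP) auto
  finally show ?case by (simp add: image_comp)
qed

lemma campbell_integral:
  fixes f :: "'b \<Rightarrow> real"
  assumes A: "has_mean_measure M A \<nu>" and f: "integrable \<nu> f"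
  shows "integrable M (\<lambda>\<omega>. \<Sum>x\<in>A \<omega>. f x)"
    and "(LINT \<omega>|M. (\<Sum>x\<in>A \<omega>. f x)) = (LINT x|\<nu>. f x)"
proof -
  define F where "F h \<omega> = (\<Sum>x\<in>A \<omega>. h x)" for h :: "'b \<Rightarrow> real" and \<omega>
  have nonneg: "integrable M (F h) \<and> integral\<^sup>L M (F h) = integral\<^sup>L \<nu> h"
    if h: "integrable \<nu> h" "\<And>x. 0 \<le> h x" for h
  proof -
    have e: "ennreal (F h \<omega>) = (\<Sum>x\<in>A \<omega>. ennreal (h x))" for \<omega>
      using h(2) by (simp add: F_def sum_ennreal)
    have m: "(\<lambda>\<omega>. ennreal (F h \<omega>)) \<in> borel_measurable M"
      using h unfolding e by (intro has_mean_measure_measurable[OF A]) auto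
    have "(\<lambda>\<omega>. enn2real (ennreal (F h \<omega>))) \<in> borel_measurable M"
      using m by measurable
    then have [measurable]: "F h \<in> borel_measurable M"
      using h(2) by (simp add: F_def[abs_def] sum_nonneg)
    have i: "(\<integral>\<^sup>+\<omega>. ennreal (F h \<omega>) \<partial>M) = ennreal (integral\<^sup>L \<nu> h)"
      using h campbell_nn_integral[OF A, of "\<lambda>x. ennreal (h x)"]
      by (simp add: e nn_integral_eq_integral)
    have "has_bochner_integral M (F h) (integral\<^sup>L \<nu> h)"
      using h i by (intro has_bochner_integral_nn_integral) (auto simp: F_def sum_nonneg)
    then show ?thesis by (simp add: has_bochner_integral_iff)
  qed
  have split: "F f \<omega> = F (\<lambda>x. max 0 (f x)) \<omega> - F (\<lambda>x. max 0 (- f x)) \<omega>" for \<omega>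
    by (simp add: F_def sum_subtractf[symmetric] max_def, rule sum.cong) auto
  have p: "integrable \<nu> (\<lambda>x. max 0 (f x))" "integrable \<nu> (\<lambda>x. max 0 (- f x))"
    using f by auto
  note P = nonneg[OF p(1)] nonneg[OF p(2)]
  have I: "integrable M (\<lambda>\<omega>. F f \<omega>)" using P unfolding split by auto
  then show "integrable M (\<lambda>\<omega>. \<Sum>x\<in>A \<omega>. f x)" by (simp add: F_def)
  have "integral\<^sup>L M (F f) = integral\<^sup>L \<nu> (\<lambda>x. max 0 (f x)) - integral\<^sup>L \<nu> (\<lambda>x. max 0 (- f x))"
    using P unfolding split by simp
  also have "\<dots> = integral\<^sup>L \<nu> (\<lambda>x. max 0 (f x) - max 0 (- f x))"
    using p by simp
  also have "\<dots> = integral\<^sup>L \<nu> f" by (rule Bochner_Integration.integral_cong) auto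
  finally show "(LINT \<omega>|M. (\<Sum>x\<in>A \<omega>. f x)) = (LINT x|\<nu>. f x)" by (simp add: F_def[abs_def])
qed

lemma indicator_sum_eq_card:
  "finite A \<Longrightarrow> (\<Sum>x\<in>A. indicator B x :: 'c::semiring_1) = of_nat (card (A \<inter> B))"
  by (simp add: indicator_def sum.If_cases Int_def)

lemma space_config_space: "space (config_space S) = Fpow S"
  unfolding config_space_def by (intro space_measure_of) auto

lemma measurable_count_config_space [measurable]:
  assumes "B \<in> sets borel"
  shows "(\<lambda>A. card (A \<inter> B)) \<in> measurable (config_space S) (count_space UNIV)"
proof (rule measurable_count_space_eq2_countable[THEN iffD2], safe)
  fix k :: nat
  have "(\<lambda>A. card (A \<inter> B)) -` {k} \<inter> space (config_space S) = {A \<in> Fpow S. card (A \<inter> B) = k}"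
    by (auto simp: space_config_space)
  also have "\<dots> \<in> sets (config_space S)"
    unfolding config_space_def using assms by (subst sets_measure_of) auto
  finally show "(\<lambda>A. card (A \<inter> B)) -` {k} \<inter> space (config_space S) \<in> sets (config_space S)" .
qed auto

lemma measurable_sum_config_space:
  fixes f :: "'a::euclidean_space \<Rightarrow> real"
  assumes [measurable]: "f \<in> borel_measurable borel"
  shows "(\<lambda>A. \<Sum>x\<in>A. f x) \<in> borel_measurable (config_space S)"
proof -
  have fin: "finite A" if "A \<in> space (config_space S)" for A
    using that by (auto simp: space_config_space Fpow_def)
  have c: "(\<lambda>A. \<Sum>x\<in>A. indicator B x :: ennreal) \<in> borel_measurable (config_space S)"
    if "B \<in> sets borel" for B
  proof -
    have "(\<lambda>A. of_nat (card (A \<inter> B)) :: ennreal) \<in> borel_measurable (config_space S)"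
      using that by measurable
    then show ?thesis by (simp add: indicator_sum_eq_card fin cong: measurable_cong)
  qed
  have m: "(\<lambda>A. \<Sum>x\<in>A. ennreal (h x)) \<in> borel_measurable (config_space S)"
    if "h \<in> borel_measurable borel" for h :: "'a \<Rightarrow> real"
    by (rule measurable_sum_over_random_set[OF _ c]) (use that fin in auto)
  have e: "(\<Sum>x\<in>A. f x) = enn2real (\<Sum>x\<in>A. ennreal (f x)) - enn2real (\<Sum>x\<in>A. ennreal (- f x))" for A
  proof -
    have *: "enn2real (\<Sum>x\<in>A. ennreal (h x)) = (\<Sum>x\<in>A. max 0 (h x))" for h :: "'a \<Rightarrow> real"
    proof -
      have "(\<Sum>x\<in>A. ennreal (h x)) = (\<Sum>x\<in>A. ennreal (max 0 (h x)))"
        by (rule sum.cong) (auto simp: max_def ennreal_neg)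
      also have "\<dots> = ennreal (\<Sum>x\<in>A. max 0 (h x))" by (rule sum_ennreal) simp
      finally show ?thesis by (simp add: sum_nonneg del: ennreal_max_0 ennreal_max_0')
    qed
    show ?thesis unfolding * by (simp add: sum_subtractf[symmetric], rule sum.cong) auto
  qed
  show ?thesis
    unfolding e using m[of f] m[of "\<lambda>x. - f x"] by measurable
qed

lemma point_processD:
  assumes "point_process M S Z" "\<omega> \<in> space M"
  shows "finite (Z \<omega>)" "Z \<omega> \<subseteq> S"
  using assms measurable_space[of Z M "config_space S" \<omega>]
  by (auto simp: point_process_def space_config_space Fpow_def)

lemma point_process_count_measurable:
  assumes "point_process M S Z" "B \<in> sets borel"
  shows "(\<lambda>\<omega>. card (Z \<omega> \<inter> B)) \<in> measurable M (count_space UNIV)"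
  using measurable_compose[OF assms(1)[unfolded point_process_def] measurable_count_config_space[OF assms(2)]] .

text \<open>
  Splitting the square of a sum into diagonal and off-diagonal pairs is what turns second moments
  into a first moment of pairs plus a first moment of points.
\<close>
lemma sum_square_offdiagonal:
  fixes f g :: "'a \<Rightarrow> 'b::comm_semiring_0"
  assumes "finite A"
  shows "(\<Sum>x\<in>A. f x) * (\<Sum>y\<in>A. g y) =
    (\<Sum>p\<in>A \<times> A - Id. f (fst p) * g (snd p)) + (\<Sum>x\<in>A. f x * g x)"
proof -
  have "(\<Sum>x\<in>A. f x) * (\<Sum>y\<in>A. g y) = (\<Sum>p\<in>A \<times> A. f (fst p) * g (snd p))"
    by (simp add: sum_product sum.cartesian_product case_prod_unfold)
  also have "A \<times> A = (A \<times> A - Id) \<union> (\<lambda>x. (x, x)) ` A" by auto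
  also have "(\<Sum>p\<in>\<dots>. f (fst p) * g (snd p)) =
     (\<Sum>p\<in>A \<times> A - Id. f (fst p) * g (snd p)) + (\<Sum>p\<in>(\<lambda>x. (x, x)) ` A. f (fst p) * g (snd p))"
    using assms by (intro sum.union_disjoint) auto
  also have "(\<Sum>p\<in>(\<lambda>x. (x, x)) ` A. f (fst p) * g (snd p)) = (\<Sum>x\<in>A. f x * g x)"
    by (subst sum.reindex) (auto simp: inj_on_def)
  finally show ?thesis .
qed

lemma point_process_mean_measure:
  fixes \<kappa> :: "'a::euclidean_space \<Rightarrow> real"
  assumes Z: "has_intensity M S \<kappa> Z" and S[measurable]: "S \<in> sets borel"
  shows "has_mean_measure M Z (density lborel (\<lambda>u. ennreal (indicator S u * \<kappa> u)))"
    (is "has_mean_measure M Z ?\<nu>")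
proof -
  have pp: "point_process M S Z" and [measurable]: "(\<lambda>u. indicator S u * \<kappa> u) \<in> borel_measurable borel"
    using Z by (auto simp: has_intensity_def set_borel_measurable_def)
  have "(\<lambda>\<omega>. \<Sum>x\<in>Z \<omega>. indicator B x :: ennreal) \<in> borel_measurable M \<and>
        (\<integral>\<^sup>+\<omega>. (\<Sum>x\<in>Z \<omega>. indicator B x) \<partial>M) = emeasure ?\<nu> B"
    if [measurable]: "B \<in> sets borel" for B
  proof
    have "(\<lambda>\<omega>. of_nat (card (Z \<omega> \<inter> B)) :: ennreal) \<in> borel_measurable M"
      using measurable_compose[OF point_process_count_measurable[OF pp that],
          of "of_nat :: nat \<Rightarrow> ennreal" borel] by simp
    then show "(\<lambda>\<omega>. \<Sum>x\<in>Z \<omega>. indicator B x :: ennreal) \<in> borel_measurable M"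
      using point_processD(1)[OF pp] by (simp add: indicator_sum_eq_card cong: measurable_cong)
    have "(\<integral>\<^sup>+\<omega>. (\<Sum>x\<in>Z \<omega>. indicator B x) \<partial>M) = (\<integral>\<^sup>+\<omega>. (\<Sum>x\<in>Z \<omega>. indicator (B \<inter> S) x :: ennreal) \<partial>M)"
      using point_processD(2)[OF pp] by (intro nn_integral_cong sum.cong) (auto simp: indicator_def)
    also have "\<dots> = (\<integral>\<^sup>+u\<in>B \<inter> S. ennreal (\<kappa> u) \<partial>lborel)"
      using Z by (auto simp: has_intensity_def)
    also have "\<dots> = emeasure ?\<nu> B"
    proof (subst emeasure_density)
      show "(\<lambda>u. ennreal (indicator S u * \<kappa> u)) \<in> borel_measurable lborel" by measurable
    qed (auto intro!: nn_integral_cong simp: indicator_def)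
    finally show "(\<integral>\<^sup>+\<omega>. (\<Sum>x\<in>Z \<omega>. indicator B x) \<partial>M) = emeasure ?\<nu> B" .
  qed
  then show ?thesis
    using point_processD(1)[OF pp] by (simp add: has_mean_measure_def)
qed

lemma factorial_moment_Int:
  fixes Z :: "'w \<Rightarrow> 'a::euclidean_space set"
  assumes "point_process M S Z"
  shows "factorial_moment M Z (B1 \<times> B2) = factorial_moment M Z ((B1 \<inter> S) \<times> (B2 \<inter> S))"
  unfolding factorial_moment_def
  using point_processD(2)[OF assms] by (intro nn_integral_cong sum.cong) (auto simp: indicator_def)

text \<open>
  The second-order density is specified on rectangles only. Rectangles are stable under
  intersections and generate the Borel sets of the product, so Dynkin's argument extends it to all
  Borel sets; finiteness of the total mass is what allows complements.
\<close>
lemma offdiagonal_mean_measure: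
  fixes Z :: "'w \<Rightarrow> 'a::euclidean_space set" and \<nu> :: "('a \<times> 'a) measure"
  assumes Z: "point_process M S Z"
    and sets: "sets \<nu> = sets borel" and fin: "emeasure \<nu> UNIV < \<infinity>"
    and rect: "\<And>B1 B2. B1 \<in> sets borel \<Longrightarrow> B2 \<in> sets borel \<Longrightarrow>
      factorial_moment M Z (B1 \<times> B2) = emeasure \<nu> (B1 \<times> B2)"
  shows "has_mean_measure M (\<lambda>\<omega>. Z \<omega> \<times> Z \<omega> - Id) \<nu>"
proof -
  define c where "c C \<omega> = (\<Sum>p\<in>Z \<omega> \<times> Z \<omega> - Id. indicator C p :: ennreal)" for C \<omega>
  have space: "space \<nu> = UNIV" using sets_eq_imp_space_eq[OF sets] by simp
  have cfin: "finite (Z \<omega> \<times> Z \<omega> - Id)" if "\<omega> \<in> space M" for \<omega>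
    using point_processD(1)[OF Z that] by simp
  have cntm: "(\<lambda>\<omega>. of_nat (card (Z \<omega> \<inter> B)) :: ennreal) \<in> borel_measurable M"
    if "B \<in> sets borel" for B
    using measurable_compose[OF point_process_count_measurable[OF Z that],
        of "of_nat :: nat \<Rightarrow> ennreal" borel] by simp
  let ?G = "{A \<times> B | A B. A \<in> sets (borel :: 'a measure) \<and> B \<in> sets (borel :: 'a measure)}"
  have G: "sets \<nu> = sigma_sets UNIV ?G"
    using sets_pair_measure[of "borel :: 'a measure" "borel :: 'a measure"]
    by (simp add: sets borel_prod[symmetric])
  have rm: "c (A \<times> B) \<in> borel_measurable M" if A: "A \<in> sets borel" and B: "B \<in> sets borel" for A B
  proof -
    \<comment> \<open>The number of off-diagonal pairs in a rectangle is a polynomial in three counts of points.\<close>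
    have "c (A \<times> B) \<omega> = of_nat (card (Z \<omega> \<inter> A)) * of_nat (card (Z \<omega> \<inter> B)) - of_nat (card (Z \<omega> \<inter> (A \<inter> B)))"
      if w: "\<omega> \<in> space M" for \<omega>
    proof -
      have f: "finite (Z \<omega>)" using point_processD(1)[OF Z w] .
      have "(\<Sum>x\<in>Z \<omega>. indicator A x :: ennreal) * (\<Sum>x\<in>Z \<omega>. indicator B x) =
         c (A \<times> B) \<omega> + (\<Sum>x\<in>Z \<omega>. indicator (A \<inter> B) x)"
        by (subst sum_square_offdiagonal[OF f]) (simp add: c_def indicator_times indicator_inter_arith)
      then show ?thesis
        by (simp add: indicator_sum_eq_card[OF f] of_nat_less_top[THEN less_imp_neq])
    qed
    then show ?thesis using A B by (subst measurable_cong) (auto intro!: cntm borel_measurable_minus_ennreal borel_measurable_times_ennreal)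
  qed
  have all: "c C \<in> borel_measurable M \<and> (\<integral>\<^sup>+\<omega>. c C \<omega> \<partial>M) = emeasure \<nu> C" if "C \<in> sets \<nu>" for C
    using Int_stable_pair_measure_generator subset_UNIV[of ?G, folded Pow_UNIV] that[unfolded G]
  proof (induction rule: sigma_sets_induct_disjoint)
    case (basic C)
    then obtain A B where C: "C = A \<times> B" "A \<in> sets borel" "B \<in> sets borel" by auto
    show ?case using rm[OF C(2,3)] rect[OF C(2,3)]
      by (simp add: C(1) factorial_moment_def c_def[abs_def])
  next
    case empty
    show ?case by (simp add: c_def[abs_def])
  next
    case (compl C)
    have C: "C \<in> sets \<nu>" using compl G by simp
    have U: "c UNIV \<in> borel_measurable M" "(\<integral>\<^sup>+\<omega>. c UNIV \<omega> \<partial>M) = emeasure \<nu> UNIV"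
      using rm[of UNIV UNIV] rect[of UNIV UNIV] by (auto simp: factorial_moment_def c_def[abs_def])
    have add: "c UNIV \<omega> = c C \<omega> + c (UNIV - C) \<omega>" for \<omega>
      unfolding c_def sum.distrib[symmetric] by (rule sum.cong) (auto simp: indicator_def)
    have "c (UNIV - C) \<omega> = c UNIV \<omega> - c C \<omega>" if "\<omega> \<in> space M" for \<omega>
    proof -
      have "c C \<omega> < top" unfolding c_def using cfin[OF that] by (simp add: indicator_sum_eq_card of_nat_less_top)
      then show ?thesis unfolding add by simp
    qed
    then have m: "c (UNIV - C) \<in> borel_measurable M"
      using U compl
      by (subst measurable_cong[where g = "\<lambda>\<omega>. c UNIV \<omega> - c C \<omega>"]) (auto intro!: borel_measurable_minus_ennreal)
    have "emeasure \<nu> C + emeasure \<nu> (UNIV - C) = emeasure \<nu> UNIV"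
      using C sets.compl_sets[OF C] by (subst plus_emeasure) (auto simp: space)
    also have "\<dots> = emeasure \<nu> C + (\<integral>\<^sup>+\<omega>. c (UNIV - C) \<omega> \<partial>M)"
      using compl m unfolding U(2)[symmetric] add by (subst nn_integral_add) auto
    finally have "emeasure \<nu> (UNIV - C) = (\<integral>\<^sup>+\<omega>. c (UNIV - C) \<omega> \<partial>M)"
      using fin emeasure_mono[of C UNIV \<nu>] sets.top[of \<nu>]
      by (auto simp: ennreal_add_left_cancel space top_unique)
    with m show ?case by simp
  next
    case (union C)
    have "c (\<Union>i. C i) \<omega> = (\<Sum>i. c (C i) \<omega>)" for \<omega>
      unfolding c_def suminf_indicator[OF union(1), symmetric]
      by (rule suminf_sum[symmetric]) simp
    moreover have "(\<Sum>i. emeasure \<nu> (C i)) = emeasure \<nu> (\<Union>i. C i)"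
      using union G by (intro suminf_emeasure) auto
    moreover have [measurable]: "c (C i) \<in> borel_measurable M" for i
      using union(3) by blast
    ultimately show ?case
      using union(3) by (simp add: nn_integral_suminf)
  qed
  show ?thesis
    using all cfin by (simp add: has_mean_measure_def space c_def[abs_def])
qed

section \<open>Moments of sums over a point process with a pair correlation function\<close>

lemma lborel_prod_integral:
  fixes a b :: "'a::euclidean_space \<Rightarrow> real"
  assumes a: "integrable lborel a" and b: "integrable lborel b"
  shows "integrable lborel (\<lambda>p. a (fst p) * b (snd p))"
    and "(LINT p|lborel. a (fst p) * b (snd p)) = integral\<^sup>L lborel a * integral\<^sup>L lborel b"
proof -
  have [measurable]: "a \<in> borel_measurable borel" "b \<in> borel_measurable borel"
    using a b by (auto dest: borel_measurable_integrable)
  have "integrable (lborel \<Otimes>\<^sub>M lborel) (\<lambda>p. a (fst p) * b (snd p))"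
    using a b by (intro lborel_pair.Fubini_integrable) (auto simp: abs_mult)
  then show i: "integrable lborel (\<lambda>p. a (fst p) * b (snd p))" by (simp add: lborel_prod)
  then have "(LINT p|lborel. a (fst p) * b (snd p)) = (LINT u|lborel. LINT v|lborel. a u * b v)"
    using lborel_pair.integral_fst'[of "\<lambda>p. a (fst p) * b (snd p)"] by (simp add: lborel_prod)
  then show "(LINT p|lborel. a (fst p) * b (snd p)) = integral\<^sup>L lborel a * integral\<^sup>L lborel b"
    by simp
qed

lemma integrable_mult_bounded:
  fixes f w :: "'a \<Rightarrow> real"
  assumes w: "integrable N w" and f: "f \<in> borel_measurable N" and C: "\<And>x. \<bar>f x\<bar> \<le> C"
  shows "integrable N (\<lambda>x. f x * w x)"
proof (rule Bochner_Integration.integrable_bound)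
  show "integrable N (\<lambda>x. C * w x)" using w by simp
  show "AE x in N. norm (f x * w x) \<le> norm (C * w x)"
  proof (intro AE_I2)
    show "norm (f x * w x) \<le> norm (C * w x)" for x
      using mult_right_mono[OF order_trans[OF C[of x] abs_ge_self[of C]], of "\<bar>w x\<bar>"]
      by (simp add: abs_mult)
  qed
qed (use w f in auto)

text \<open>
  The setting shared by the two kinds of processes: on \<open>S\<close> the intensity is positive and
  integrable, and the pair correlation function is bounded above.
\<close>
locale pcf_process = prob_space M for M :: "'w measure" +
  fixes S :: "'a::euclidean_space set" and \<kappa> :: "'a \<Rightarrow> real" and g :: "'a \<Rightarrow> 'a \<Rightarrow> real"
    and Z :: "'w \<Rightarrow> 'a set"
  assumes S[measurable]: "S \<in> sets borel" and Z: "has_pair_correlation M S \<kappa> g Z"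
    and int: "set_integrable lborel S \<kappa>" and pos: "\<And>u. u \<in> S \<Longrightarrow> 0 < \<kappa> u"
    and g: "bdd_above ((\<lambda>(u, v). g u v) ` (S \<times> S))"
begin

abbreviation "cov_integral f h \<equiv>
  (LINT u:S|lborel. LINT v:S|lborel. f u * h v * \<kappa> u * \<kappa> v * (g u v - 1))"

text \<open>
  On \<open>S \<times> S\<close> the density \<open>\<kappa>(u) \<kappa>(v) g(u, v)\<close> is the second-order product density, hence measurable
  and nonnegative, and it is dominated by a multiple of the integrable \<open>\<kappa>(u) \<kappa>(v)\<close>. Fubini's
  theorem can therefore be used freely below.
\<close>
lemma pair_correlation_integrable:
  shows "integrable lborel (\<lambda>p. indicator (S \<times> S) p * (\<kappa> (fst p) * \<kappa> (snd p)))"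
    and "integrable lborel (\<lambda>p. indicator (S \<times> S) p * (\<kappa> (fst p) * \<kappa> (snd p) * g (fst p) (snd p)))"
proof -
  obtain \<kappa>2 where D: "has_second_order_density M S \<kappa>2 Z"
    and g_eq: "\<And>u v. u \<in> S \<Longrightarrow> v \<in> S \<Longrightarrow> g u v = \<kappa>2 u v / (\<kappa> u * \<kappa> v)"
    using Z unfolding has_pair_correlation_def by blast
  obtain C0 where "\<And>u v. u \<in> S \<Longrightarrow> v \<in> S \<Longrightarrow> g u v \<le> C0"
    using g unfolding bdd_above_def by fastforce
  then have C: "\<And>u v. u \<in> S \<Longrightarrow> v \<in> S \<Longrightarrow> g u v \<le> max 0 C0" by (meson max.coboundedI2)
  define k where "k p = indicator (S \<times> S) p * (\<kappa> (fst p) * \<kappa> (snd p))" for p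
  define k2 where "k2 p = indicator (S \<times> S) p * (\<kappa> (fst p) * \<kappa> (snd p) * g (fst p) (snd p))" for p
  have k2_eq: "k2 p = indicator (S \<times> S) p * \<kappa>2 (fst p) (snd p)" for p
    using pos[of "fst p"] pos[of "snd p"] g_eq[of "fst p" "snd p"]
    by (cases p) (auto simp: k2_def indicator_def)
  have k2m: "k2 \<in> borel_measurable borel"
    using D unfolding k2_eq[abs_def]
    by (simp add: has_second_order_density_def set_borel_measurable_def case_prod_unfold)
  have k2C: "0 \<le> k2 p \<and> k2 p \<le> max 0 C0 * k p" for p
  proof (cases "p \<in> S \<times> S")
    case True
    then have S: "fst p \<in> S" "snd p \<in> S" by auto
    have "0 \<le> \<kappa>2 (fst p) (snd p)" using D S by (simp add: has_second_order_density_def)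
    moreover have "\<kappa> (fst p) * \<kappa> (snd p) * g (fst p) (snd p) \<le> \<kappa> (fst p) * \<kappa> (snd p) * max 0 C0"
      by (intro mult_left_mono C S) (use pos[OF S(1)] pos[OF S(2)] in simp)
    ultimately show ?thesis using k2_eq[of p] True by (simp add: k2_def k_def mult_ac)
  qed (simp add: k2_def k_def)
  have "integrable lborel (\<lambda>u. indicator S u * \<kappa> u)" using int by (simp add: set_integrable_def)
  from lborel_prod_integral(1)[OF this this] show k: "integrable lborel k"
    unfolding k_def[abs_def] by (simp add: indicator_times mult_ac)
  show "integrable lborel k2"
  proof (rule Bochner_Integration.integrable_bound)
    show "integrable lborel (\<lambda>p. max 0 C0 * k p)" using k by simp
    show "AE p in lborel. norm (k2 p) \<le> norm (max 0 C0 * k p)"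
    proof (intro AE_I2)
      show "norm (k2 p) \<le> norm (max 0 C0 * k p)" for p
        using k2C[of p] unfolding real_norm_def by linarith
    qed
  qed (use k2m in simp)
qed

text \<open>
  Rewriting the iterated integral as an integral over the product makes it bilinear in \<open>f\<close> and \<open>h\<close>
  without concern for the integrability of the inner integrals.
\<close>
lemma pair_correlation_double_integral:
  assumes f: "f \<in> borel_measurable borel" "\<And>u. \<bar>f u\<bar> \<le> K"
    and h: "h \<in> borel_measurable borel" "\<And>u. \<bar>h u\<bar> \<le> K"
  defines "q \<equiv> \<lambda>p. indicator (S \<times> S) p * (\<kappa> (fst p) * \<kappa> (snd p) * (g (fst p) (snd p) - 1))"
  shows "integrable lborel (\<lambda>p. f (fst p) * h (snd p) * q p)"
    and "cov_integral f h =
      (LINT p|lborel. f (fst p) * h (snd p) * q p)"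
proof -
  have q: "integrable lborel q"
  proof -
    have q_eq: "q = (\<lambda>p. indicator (S \<times> S) p * (\<kappa> (fst p) * \<kappa> (snd p) * g (fst p) (snd p)) -
      indicator (S \<times> S) p * (\<kappa> (fst p) * \<kappa> (snd p)))"
      by (simp add: q_def algebra_simps)
    show ?thesis
      unfolding q_eq using pair_correlation_integrable by (intro Bochner_Integration.integrable_diff)
  qed
  show i: "integrable lborel (\<lambda>p. f (fst p) * h (snd p) * q p)"
  proof (rule integrable_mult_bounded[OF q])
    have [measurable]: "f \<in> borel_measurable borel" "h \<in> borel_measurable borel" using f h by auto
    have "(\<lambda>p. f (fst p) * h (snd p)) \<in> borel_measurable (borel \<Otimes>\<^sub>M borel)" by measurable
    then show "(\<lambda>p. f (fst p) * h (snd p)) \<in> borel_measurable lborel" by (simp add: borel_prod)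
    show "\<bar>f (fst p) * h (snd p)\<bar> \<le> K * K" for p
      unfolding abs_mult using f(2) h(2) order_trans[OF abs_ge_zero f(2)] by (intro mult_mono) auto
  qed
  have "(LINT p|lborel. f (fst p) * h (snd p) * q p) = (LINT u|lborel. LINT v|lborel. f u * h v * q (u, v))"
    using i lborel_pair.integral_fst'[of "\<lambda>p. f (fst p) * h (snd p) * q p"] by (simp add: lborel_prod)
  also have "\<dots> = cov_integral f h"
    unfolding set_lebesgue_integral_def
  proof (intro Bochner_Integration.integral_cong refl)
    fix u
    have eq: "f u * h v * q (u, v) = indicator S u * (indicator S v *\<^sub>R (f u * h v * \<kappa> u * \<kappa> v * (g u v - 1)))" for v
      by (auto simp: q_def indicator_def algebra_simps)
    show "(LINT v|lborel. f u * h v * q (u, v)) =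
      indicator S u *\<^sub>R (LINT v|lborel. indicator S v *\<^sub>R (f u * h v * \<kappa> u * \<kappa> v * (g u v - 1)))"
      unfolding eq by simp
  qed
  finally show "cov_integral f h =
      (LINT p|lborel. f (fst p) * h (snd p) * q p)" by simp
qed

text \<open>
  The product of two sums over \<open>Z\<close> is a sum over distinct pairs plus a sum over points; Campbell's
  formula evaluates both, and the product of the means is the part of the pair integral with
  \<open>g\<close> replaced by 1. The formula is stated for two functions because the symmetry of its left-hand
  side later yields the symmetry of \<open>V\<close>.
\<close>
lemma pair_correlation_covariance:
  assumes f[measurable]: "f \<in> borel_measurable borel" and fK: "\<And>u. \<bar>f u\<bar> \<le> K"
    and h[measurable]: "h \<in> borel_measurable borel" and hK: "\<And>u. \<bar>h u\<bar> \<le> K"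
  shows "integrable M (\<lambda>\<omega>. (\<Sum>x\<in>Z \<omega>. f x) * (\<Sum>x\<in>Z \<omega>. h x))"
    and "integrable M (\<lambda>\<omega>. \<Sum>x\<in>Z \<omega>. f x)"
    and "(LINT \<omega>|M. (\<Sum>x\<in>Z \<omega>. f x)) = (LINT u:S|lborel. f u * \<kappa> u)"
    and "(LINT \<omega>|M. (\<Sum>x\<in>Z \<omega>. f x) * (\<Sum>x\<in>Z \<omega>. h x)) =
      (LINT u:S|lborel. f u * \<kappa> u) * (LINT u:S|lborel. h u * \<kappa> u) +
      (LINT u:S|lborel. f u * h u * \<kappa> u) +
      cov_integral f h"
proof -
  obtain \<kappa>2 where I: "has_intensity M S \<kappa> Z" and D: "has_second_order_density M S \<kappa>2 Z"
    and g_eq: "\<And>u v. u \<in> S \<Longrightarrow> v \<in> S \<Longrightarrow> g u v = \<kappa>2 u v / (\<kappa> u * \<kappa> v)"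
    using Z unfolding has_pair_correlation_def by blast
  have pp: "point_process M S Z" using I by (simp add: has_intensity_def)
  define k1 where "k1 u = indicator S u * \<kappa> u" for u
  define k2 where "k2 p = indicator (S \<times> S) p * (\<kappa> (fst p) * \<kappa> (snd p) * g (fst p) (snd p))" for p
  have k1i: "integrable lborel k1" using int by (simp add: set_integrable_def k1_def[abs_def])
  then have k1m[measurable]: "k1 \<in> borel_measurable borel" by (auto dest: borel_measurable_integrable)
  have k10: "0 \<le> k1 u" for u using pos[of u] by (auto simp: k1_def indicator_def less_imp_le)
  have k2_eq: "k2 p = indicator (S \<times> S) p * \<kappa>2 (fst p) (snd p)" for p
    using pos[of "fst p"] pos[of "snd p"] g_eq[of "fst p" "snd p"]
    by (cases p) (auto simp: k2_def indicator_def)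
  have k2i: "integrable lborel k2"
    using pair_correlation_integrable(2) by (simp add: k2_def[abs_def])
  then have k2m[measurable]: "k2 \<in> borel_measurable borel" by (auto dest: borel_measurable_integrable)
  have k20: "0 \<le> k2 p" for p
    unfolding k2_eq using D by (auto simp: has_second_order_density_def indicator_def)
  define \<nu>1 where "\<nu>1 = density lborel (\<lambda>u. ennreal (k1 u))"
  define \<nu>2 where "\<nu>2 = density lborel (\<lambda>p. ennreal (k2 p))"
  have A1: "has_mean_measure M Z \<nu>1"
    using point_process_mean_measure[OF I S] by (simp add: \<nu>1_def k1_def)
  have A2: "has_mean_measure M (\<lambda>\<omega>. Z \<omega> \<times> Z \<omega> - Id) \<nu>2"
  proof (rule offdiagonal_mean_measure[OF pp])
    show "sets \<nu>2 = sets borel" by (simp add: \<nu>2_def)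
    show "emeasure \<nu>2 UNIV < \<infinity>"
      using k2i k20 by (simp add: \<nu>2_def emeasure_density nn_integral_eq_integral)
    fix B1 B2 :: "'a set" assume [measurable]: "B1 \<in> sets borel" "B2 \<in> sets borel"
    have [measurable]: "B1 \<times> B2 \<in> sets borel" by (intro borel_Times) simp_all
    have "factorial_moment M Z (B1 \<times> B2) = factorial_moment M Z ((B1 \<inter> S) \<times> (B2 \<inter> S))"
      by (rule factorial_moment_Int[OF pp])
    also have "\<dots> = (\<integral>\<^sup>+u\<in>B1 \<inter> S. (\<integral>\<^sup>+v\<in>B2 \<inter> S. ennreal (\<kappa>2 u v) \<partial>lborel) \<partial>lborel)"
      using D by (simp add: has_second_order_density_def)
    also have "\<dots> = (\<integral>\<^sup>+u. \<integral>\<^sup>+v. ennreal (k2 (u, v)) * indicator (B1 \<times> B2) (u, v) \<partial>lborel \<partial>lborel)"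
      by (intro nn_integral_cong) (auto simp: k2_eq indicator_def intro!: nn_integral_cong)
    also have "\<dots> = (\<integral>\<^sup>+p. ennreal (k2 p) * indicator (B1 \<times> B2) p \<partial>(lborel \<Otimes>\<^sub>M lborel))"
      by (subst lborel.nn_integral_fst) (simp_all add: lborel_prod)
    also have "\<dots> = emeasure \<nu>2 (B1 \<times> B2)"
      by (simp add: \<nu>2_def emeasure_density lborel_prod borel_Times)
    finally show "factorial_moment M Z (B1 \<times> B2) = emeasure \<nu>2 (B1 \<times> B2)" .
  qed
  define fh where "fh p = f (fst p) * h (snd p)" for p
  have fhm[measurable]: "fh \<in> borel_measurable borel"
  proof -
    have "(\<lambda>p. f (fst p) * h (snd p)) \<in> borel_measurable (borel \<Otimes>\<^sub>M borel)" by measurable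
    then show ?thesis by (simp add: borel_prod fh_def[abs_def])
  qed
  have K2: "\<bar>f u * h v\<bar> \<le> K * K" for u v
    unfolding abs_mult using fK hK order_trans[OF abs_ge_zero fK] by (intro mult_mono) auto
  have d1: "integrable \<nu>1 F" "integral\<^sup>L \<nu>1 F = (LINT u:S|lborel. F u * \<kappa> u)"
    if [measurable]: "F \<in> borel_measurable borel" and C: "\<And>u. \<bar>F u\<bar> \<le> C" for F :: "'a \<Rightarrow> real" and C
  proof -
    have "integrable lborel (\<lambda>u. F u * k1 u)" by (rule integrable_mult_bounded[OF k1i _ C]) simp
    then show "integrable \<nu>1 F" using k10 by (simp add: \<nu>1_def integrable_density mult.commute)
    have "integral\<^sup>L \<nu>1 F = (LINT u|lborel. k1 u * F u)"
      using k10 by (simp add: \<nu>1_def integral_density)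
    then show "integral\<^sup>L \<nu>1 F = (LINT u:S|lborel. F u * \<kappa> u)"
      by (simp add: set_lebesgue_integral_def k1_def mult_ac)
  qed
  have fki: "integrable lborel (\<lambda>u. F u * k1 u)"
    if "F \<in> borel_measurable borel" "\<And>u. \<bar>F u\<bar> \<le> K" for F :: "'a \<Rightarrow> real"
    using that by (intro integrable_mult_bounded[OF k1i]) auto
  have fki_eq: "(LINT u|lborel. F u * k1 u) = (LINT u:S|lborel. F u * \<kappa> u)" for F :: "'a \<Rightarrow> real"
    by (simp add: set_lebesgue_integral_def k1_def mult_ac)
  have kh: "integrable lborel (\<lambda>p. fh p * k2 p)"
  proof (rule integrable_mult_bounded[OF k2i])
    show "\<bar>fh p\<bar> \<le> K * K" for p unfolding fh_def by (rule K2)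
  qed simp
  have h2: "integrable \<nu>2 fh" "integral\<^sup>L \<nu>2 fh = (LINT p|lborel. fh p * k2 p)"
    using k20 kh by (simp_all add: \<nu>2_def integrable_density integral_density mult.commute)
  note c1 = campbell_integral[OF A1 d1(1)[OF f fK]]
    and c2 = campbell_integral[OF A1 d1(1)[of "\<lambda>u. f u * h u", OF _ K2]]
    and c3 = campbell_integral[OF A2 h2(1)]
  have prod: "(\<Sum>x\<in>Z \<omega>. f x) * (\<Sum>x\<in>Z \<omega>. h x) = (\<Sum>p\<in>Z \<omega> \<times> Z \<omega> - Id. fh p) + (\<Sum>x\<in>Z \<omega>. f x * h x)"
    if "\<omega> \<in> space M" for \<omega>
    unfolding sum_square_offdiagonal[OF point_processD(1)[OF pp that]] by (simp add: fh_def)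
  show "integrable M (\<lambda>\<omega>. (\<Sum>x\<in>Z \<omega>. f x) * (\<Sum>x\<in>Z \<omega>. h x))"
    using c2 c3 by (subst Bochner_Integration.integrable_cong[OF refl prod]) auto
  show "integrable M (\<lambda>\<omega>. \<Sum>x\<in>Z \<omega>. f x)" by (rule c1)
  show "(LINT \<omega>|M. (\<Sum>x\<in>Z \<omega>. f x)) = (LINT u:S|lborel. f u * \<kappa> u)"
    using c1(2) d1(2)[OF f fK] by simp
  have "(LINT \<omega>|M. (\<Sum>x\<in>Z \<omega>. f x) * (\<Sum>x\<in>Z \<omega>. h x)) =
      (LINT \<omega>|M. (\<Sum>p\<in>Z \<omega> \<times> Z \<omega> - Id. fh p) + (\<Sum>x\<in>Z \<omega>. f x * h x))"
    by (rule Bochner_Integration.integral_cong[OF refl prod])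
  also have "\<dots> = (LINT p|lborel. fh p * k2 p) + (LINT u:S|lborel. f u * h u * \<kappa> u)"
    using c2 c3 h2 d1(2)[of "\<lambda>u. f u * h u", OF _ K2] by simp
  also have "(LINT p|lborel. fh p * k2 p) =
      cov_integral f h +
      (LINT u:S|lborel. f u * \<kappa> u) * (LINT u:S|lborel. h u * \<kappa> u)"
  proof -
    note di = pair_correlation_double_integral[OF f fK h hK]
      and pi = lborel_prod_integral[OF fki[OF f fK] fki[OF h hK]]
    have "(LINT p|lborel. fh p * k2 p) =
      (LINT p|lborel. f (fst p) * h (snd p) * (indicator (S \<times> S) p * (\<kappa> (fst p) * \<kappa> (snd p) * (g (fst p) (snd p) - 1)))
        + (f (fst p) * k1 (fst p)) * (h (snd p) * k1 (snd p)))"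
      by (rule Bochner_Integration.integral_cong)
        (auto simp: fh_def k2_def k1_def indicator_def algebra_simps)
    then show ?thesis using di pi by (simp add: fki_eq)
  qed
  finally show "(LINT \<omega>|M. (\<Sum>x\<in>Z \<omega>. f x) * (\<Sum>x\<in>Z \<omega>. h x)) =
      (LINT u:S|lborel. f u * \<kappa> u) * (LINT u:S|lborel. h u * \<kappa> u) +
      (LINT u:S|lborel. f u * h u * \<kappa> u) +
      cov_integral f h" by simp
qed

lemma pair_correlation_moments:
  assumes f: "f \<in> borel_measurable borel" "\<And>u. \<bar>f u\<bar> \<le> K"
  shows "integrable M (\<lambda>\<omega>. (\<Sum>x\<in>Z \<omega>. f x)\<^sup>2)"
    and "(LINT \<omega>|M. (\<Sum>x\<in>Z \<omega>. f x)) = (LINT u:S|lborel. f u * \<kappa> u)"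
    and "variance (\<lambda>\<omega>. \<Sum>x\<in>Z \<omega>. f x) =
      (LINT u:S|lborel. (f u)\<^sup>2 * \<kappa> u) +
      cov_integral f f"
proof -
  note cov = pair_correlation_covariance[OF f f]
  show sq: "integrable M (\<lambda>\<omega>. (\<Sum>x\<in>Z \<omega>. f x)\<^sup>2)" using cov(1) by (simp add: power2_eq_square)
  show mean: "(LINT \<omega>|M. (\<Sum>x\<in>Z \<omega>. f x)) = (LINT u:S|lborel. f u * \<kappa> u)" by (rule cov(3))
  show "variance (\<lambda>\<omega>. \<Sum>x\<in>Z \<omega>. f x) =
      (LINT u:S|lborel. (f u)\<^sup>2 * \<kappa> u) +
      cov_integral f f"
    using cov(4) variance_eq[OF cov(2) sq] unfolding mean power2_eq_square by simp
qed

end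

section \<open>Poisson processes have pair correlation function one\<close>

text \<open>
  The Poisson masses are summed directly so that the rate 0 of a null set is covered.
\<close>
lemma nn_integral_poisson:
  fixes N :: "'w \<Rightarrow> nat" and \<phi> :: "nat \<Rightarrow> real"
  assumes "prob_space M" and N[measurable]: "N \<in> measurable M (count_space UNIV)"
    and law: "\<And>k. measure M {\<omega> \<in> space M. N \<omega> = k} = r ^ k / fact k * exp (- r)"
    and \<phi>: "\<And>k. 0 \<le> \<phi> k" and sums: "(\<lambda>k. \<phi> k * (r ^ k / fact k)) sums (s * exp r)"
  shows "(\<integral>\<^sup>+\<omega>. ennreal (\<phi> (N \<omega>)) \<partial>M) = ennreal s"
proof -
  interpret prob_space M by fact
  let ?A = "\<lambda>k. {\<omega> \<in> space M. N \<omega> = k}"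
  have s: "(\<lambda>k. \<phi> k * measure M (?A k)) sums s"
    using sums_mult2[OF sums, of "exp (- r)"]
    by (simp add: law mult.assoc exp_add[symmetric])
  have "(\<integral>\<^sup>+\<omega>. ennreal (\<phi> (N \<omega>)) \<partial>M) =
      (\<integral>\<^sup>+\<omega>. (\<Sum>k. ennreal (\<phi> k) * indicator (?A k) \<omega>) \<partial>M)"
    by (intro nn_integral_cong, subst suminf_cmult_indicator) (auto simp: disjoint_family_on_def)
  also have "\<dots> = (\<Sum>k. ennreal (\<phi> k) * emeasure M (?A k))"
    by (subst nn_integral_suminf) (auto simp: nn_integral_cmult_indicator)
  also have "\<dots> = (\<Sum>k. ennreal (\<phi> k * measure M (?A k)))"
    using \<phi> by (simp add: emeasure_eq_measure ennreal_mult)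
  also have "\<dots> = ennreal s"
    using s \<phi> by (intro suminf_ennreal_eq) auto
  finally show ?thesis .
qed

lemma poisson_sums:
  fixes r :: real
  shows "(\<lambda>k. real k * (r ^ k / fact k)) sums (r * exp r)"
    and "(\<lambda>k. real (k * (k - 1)) * (r ^ k / fact k)) sums (r\<^sup>2 * exp r)"
proof -
  have e: "(\<lambda>k. r ^ k / fact k) sums exp r"
    using exp_converges[of r] by (simp add: divide_inverse mult.commute)
  have "(\<lambda>k. real (Suc k) * (r ^ Suc k / fact (Suc k))) sums (r * exp r)"
    using sums_mult[OF e, of r] by (simp add: field_simps del: of_nat_Suc)
  from sums_Suc[OF this] show 1: "(\<lambda>k. real k * (r ^ k / fact k)) sums (r * exp r)" by simp
  have "(\<lambda>k. real (Suc k * (Suc k - 1)) * (r ^ Suc k / fact (Suc k))) sums (r * (r * exp r))"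
  proof -
    have "real (Suc k * (Suc k - 1)) * (r ^ Suc k / fact (Suc k)) = r * (real k * (r ^ k / fact k))" for k
      by (simp add: fact_Suc divide_simps del: of_nat_Suc, simp add: algebra_simps)
    then show ?thesis using sums_mult[OF 1, of r] by simp
  qed
  from sums_Suc[OF this] show "(\<lambda>k. real (k * (k - 1)) * (r ^ k / fact k)) sums (r\<^sup>2 * exp r)"
    by (simp add: power2_eq_square mult.assoc)
qed

text \<open>
  For a rectangle \<open>B\<^sub>1 \<times> B\<^sub>2\<close> split \<open>B\<^sub>1\<close> and \<open>B\<^sub>2\<close> into \<open>A = B\<^sub>1 - B\<^sub>2\<close>, \<open>B = B\<^sub>2 - B\<^sub>1\<close> and
  \<open>C = B\<^sub>1 \<inter> B\<^sub>2\<close>. The number of pairs of distinct points in the rectangle is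
  \<open>ab + ac + cb + c(c - 1)\<close> in terms of the three independent counts, and since the second
  factorial moment of a Poisson variable is the square of its mean, the expectation factorises.
\<close>
lemma poisson_process_pair_correlation:
  fixes \<kappa> :: "'a::euclidean_space \<Rightarrow> real"
  assumes M: "prob_space M" and Z: "poisson_process M S \<kappa> Z"
    and S[measurable]: "S \<in> sets borel" and pos: "\<And>u. u \<in> S \<Longrightarrow> 0 < \<kappa> u"
  shows "has_pair_correlation M S \<kappa> (\<lambda>u v. 1) Z"
proof -
  interpret prob_space M by fact
  have pp: "point_process M S Z" and int: "set_integrable lborel S \<kappa>"
    using Z by (auto simp: poisson_process_def)
  have [measurable]: "(\<lambda>u. indicator S u * \<kappa> u) \<in> borel_measurable borel"
    using int by (auto simp: set_integrable_def dest: borel_measurable_integrable)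
  define \<Lambda> where "\<Lambda> B = (LINT u:B|lborel. \<kappa> u)" for B
  have intB: "set_integrable lborel B \<kappa>" if "B \<in> sets borel" "B \<subseteq> S" for B
    using int that by (auto intro: set_integrable_subset)
  have \<Lambda>: "(\<integral>\<^sup>+u\<in>B. ennreal (\<kappa> u) \<partial>lborel) = ennreal (\<Lambda> B)" "0 \<le> \<Lambda> B"
    if B: "B \<in> sets borel" "B \<subseteq> S" for B
  proof -
    have nn: "0 \<le> indicator B u * \<kappa> u" for u
      using B pos[of u] by (auto simp: indicator_def less_imp_le)
    have "(\<integral>\<^sup>+u\<in>B. ennreal (\<kappa> u) \<partial>lborel) = (\<integral>\<^sup>+u. ennreal (indicator B u * \<kappa> u) \<partial>lborel)"
      by (intro nn_integral_cong) (auto simp: indicator_def)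
    also have "\<dots> = ennreal (\<Lambda> B)"
      using intB[OF B] nn unfolding \<Lambda>_def set_lebesgue_integral_def set_integrable_def
      by (subst nn_integral_eq_integral) auto
    finally show "(\<integral>\<^sup>+u\<in>B. ennreal (\<kappa> u) \<partial>lborel) = ennreal (\<Lambda> B)" .
    show "0 \<le> \<Lambda> B" unfolding \<Lambda>_def set_lebesgue_integral_def
      using nn by (auto intro!: Bochner_Integration.integral_nonneg)
  qed
  define n where "n B \<omega> = card (Z \<omega> \<inter> B)" for B \<omega>
  define e where "e B \<omega> = ennreal (real (n B \<omega>))" for B \<omega>
  have n[measurable]: "n B \<in> measurable M (count_space UNIV)" if "B \<in> sets borel" for B
    using point_process_count_measurable[OF pp that] by (simp add: n_def[abs_def])
  have law: "measure M {\<omega> \<in> space M. n B \<omega> = k} = \<Lambda> B ^ k / fact k * exp (- \<Lambda> B)"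
    if "B \<in> sets borel" "B \<subseteq> S" for B k
    using Z that unfolding poisson_process_def n_def \<Lambda>_def by blast
  have m1: "(\<integral>\<^sup>+\<omega>. e B \<omega> \<partial>M) = ennreal (\<Lambda> B)"
    if B: "B \<in> sets borel" "B \<subseteq> S" for B
    unfolding e_def by (rule nn_integral_poisson[OF M n[OF B(1)] law[OF B] _ poisson_sums(1)]) simp
  have m2: "(\<integral>\<^sup>+\<omega>. ennreal (real (n B \<omega> * (n B \<omega> - 1))) \<partial>M) = ennreal ((\<Lambda> B)\<^sup>2)"
    if B: "B \<in> sets borel" "B \<subseteq> S" for B
    by (rule nn_integral_poisson[OF M n[OF B(1)] law[OF B] _ poisson_sums(2)]) simp
  have m11: "(\<integral>\<^sup>+\<omega>. e A \<omega> * e B \<omega> \<partial>M) = ennreal (\<Lambda> A * \<Lambda> B)"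
    if A: "A \<in> sets borel" "A \<subseteq> S" and B: "B \<in> sets borel" "B \<subseteq> S" and disj: "A \<inter> B = {}" for A B
  proof -
    \<comment> \<open>Independence is assumed for infinite disjoint families, so the pair is padded with empty sets.\<close>
    define F where "F = (\<lambda>j::nat. if j = 0 then A else if j = 1 then B else {})"
    have "indep_vars (\<lambda>_. count_space UNIV) (\<lambda>j \<omega>. card (Z \<omega> \<inter> F j)) UNIV"
    proof -
      have "\<forall>j. F j \<in> sets borel \<and> F j \<subseteq> S" "disjoint_family F"
        using A B disj by (auto simp: F_def disjoint_family_on_def)
      then show ?thesis using Z unfolding poisson_process_def by blast
    qed
    then have "indep_vars (\<lambda>_. borel) (\<lambda>j \<omega>. ennreal (real (card (Z \<omega> \<inter> F j)))) UNIV"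
      by (rule indep_vars_compose2) simp
    then have "indep_vars (\<lambda>_. borel) (\<lambda>j \<omega>. ennreal (real (card (Z \<omega> \<inter> F j)))) {0,1}"
      by (rule indep_vars_subset) simp
    from indep_vars_nn_integral[OF _ this]
    have "(\<integral>\<^sup>+\<omega>. e A \<omega> * e B \<omega> \<partial>M) = ennreal (\<Lambda> A) * ennreal (\<Lambda> B)"
      using m1[OF A] m1[OF B] by (simp add: F_def e_def n_def)
    then show ?thesis using \<Lambda>[OF A] \<Lambda>[OF B] by (simp add: ennreal_mult)
  qed
  have fm: "factorial_moment M Z (B1 \<times> B2) = ennreal (\<Lambda> B1 * \<Lambda> B2)"
    if B1: "B1 \<in> sets borel" "B1 \<subseteq> S" and B2: "B2 \<in> sets borel" "B2 \<subseteq> S" for B1 B2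
  proof -
    let ?A = "B1 - B2" and ?B = "B2 - B1" and ?C = "B1 \<inter> B2"
    have sets: "?A \<in> sets borel" "?B \<in> sets borel" "?C \<in> sets borel" "?A \<subseteq> S" "?B \<subseteq> S" "?C \<subseteq> S"
      using B1 B2 by auto
    have pw: "(\<Sum>p\<in>Z \<omega> \<times> Z \<omega> - Id. indicator (B1 \<times> B2) p :: ennreal) =
       e ?A \<omega> * e ?B \<omega> + e ?A \<omega> * e ?C \<omega>
       + e ?C \<omega> * e ?B \<omega> + ennreal (real (n ?C \<omega> * (n ?C \<omega> - 1)))"
      if w: "\<omega> \<in> space M" for \<omega>
    proof -
      have f: "finite (Z \<omega>)" using point_processD(1)[OF pp w] .
      have c1: "card (Z \<omega> \<inter> B1) = n ?A \<omega> + n ?C \<omega>" and c2: "card (Z \<omega> \<inter> B2) = n ?B \<omega> + n ?C \<omega>"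
        using f unfolding n_def
        by (subst card_Un_disjoint[symmetric]; auto intro!: arg_cong[where f=card])+
      have "(\<Sum>x\<in>Z \<omega>. indicator B1 x :: nat) * (\<Sum>x\<in>Z \<omega>. indicator B2 x) =
         (\<Sum>p\<in>Z \<omega> \<times> Z \<omega> - Id. indicator (B1 \<times> B2) p) + (\<Sum>x\<in>Z \<omega>. indicator ?C x)"
        by (subst sum_square_offdiagonal[OF f]) (simp add: indicator_times indicator_inter_arith)
      then have "(n ?A \<omega> + n ?C \<omega>) * (n ?B \<omega> + n ?C \<omega>) =
         (\<Sum>p\<in>Z \<omega> \<times> Z \<omega> - Id. indicator (B1 \<times> B2) p) + n ?C \<omega>"
        using f by (simp add: indicator_sum_eq_card[OF f] c1 c2 n_def[of ?C])
      moreover have "(n ?A \<omega> + n ?C \<omega>) * (n ?B \<omega> + n ?C \<omega>) =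
        n ?A \<omega> * n ?B \<omega> + n ?A \<omega> * n ?C \<omega> + n ?C \<omega> * n ?B \<omega> + n ?C \<omega> * (n ?C \<omega> - 1) + n ?C \<omega>"
        by (cases "n ?C \<omega>") (auto simp: algebra_simps)
      ultimately have *: "(\<Sum>p\<in>Z \<omega> \<times> Z \<omega> - Id. indicator (B1 \<times> B2) p) =
        n ?A \<omega> * n ?B \<omega> + n ?A \<omega> * n ?C \<omega> + n ?C \<omega> * n ?B \<omega> + n ?C \<omega> * (n ?C \<omega> - 1)"
        by linarith
      have "(\<Sum>p\<in>Z \<omega> \<times> Z \<omega> - Id. indicator (B1 \<times> B2) p :: ennreal) =
        of_nat (\<Sum>p\<in>Z \<omega> \<times> Z \<omega> - Id. indicator (B1 \<times> B2) p)"
        using f by (simp add: indicator_sum_eq_card)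
      also have "\<dots> = of_nat (n ?A \<omega> * n ?B \<omega> + n ?A \<omega> * n ?C \<omega> + n ?C \<omega> * n ?B \<omega> + n ?C \<omega> * (n ?C \<omega> - 1))"
        by (simp only: *)
      finally show ?thesis by (simp add: e_def ennreal_of_nat_eq_real_of_nat ennreal_mult)
    qed
    have "factorial_moment M Z (B1 \<times> B2) =
       ennreal (\<Lambda> ?A * \<Lambda> ?B) + ennreal (\<Lambda> ?A * \<Lambda> ?C) + ennreal (\<Lambda> ?C * \<Lambda> ?B) + ennreal ((\<Lambda> ?C)\<^sup>2)"
    proof -
      have [measurable]: "n ?A \<in> measurable M (count_space UNIV)" "n ?B \<in> measurable M (count_space UNIV)"
        "n ?C \<in> measurable M (count_space UNIV)" using sets n by auto
      have "factorial_moment M Z (B1 \<times> B2) = (\<integral>\<^sup>+\<omega>. e ?A \<omega> * e ?B \<omega> + e ?A \<omega> * e ?C \<omega>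
       + e ?C \<omega> * e ?B \<omega> + ennreal (real (n ?C \<omega> * (n ?C \<omega> - 1))) \<partial>M)"
        unfolding factorial_moment_def by (intro nn_integral_cong pw)
      also have "\<dots> = ennreal (\<Lambda> ?A * \<Lambda> ?B) + ennreal (\<Lambda> ?A * \<Lambda> ?C) + ennreal (\<Lambda> ?C * \<Lambda> ?B) + ennreal ((\<Lambda> ?C)\<^sup>2)"
      proof -
        have "(\<integral>\<^sup>+\<omega>. e ?A \<omega> * e ?B \<omega> \<partial>M) = ennreal (\<Lambda> ?A * \<Lambda> ?B)"
          "(\<integral>\<^sup>+\<omega>. e ?A \<omega> * e ?C \<omega> \<partial>M) = ennreal (\<Lambda> ?A * \<Lambda> ?C)"
          "(\<integral>\<^sup>+\<omega>. e ?C \<omega> * e ?B \<omega> \<partial>M) = ennreal (\<Lambda> ?C * \<Lambda> ?B)"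
          using sets by (intro m11; auto)+
        then show ?thesis
          using m2[OF sets(3,6)] by (simp add: nn_integral_add e_def del: of_nat_mult)
      qed
      finally show ?thesis .
    qed
    also have "\<dots> = ennreal ((\<Lambda> ?A + \<Lambda> ?C) * (\<Lambda> ?B + \<Lambda> ?C))"
      using sets \<Lambda>(2)[of ?A] \<Lambda>(2)[of ?B] \<Lambda>(2)[of ?C]
      by (simp add: ennreal_plus[symmetric] power2_eq_square algebra_simps del: ennreal_plus)
    also have "\<Lambda> ?A + \<Lambda> ?C = \<Lambda> B1"
    proof -
      have "\<Lambda> (?A \<union> ?C) = \<Lambda> ?A + \<Lambda> ?C"
        unfolding \<Lambda>_def using sets by (intro set_integral_Un intB) auto
      moreover have "?A \<union> ?C = B1" by auto
      ultimately show ?thesis by simp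
    qed
    also have "\<Lambda> ?B + \<Lambda> ?C = \<Lambda> B2"
    proof -
      have "\<Lambda> (?B \<union> ?C) = \<Lambda> ?B + \<Lambda> ?C"
        unfolding \<Lambda>_def using sets by (intro set_integral_Un intB) auto
      moreover have "?B \<union> ?C = B2" by auto
      ultimately show ?thesis by simp
    qed
    finally show ?thesis .
  qed
  have I: "has_intensity M S \<kappa> Z"
    unfolding has_intensity_def
  proof (intro conjI ballI impI pp)
    show "set_borel_measurable borel S \<kappa>" by (simp add: set_borel_measurable_def)
    show "0 \<le> \<kappa> u" if "u \<in> S" for u using pos[OF that] by simp
    fix B :: "'a set" assume B: "B \<in> sets borel" "B \<subseteq> S"
    have "(\<integral>\<^sup>+\<omega>. (\<Sum>x\<in>Z \<omega>. indicator B x) \<partial>M) = (\<integral>\<^sup>+\<omega>. e B \<omega> \<partial>M)"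
      using point_processD(1)[OF pp]
      by (intro nn_integral_cong) (simp add: indicator_sum_eq_card e_def n_def ennreal_of_nat_eq_real_of_nat)
    then show "(\<integral>\<^sup>+\<omega>. (\<Sum>x\<in>Z \<omega>. indicator B x) \<partial>M) = (\<integral>\<^sup>+u\<in>B. ennreal (\<kappa> u) \<partial>lborel)"
      using \<Lambda>[OF B] m1[OF B] by simp
  qed
  have "has_second_order_density M S (\<lambda>u v. \<kappa> u * \<kappa> v) Z"
    unfolding has_second_order_density_def
  proof (intro conjI ballI impI pp)
    have "(\<lambda>p. (indicator S (fst p) * \<kappa> (fst p)) * (indicator S (snd p) * \<kappa> (snd p)))
        \<in> borel_measurable (borel \<Otimes>\<^sub>M borel)"
      by measurable
    then show "set_borel_measurable borel (S \<times> S) (\<lambda>(u, v). \<kappa> u * \<kappa> v)"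
      by (simp add: set_borel_measurable_def borel_prod indicator_times case_prod_unfold mult_ac)
    show "0 \<le> \<kappa> u * \<kappa> v" if "u \<in> S" "v \<in> S" for u v
      using pos[OF that(1)] pos[OF that(2)] by simp
    show "sigma_finite_measure (measure_of UNIV (sets borel) (factorial_moment M Z))"
    proof -
      \<comment> \<open>Should the set function fail to be a measure, then \<open>measure_of\<close> is the zero measure, so in
        either case the total mass is finite.\<close>
      have "factorial_moment M Z UNIV < \<infinity>"
        using factorial_moment_Int[OF pp, of UNIV UNIV] fm[of S S] by simp
      then have "finite_measure (measure_of UNIV (sets borel) (factorial_moment M Z))"
        by (intro finite_measureI) (auto simp: emeasure_measure_of_conv)
      then show ?thesis by (rule finite_measure.axioms(1))
    qed
    fix B1 B2 :: "'a set"
    assume B1: "B1 \<in> sets borel" "B1 \<subseteq> S" and B2: "B2 \<in> sets borel" "B2 \<subseteq> S"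
    have [measurable]: "(\<lambda>u. indicator B u * \<kappa> u) \<in> borel_measurable borel"
      if "B \<in> sets borel" "B \<subseteq> S" for B
      using intB[OF that] by (auto simp: set_integrable_def dest: borel_measurable_integrable)
    have meas: "(\<lambda>u. ennreal (\<kappa> u) * indicator B u) \<in> borel_measurable borel"
      if B: "B \<in> sets borel" "B \<subseteq> S" for B
    proof -
      have "(\<lambda>u. ennreal (indicator B u * \<kappa> u)) \<in> borel_measurable borel"
        using B by measurable
      moreover have "ennreal (indicator B u * \<kappa> u) = ennreal (\<kappa> u) * indicator B u" for u
        by (simp add: indicator_def)
      ultimately show ?thesis by simp
    qed
    have "(\<integral>\<^sup>+u\<in>B1. (\<integral>\<^sup>+v\<in>B2. ennreal (\<kappa> u * \<kappa> v) \<partial>lborel) \<partial>lborel) =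
      (\<integral>\<^sup>+u. (ennreal (\<kappa> u) * indicator B1 u) * (\<integral>\<^sup>+v\<in>B2. ennreal (\<kappa> v) \<partial>lborel) \<partial>lborel)"
    proof (intro nn_integral_cong)
      fix u
      have "(\<integral>\<^sup>+v\<in>B2. ennreal (\<kappa> u * \<kappa> v) \<partial>lborel) = ennreal (\<kappa> u) * (\<integral>\<^sup>+v\<in>B2. ennreal (\<kappa> v) \<partial>lborel)"
        if "u \<in> S"
      proof -
        have "(\<integral>\<^sup>+v\<in>B2. ennreal (\<kappa> u * \<kappa> v) \<partial>lborel) =
          (\<integral>\<^sup>+v. ennreal (\<kappa> u) * (ennreal (\<kappa> v) * indicator B2 v) \<partial>lborel)"
          using pos that B2 by (intro nn_integral_cong) (auto simp: indicator_def ennreal_mult less_imp_le subset_iff)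
        then show ?thesis using meas[OF B2] by (simp add: nn_integral_cmult)
      qed
      then show "(\<integral>\<^sup>+v\<in>B2. ennreal (\<kappa> u * \<kappa> v) \<partial>lborel) * indicator B1 u =
        (ennreal (\<kappa> u) * indicator B1 u) * (\<integral>\<^sup>+v\<in>B2. ennreal (\<kappa> v) \<partial>lborel)"
        using B1 by (auto simp: indicator_def)
    qed
    also have "\<dots> = ennreal (\<Lambda> B1 * \<Lambda> B2)"
      using meas[OF B1] \<Lambda>[OF B1] \<Lambda>[OF B2] by (simp add: nn_integral_multc ennreal_mult)
    finally show "factorial_moment M Z (B1 \<times> B2) =
      (\<integral>\<^sup>+u\<in>B1. (\<integral>\<^sup>+v\<in>B2. ennreal (\<kappa> u * \<kappa> v) \<partial>lborel) \<partial>lborel)"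
      using fm[OF B1 B2] by simp
  qed
  then show ?thesis
    using I pos unfolding has_pair_correlation_def
    by (intro conjI exI[of _ "\<lambda>u v. \<kappa> u * \<kappa> v"]) (auto simp: less_imp_neq[symmetric])
qed

section \<open>Characteristic functions and convergence in distribution\<close>

text \<open>The characteristic function of a law on a Euclidean space.\<close>
definition char_vec :: "'a::euclidean_space measure \<Rightarrow> 'a \<Rightarrow> complex" where
  "char_vec N a = (CLINT x|N. iexp (a \<bullet> x))"

text \<open>
  The phase \<open>b\<close> makes sines and constants instances of the first rule, so that the span is closed
  under products by the product formula for cosines.
\<close>
inductive trig_poly :: "('a::real_inner \<Rightarrow> real) \<Rightarrow> bool" where
  cos: "trig_poly (\<lambda>x. c * cos (a \<bullet> x + b))"
| add: "trig_poly f \<Longrightarrow> trig_poly g \<Longrightarrow> trig_poly (\<lambda>x. f x + g x)"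

lemma trig_poly_const: "trig_poly (\<lambda>x. c)"
  using trig_poly.cos[of c 0 0] by simp

lemma trig_poly_mult:
  assumes f: "trig_poly f" and g: "trig_poly g"
  shows "trig_poly (\<lambda>x. f x * g x)"
  using f
proof induction
  case (cos c a b)
  show ?case using g
  proof induction
    case (cos d a' b')
    have eq: "c * cos (a \<bullet> x + b) * (d * cos (a' \<bullet> x + b')) =
        c * d / 2 * cos ((a - a') \<bullet> x + (b - b')) + c * d / 2 * cos ((a + a') \<bullet> x + (b + b'))" for x
    proof -
      have "cos (a \<bullet> x + b) * cos (a' \<bullet> x + b') =
        (cos ((a - a') \<bullet> x + (b - b')) + cos ((a + a') \<bullet> x + (b + b'))) / 2"
        unfolding cos_times_cos by (simp add: inner_left_distrib inner_diff_left algebra_simps)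
      moreover have "c * u * (d * v) = c * d / 2 * p + c * d / 2 * q"
        if uv: "u * v = (p + q) / 2" for u v p q :: real
      proof -
        have "c * u * (d * v) = c * d * (u * v)" by simp
        then show ?thesis unfolding uv by (simp add: field_simps)
      qed
      ultimately show ?thesis by blast
    qed
    show ?case unfolding eq by (intro trig_poly.intros)
  next
    case (add g h)
    then show ?case by (simp add: distrib_left trig_poly.add)
  qed
next
  case (add f h)
  then show ?case by (simp add: distrib_right trig_poly.add)
qed

lemma trig_poly_continuous: "trig_poly f \<Longrightarrow> continuous_on S f"
  by (induction rule: trig_poly.induct) (auto intro!: continuous_intros)

lemma trig_poly_bounded:
  assumes "trig_poly f" obtains B where "0 < B" "\<And>x. \<bar>f x\<bar> \<le> B"
proof -
  from assms have "\<exists>B>0. \<forall>x. \<bar>f x\<bar> \<le> B"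
  proof induction
    case (cos c a b)
    have "\<bar>c * cos (a \<bullet> x + b)\<bar> \<le> \<bar>c\<bar> + 1" for x
      using mult_left_mono[OF abs_cos_le_one[of "a \<bullet> x + b"], of "\<bar>c\<bar>"] by (simp add: abs_mult)
    then show ?case by (intro exI[of _ "\<bar>c\<bar> + 1"]) auto
  next
    case (add f g)
    then obtain A B where "0 < A" "0 < B" "\<forall>x. \<bar>f x\<bar> \<le> A" "\<forall>x. \<bar>g x\<bar> \<le> B" by auto
    then show ?case
      by (intro exI[of _ "A + B"]) (auto intro: order_trans[OF abs_triangle_ineq] add_mono)
  qed
  with that show ?thesis by auto
qed

text \<open>The witness is \<open>w \<mapsto> cos(a \<bullet> (w - y))\<close> with \<open>a\<close> scaled so that \<open>a \<bullet> (x - y) = 1\<close>.\<close>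
lemma trig_poly_separates:
  fixes x y :: "'a::real_inner"
  assumes "x \<noteq> y" shows "\<exists>f. trig_poly f \<and> f x \<noteq> f y"
proof -
  define d where "d = x - y"
  define a where "a = (1 / (d \<bullet> d)) *\<^sub>R d"
  have "d \<bullet> d \<noteq> 0" using assms by (simp add: d_def)
  then have "a \<bullet> d = 1" by (simp add: a_def)
  then have 1: "a \<bullet> x - a \<bullet> y = 1" by (simp add: d_def inner_diff_right)
  have "cos (a \<bullet> x + - (a \<bullet> y)) \<noteq> cos (a \<bullet> y + - (a \<bullet> y))"
    using cos_monotone_0_pi[of 0 1] pi_gt3 1 by simp
  then show ?thesis
    using trig_poly.cos[of 1 a "- (a \<bullet> y)"] by (intro exI[of _ "\<lambda>w. 1 * cos (a \<bullet> w + - (a \<bullet> y))"]) simp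
qed

text \<open>
  Trigonometric polynomials form an algebra. Composing with a polynomial that approximates a
  truncation will make them globally bounded.
\<close>
lemma trig_poly_polynomial:
  fixes q :: "real \<Rightarrow> real"
  assumes "real_polynomial_function q" and p: "trig_poly p"
  shows "trig_poly (\<lambda>x. q (p x))"
  using assms(1)
proof induction
  case (linear f)
  have "f (p x) = f 1 * p x" for x
    using linear_cmul[OF bounded_linear.linear[OF linear], of "p x" 1] by simp
  then show ?case using trig_poly_mult[OF trig_poly_const p, of "f 1"] by simp
qed (auto intro: trig_poly_const trig_poly.add trig_poly_mult)

text \<open>
  Stone and Weierstrass give a trigonometric polynomial \<open>p\<close> close to \<open>f\<close> on \<open>K\<close>, but with no
  control of its size elsewhere. It is bounded by some \<open>L\<close>, so the truncation to
  \<open>[-B, B]\<close> can be approximated on \<open>[-L, L]\<close> by a polynomial \<open>q\<close>; then \<open>q \<circ> p\<close> is still a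
  trigonometric polynomial, is close to \<open>f\<close> on \<open>K\<close>, and hardly exceeds \<open>B\<close> anywhere.
\<close>
lemma trig_poly_approx:
  fixes f :: "'a::euclidean_space \<Rightarrow> real"
  assumes f: "continuous_on UNIV f" and B: "\<And>x. \<bar>f x\<bar> \<le> B" and K: "compact K" and e: "0 < e"
  obtains t where "trig_poly t" "\<And>x. \<bar>t x\<bar> \<le> B + e" "\<And>x. x \<in> K \<Longrightarrow> \<bar>t x - f x\<bar> \<le> e"
proof -
  have "\<exists>p. trig_poly p \<and> (\<forall>x\<in>K. \<bar>f x - p x\<bar> < e / 2)"
    by (rule Stone_Weierstrass_HOL[OF K])
      (use e continuous_on_subset[OF f] trig_poly_separates in
        \<open>auto intro: trig_poly_const trig_poly_mult trig_poly.add trig_poly_continuous\<close>)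
  then obtain p where p: "trig_poly p" "\<And>x. x \<in> K \<Longrightarrow> \<bar>f x - p x\<bar> < e / 2" by blast
  obtain L where L: "\<And>x. \<bar>p x\<bar> \<le> L" using trig_poly_bounded[OF p(1)] by blast
  define c where "c y = max (- B) (min B y)" for y :: real
  have cont: "continuous_on {-L..L} c" unfolding c_def by (intro continuous_intros)
  obtain q where q: "real_polynomial_function q" "\<And>y. y \<in> {-L..L} \<Longrightarrow> \<bar>c y - q y\<bar> < e / 2"
    using Stone_Weierstrass_real_polynomial_function[OF compact_Icc cont, of "e / 2"] e by auto
  have qp: "\<bar>c (p x) - q (p x)\<bar> < e / 2" for x
    using q(2)[of "p x"] L[of x] by (simp add: abs_le_iff)
  have B0: "0 \<le> B" using B[of undefined] by linarith
  show ?thesis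
  proof (rule that)
    show "trig_poly (\<lambda>x. q (p x))" by (rule trig_poly_polynomial[OF q(1) p(1)])
    show "\<bar>q (p x)\<bar> \<le> B + e" for x
      using qp[of x] B0 e unfolding c_def by linarith
    show "\<bar>q (p x) - f x\<bar> \<le> e" if "x \<in> K" for x
    proof -
      have "\<bar>c (p x) - f x\<bar> \<le> \<bar>p x - f x\<bar>"
        using B[of x] unfolding c_def by linarith
      then show ?thesis using qp[of x] p(2)[OF that] by linarith
    qed
  qed
qed

lemma char_vec_eq_char:
  assumes "sets N = sets (borel :: 'a::euclidean_space measure)"
  shows "char_vec N (t *\<^sub>R a) = char (distr N borel (\<lambda>x. a \<bullet> x)) t"
proof -
  have [measurable_cong]: "sets N = sets borel" by fact
  show ?thesis unfolding char_vec_def char_def by (subst integral_distr) auto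
qed

lemma integrable_iexp_inner:
  fixes N :: "'a::euclidean_space measure"
  assumes "prob_space N" "sets N = sets borel"
  shows "complex_integrable N (\<lambda>x. iexp (a \<bullet> x))"
proof -
  interpret prob_space N by fact
  have [measurable_cong]: "sets N = sets borel" by fact
  show ?thesis by (intro integrable_iexp) auto
qed

lemma integral_cos_char_vec:
  fixes N :: "'a::euclidean_space measure"
  assumes N: "prob_space N" "sets N = sets borel"
  shows "(LINT x|N. cos (a \<bullet> x + b)) = Re (cis b * char_vec N a)"
proof -
  have "Re (cis b * char_vec N a) = Re (CLINT x|N. cis b * iexp (a \<bullet> x))"
    using integrable_iexp_inner[OF N] by (simp add: char_vec_def)
  also have "\<dots> = (LINT x|N. Re (cis b * iexp (a \<bullet> x)))"
    using integrable_iexp_inner[OF N] by (intro integral_Re[symmetric]) auto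
  also have "\<dots> = (LINT x|N. cos (a \<bullet> x + b))"
    by (rule Bochner_Integration.integral_cong)
      (auto simp: cis_conv_exp exp_add[symmetric] cos_add Re_exp algebra_simps)
  finally show ?thesis by simp
qed

lemma integral_trig_poly_tendsto:
  fixes N :: "'a::euclidean_space measure"
  assumes \<mu>: "\<And>n. prob_space (\<mu> n)" "\<And>n. sets (\<mu> n) = sets borel"
    and N: "prob_space N" "sets N = sets borel"
    and conv: "\<And>a. (\<lambda>n. char_vec (\<mu> n) a) \<longlonglongrightarrow> char_vec N a"
    and t: "trig_poly t"
  shows "(\<lambda>n. integral\<^sup>L (\<mu> n) t) \<longlonglongrightarrow> integral\<^sup>L N t"
  using t
proof induction
  case (cos c a b)
  have "(\<lambda>n. c * Re (cis b * char_vec (\<mu> n) a)) \<longlonglongrightarrow> c * Re (cis b * char_vec N a)"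
    by (intro tendsto_intros conv)
  then show ?case by (simp add: integral_cos_char_vec \<mu> N)
next
  case (add f g)
  have i: "integrable P h" if h: "trig_poly h" and P: "prob_space P" "sets P = sets borel" for P h
  proof -
    interpret prob_space P by fact
    have [measurable_cong]: "sets P = sets borel" by fact
    have "h \<in> borel_measurable borel" using trig_poly_continuous[OF h] by (rule borel_measurable_continuous_onI)
    moreover obtain B where "\<And>x. \<bar>h x\<bar> \<le> B" using trig_poly_bounded[OF h] by blast
    ultimately show ?thesis by (intro integrable_const_bound[where B = B]) auto
  qed
  show ?case
    using tendsto_add[OF add.IH] i[OF add.hyps(1)] i[OF add.hyps(2)] \<mu> N by simp
qed

lemma prob_tail_small:
  fixes N :: "'a::euclidean_space measure"
  assumes N: "prob_space N" "sets N = sets borel" and e: "0 < e"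
  obtains R where "0 < R" "measure N {x. R < norm x} < e"
proof -
  interpret prob_space N by fact
  have [measurable_cong]: "sets N = sets borel" by fact
  have sp: "space N = UNIV" using sets_eq_imp_space_eq[OF N(2)] by simp
  let ?A = "\<lambda>n::nat. {x. real n < norm x}"
  have "(\<lambda>n. measure N (?A n)) \<longlonglongrightarrow> measure N (\<Inter>n. ?A n)"
  proof (rule finite_Lim_measure_decseq)
    show "range ?A \<subseteq> sets N" unfolding N(2) by (auto intro!: borel_open open_Collect_less continuous_intros)
    show "decseq ?A" by (auto simp: decseq_def intro: le_less_trans[rotated])
  qed
  moreover have "(\<Inter>n. ?A n) = {}"
    by auto (metis reals_Archimedean2 less_asym)
  ultimately have "(\<lambda>n. measure N (?A n)) \<longlonglongrightarrow> 0" by (metis measure_empty)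
  then have "\<forall>\<^sub>F n in sequentially. measure N (?A n) < e" using e by (rule order_tendstoD)
  then obtain n where n: "\<And>k. k \<ge> n \<Longrightarrow> measure N (?A k) < e" by (auto simp: eventually_sequentially)
  show ?thesis by (rule that[of "real (Suc n)"]) (use n[of "Suc n"] in auto)
qed

text \<open>
  Along each coordinate axis the characteristic functions converge to that of the corresponding
  marginal of \<open>N\<close>, so the marginals converge weakly by the one-dimensional continuity theorem,
  and a continuous cut-off bounds their tails. Finitely many coordinates control the norm.
\<close>
lemma tight_of_char_vec_tendsto:
  fixes N :: "'a::euclidean_space measure"
  assumes \<mu>: "\<And>n. prob_space (\<mu> n)" "\<And>n. sets (\<mu> n) = sets borel"
    and N: "prob_space N" "sets N = sets borel"
    and conv: "\<And>a. (\<lambda>n. char_vec (\<mu> n) a) \<longlonglongrightarrow> char_vec N a"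
    and e: "0 < e"
  obtains R where "0 < R" "\<forall>\<^sub>F n in sequentially. measure (\<mu> n) {x. R < norm x} < e"
proof -
  have meas: "{x::'a. r < norm x} \<in> sets borel" "{x::'a. r < \<bar>i \<bullet> x\<bar>} \<in> sets borel" for r i
    by (auto intro!: borel_open open_Collect_less continuous_intros)
  define d where "d = e / DIM('a)"
  have d: "0 < d" using e by (simp add: d_def)
  obtain r where r: "0 < r" "measure N {x. r < norm x} < d" using prob_tail_small[OF N d] by blast
  define \<phi> where "\<phi> y = min 1 (max 0 (\<bar>y\<bar> - r))" for y :: real
  let ?A = "\<lambda>i. {x::'a. r + 1 < \<bar>i \<bullet> x\<bar>}"
  have \<phi>: "isCont \<phi> y" "norm (\<phi> y) \<le> 1" for y
    unfolding \<phi>_def by (intro continuous_intros) auto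
  have \<phi>m[measurable]: "\<phi> \<in> borel_measurable borel" unfolding \<phi>_def by measurable
  have ev: "\<forall>\<^sub>F n in sequentially. measure (\<mu> n) (?A i) < d" if i: "i \<in> Basis" for i :: 'a
  proof -
    have rd: "real_distribution (distr P borel (\<lambda>x. i \<bullet> x))"
      if "prob_space P" "sets P = sets borel" for P :: "'a measure"
    proof -
      interpret prob_space P by fact
      have [measurable_cong]: "sets P = sets borel" by fact
      show ?thesis by (rule real_distribution_distr) measurable
    qed
    have "weak_conv_m (\<lambda>n. distr (\<mu> n) borel (\<lambda>x. i \<bullet> x)) (distr N borel (\<lambda>x. i \<bullet> x))"
      by (rule levy_continuity) (use rd \<mu> N conv in \<open>auto simp: char_vec_eq_char[symmetric]\<close>)
    then have "(\<lambda>n. integral\<^sup>L (distr (\<mu> n) borel (\<lambda>x. i \<bullet> x)) \<phi>) \<longlonglongrightarrow> integral\<^sup>L (distr N borel (\<lambda>x. i \<bullet> x)) \<phi>"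
      using rd \<mu> N \<phi> by (intro weak_conv_imp_integral_bdd_continuous_conv) auto
    moreover have id: "integral\<^sup>L (distr P borel (\<lambda>x. i \<bullet> x)) \<phi> = (LINT x|P. \<phi> (i \<bullet> x))"
      if "sets P = sets borel" for P :: "'a measure"
    proof -
      have [measurable_cong]: "sets P = sets borel" by fact
      show ?thesis by (rule integral_distr) measurable
    qed
    ultimately have lim: "(\<lambda>n. LINT x|\<mu> n. \<phi> (i \<bullet> x)) \<longlonglongrightarrow> (LINT x|N. \<phi> (i \<bullet> x))"
      using \<mu> N by simp
    have ii: "integrable P (\<lambda>x. \<phi> (i \<bullet> x))" if "prob_space P" "sets P = sets borel" for P :: "'a measure"
    proof -
      interpret prob_space P by fact
      have [measurable_cong]: "sets P = sets borel" by fact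
      show ?thesis using \<phi>(2) by (intro integrable_const_bound[where B = 1]) auto
    qed
    have "(LINT x|N. \<phi> (i \<bullet> x)) \<le> (LINT x|N. indicator {x. r < norm x} x)"
    proof (rule integral_mono)
      interpret prob_space N by (rule N)
      show "integrable N (indicator {x. r < norm x} :: 'a \<Rightarrow> real)"
        using N(2) meas by (intro integrable_real_indicator) (auto simp: emeasure_eq_measure)
      show "\<phi> (i \<bullet> x) \<le> indicator {x. r < norm x} x" for x
        using Basis_le_norm[OF i, of x] by (auto simp: \<phi>_def indicator_def inner_commute)
    qed (rule ii[OF N])
    also have "\<dots> < d" using r sets_eq_imp_space_eq[OF N(2)] by simp
    finally have "\<forall>\<^sub>F n in sequentially. (LINT x|\<mu> n. \<phi> (i \<bullet> x)) < d" using order_tendstoD(2)[OF lim] by blast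
    note lt = this
    have le: "measure (\<mu> n) (?A i) \<le> (LINT x|\<mu> n. \<phi> (i \<bullet> x))" for n
    proof -
      interpret prob_space "\<mu> n" by (rule \<mu>)
      have "(LINT x|\<mu> n. indicator (?A i) x) \<le> (LINT x|\<mu> n. \<phi> (i \<bullet> x))"
      proof (rule integral_mono)
        show "integrable (\<mu> n) (indicator (?A i) :: 'a \<Rightarrow> real)"
          using \<mu>(2)[of n] meas by (intro integrable_real_indicator) (auto simp: emeasure_eq_measure)
        show "indicator (?A i) x \<le> \<phi> (i \<bullet> x)" for x
          by (auto simp: \<phi>_def indicator_def)
      qed (rule ii[OF \<mu>])
      then show ?thesis using sets_eq_imp_space_eq[OF \<mu>(2)] by simp
    qed
    show ?thesis by (rule eventually_mono[OF lt le_less_trans[OF le]])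
  qed
  have "\<forall>\<^sub>F n in sequentially. \<forall>i\<in>(Basis :: 'a set). measure (\<mu> n) (?A i) < d"
    using ev by (intro eventually_ball_finite) auto
  then have "\<forall>\<^sub>F n in sequentially. measure (\<mu> n) {x. DIM('a) * (r + 1) < norm x} < e"
  proof eventually_elim
    case (elim n)
    interpret prob_space "\<mu> n" by (rule \<mu>)
    have "{x::'a. DIM('a) * (r + 1) < norm x} \<subseteq> (\<Union>i\<in>Basis. ?A i)"
    proof
      fix x :: 'a assume "x \<in> {x. DIM('a) * (r + 1) < norm x}"
      then have x: "DIM('a) * (r + 1) < norm x" by simp
      show "x \<in> (\<Union>i\<in>Basis. ?A i)"
      proof (rule ccontr)
        assume "\<not> ?thesis"
        then have "\<bar>x \<bullet> i\<bar> \<le> r + 1" if "i \<in> Basis" for i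
          using that by (auto simp: not_less inner_commute)
        then have "(\<Sum>i\<in>Basis. \<bar>x \<bullet> i\<bar>) \<le> (\<Sum>i\<in>(Basis::'a set). r + 1)" by (intro sum_mono)
        then show False using x norm_le_l1[of x] by simp
      qed
    qed
    then have "measure (\<mu> n) {x. DIM('a) * (r + 1) < norm x} \<le> measure (\<mu> n) (\<Union>i\<in>Basis. ?A i)"
      using \<mu>(2)[of n] meas by (intro finite_measure_mono) auto
    also have "\<dots> \<le> (\<Sum>i\<in>(Basis::'a set). measure (\<mu> n) (?A i))"
    proof (rule finite_measure_subadditive_finite)
      show "?A ` Basis \<subseteq> sets (\<mu> n)"
        unfolding \<mu>(2) using meas(2) by blast
    qed simp
    also have "\<dots> < (\<Sum>i\<in>(Basis::'a set). d)"
      using elim by (intro sum_strict_mono) auto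
    also have "\<dots> = e" by (simp add: d_def)
    finally show ?case .
  qed
  then show ?thesis by (rule that[rotated]) (use r(1) in simp)
qed

text \<open>
  The continuity theorem on Euclidean spaces: integrals of trigonometric polynomials converge by
  hypothesis, and by tightness a uniformly bounded approximation on a large ball is enough.
\<close>
theorem char_vec_tendsto_imp_converges_in_distribution:
  fixes N :: "'a::euclidean_space measure"
  assumes \<mu>: "\<And>n. prob_space (\<mu> n)" "\<And>n. sets (\<mu> n) = sets borel"
    and N: "prob_space N" "sets N = sets borel"
    and conv: "\<And>a. (\<lambda>n. char_vec (\<mu> n) a) \<longlonglongrightarrow> char_vec N a"
  shows "converges_in_distribution \<mu> N"
  unfolding converges_in_distribution_def
proof (intro allI impI)
  fix f :: "'a \<Rightarrow> real"
  assume f: "continuous_on UNIV f" and bd: "bounded (range f)"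
  obtain B where B: "0 < B" "\<And>x. \<bar>f x\<bar> \<le> B" using bd unfolding bounded_pos by auto
  have fm[measurable]: "f \<in> borel_measurable borel" using f by (rule borel_measurable_continuous_onI)
  show "(\<lambda>n. integral\<^sup>L (\<mu> n) f) \<longlonglongrightarrow> integral\<^sup>L N f"
  proof (rule LIMSEQ_I)
    fix r :: real assume r: "0 < r"
    define e where "e = min 1 (r / 5)"
    have e: "0 < e" "e \<le> 1" "5 * e \<le> r" using r by (auto simp: e_def)
    define d where "d = e / (2 * B + 1)"
    have d: "0 < d" using e B by (simp add: d_def)
    obtain R1 where R1: "0 < R1" "\<forall>\<^sub>F n in sequentially. measure (\<mu> n) {x. R1 < norm x} < d"
      using tight_of_char_vec_tendsto[OF \<mu> N conv d] by blast
    obtain R2 where R2: "0 < R2" "measure N {x. R2 < norm x} < d"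
      using prob_tail_small[OF N d] by blast
    define R where "R = max R1 R2"
    obtain t where t: "trig_poly t" "\<And>x. \<bar>t x\<bar> \<le> B + e" "\<And>x. x \<in> cball 0 R \<Longrightarrow> \<bar>t x - f x\<bar> \<le> e"
      using trig_poly_approx[OF f B(2) compact_cball e(1)] by blast
    have tm[measurable]: "t \<in> borel_measurable borel"
      using trig_poly_continuous[OF t(1)] by (rule borel_measurable_continuous_onI)
    have close: "\<bar>integral\<^sup>L P t - integral\<^sup>L P f\<bar> < 2 * e"
      if P: "prob_space P" "sets P = sets borel" and Q: "Q \<le> R" "measure P {x. Q < norm x} < d" for P Q
    proof -
      interpret prob_space P by (rule P)
      have [measurable_cong]: "sets P = sets borel" by fact
      have sp: "space P = UNIV" using sets_eq_imp_space_eq[OF P(2)] by simp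
      have ms: "{x. Q < norm x} \<in> sets P"
        unfolding P(2) by (auto intro!: borel_open open_Collect_less continuous_intros)
      have it: "integrable P t" using t(2) by (intro integrable_const_bound[where B = "B + e"]) auto
      have f_int: "integrable P f" using B(2) by (intro integrable_const_bound[where B = B]) auto
      have "\<bar>integral\<^sup>L P t - integral\<^sup>L P f\<bar> = \<bar>LINT x|P. t x - f x\<bar>" using it f_int by simp
      also have "\<dots> \<le> (LINT x|P. \<bar>t x - f x\<bar>)" by (rule integral_abs_bound)
      also have "\<dots> \<le> (LINT x|P. e + (2 * B + 1) * indicator {x. Q < norm x} x)"
      proof (rule integral_mono)
        show "integrable P (\<lambda>x. \<bar>t x - f x\<bar>)" using it f_int by simp
        show "integrable P (\<lambda>x. e + (2 * B + 1) * indicator {x. Q < norm x} x)"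
          using ms by (auto intro!: integrable_real_indicator simp: emeasure_eq_measure)
        show "\<bar>t x - f x\<bar> \<le> e + (2 * B + 1) * indicator {x. Q < norm x} x" for x
        proof (cases "Q < norm x")
          case True
          have "\<bar>t x - f x\<bar> \<le> \<bar>t x\<bar> + \<bar>f x\<bar>" by (rule abs_triangle_ineq4)
          with True show ?thesis using t(2)[of x] B(2)[of x] e by simp
        next
          case False
          then show ?thesis using t(3)[of x] Q by simp
        qed
      qed
      also have "\<dots> = e + (2 * B + 1) * measure P {x. Q < norm x}"
        using ms by (subst Bochner_Integration.integral_add) (auto simp: prob_space[unfolded sp] sp emeasure_eq_measure)
      also have "\<dots> < e + (2 * B + 1) * d" using Q B by simp
      also have "\<dots> = 2 * e" using B by (simp add: d_def)
      finally show ?thesis .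
    qed
    have cN: "\<bar>integral\<^sup>L N t - integral\<^sup>L N f\<bar> < 2 * e"
      using close[OF N _ R2(2)] by (simp add: R_def)
    have "\<forall>\<^sub>F n in sequentially. \<bar>integral\<^sup>L (\<mu> n) t - integral\<^sup>L N t\<bar> < e"
      using integral_trig_poly_tendsto[OF \<mu> N conv t(1)] e(1) unfolding tendsto_iff dist_real_def by blast
    with R1(2) have "\<forall>\<^sub>F n in sequentially. \<bar>integral\<^sup>L (\<mu> n) f - integral\<^sup>L N f\<bar> < r"
    proof eventually_elim
      case (elim n)
      have "\<bar>integral\<^sup>L (\<mu> n) t - integral\<^sup>L (\<mu> n) f\<bar> < 2 * e"
        using close[OF \<mu> _ elim(1)] by (simp add: R_def)
      with elim(2) cN e(3) show ?case by linarith
    qed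
    then show "\<exists>no. \<forall>n\<ge>no. norm (integral\<^sup>L (\<mu> n) f - integral\<^sup>L N f) < r"
      by (simp add: eventually_sequentially)
  qed
qed

text \<open>
  Slutsky's lemma at the level of characteristic functions: \<open>x \<mapsto> exp(ix)\<close> is 1-Lipschitz and
  bounded by 1, so a difference that vanishes in probability does not change the limit.
\<close>
lemma char_vec_tendsto_of_close:
  fixes X B :: "nat \<Rightarrow> 'w \<Rightarrow> 'a::euclidean_space"
  assumes M: "prob_space M"
    and X[measurable]: "\<And>n. X n \<in> borel_measurable M" and B[measurable]: "\<And>n. B n \<in> borel_measurable M"
    and close: "\<And>e. 0 < e \<Longrightarrow> (\<lambda>n. measure M {\<omega> \<in> space M. e < norm (X n \<omega> - B n \<omega>)}) \<longlonglongrightarrow> 0"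
    and lim: "(\<lambda>n. char_vec (distr M borel (B n)) a) \<longlonglongrightarrow> l"
  shows "(\<lambda>n. char_vec (distr M borel (X n)) a) \<longlonglongrightarrow> l"
proof -
  interpret prob_space M by fact
  have cv: "char_vec (distr M borel F) a = (CLINT \<omega>|M. iexp (a \<bullet> F \<omega>))"
    if [measurable]: "F \<in> borel_measurable M" for F :: "'w \<Rightarrow> 'a"
    unfolding char_vec_def by (subst integral_distr) auto
  have ii: "complex_integrable M (\<lambda>\<omega>. iexp (a \<bullet> F \<omega>))"
    if [measurable]: "F \<in> borel_measurable M" for F :: "'w \<Rightarrow> 'a"
    by (intro integrable_iexp) auto
  let ?d = "\<lambda>n. char_vec (distr M borel (X n)) a - char_vec (distr M borel (B n)) a"
  have "?d \<longlonglongrightarrow> 0"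
  proof (rule LIMSEQ_I)
    fix r :: real assume r: "0 < r"
    define e where "e = r / (2 * (norm a + 1))"
    have e: "0 < e" using r norm_ge_zero[of a] by (auto simp: e_def intro!: divide_pos_pos add_nonneg_pos)
    have ae: "norm a * e \<le> r / 2"
    proof -
      have "norm a * e \<le> (norm a + 1) * e" using e by simp
      also have "\<dots> = r / 2" using norm_ge_zero[of a] by (simp add: e_def field_simps add_nonneg_eq_0_iff)
      finally show ?thesis .
    qed
    let ?A = "\<lambda>n. {\<omega> \<in> space M. e < norm (X n \<omega> - B n \<omega>)}"
    define P where "P n = prob (?A n)" for n
    have bound: "norm (?d n) \<le> r / 2 + 2 * P n" for n
    proof -
      have "norm (?d n) =
        norm (CLINT \<omega>|M. iexp (a \<bullet> X n \<omega>) - iexp (a \<bullet> B n \<omega>))"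
        by (simp add: cv ii)
      also have "\<dots> \<le> (LINT \<omega>|M. norm (iexp (a \<bullet> X n \<omega>) - iexp (a \<bullet> B n \<omega>)))"
        by (rule integral_norm_bound)
      also have "\<dots> \<le> (LINT \<omega>|M. r / 2 + 2 * indicator (?A n) \<omega>)"
      proof (rule integral_mono)
        show "integrable M (\<lambda>\<omega>. norm (iexp (a \<bullet> X n \<omega>) - iexp (a \<bullet> B n \<omega>)))" using ii by simp
        show "integrable M (\<lambda>\<omega>. r / 2 + 2 * indicator (?A n) \<omega>)"
          by (auto intro!: integrable_real_indicator simp: emeasure_eq_measure)
        fix \<omega> assume w: "\<omega> \<in> space M"
        show "norm (iexp (a \<bullet> X n \<omega>) - iexp (a \<bullet> B n \<omega>)) \<le>
          r / 2 + 2 * indicator (?A n) \<omega>"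
        proof (cases "e < norm (X n \<omega> - B n \<omega>)")
          case True
          have "norm (iexp (a \<bullet> X n \<omega>) - iexp (a \<bullet> B n \<omega>)) \<le> norm (iexp (a \<bullet> X n \<omega>)) + norm (iexp (a \<bullet> B n \<omega>))"
            by (rule norm_triangle_ineq4)
          also have "\<dots> = 2" by simp
          finally show ?thesis using True w r by simp
        next
          case False
          have "norm (iexp x - iexp y) \<le> \<bar>x - y\<bar>" for x y :: real
          proof -
            have "iexp x - iexp y = iexp y * (iexp (x - y) - 1)"
              by (simp add: algebra_simps exp_add[symmetric])
            then have "norm (iexp x - iexp y) = norm (iexp (x - y) - 1)" by (simp add: norm_mult)
            also have "\<dots> \<le> \<bar>x - y\<bar>" using iexp_approx1[of "x - y" 0] by simp
            finally show ?thesis .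
          qed
          then have "norm (iexp (a \<bullet> X n \<omega>) - iexp (a \<bullet> B n \<omega>)) \<le> \<bar>a \<bullet> X n \<omega> - a \<bullet> B n \<omega>\<bar>" .
          also have "\<dots> \<le> norm a * norm (X n \<omega> - B n \<omega>)"
            using Cauchy_Schwarz_ineq2[of a "X n \<omega> - B n \<omega>"] by (simp add: inner_diff_right)
          also have "\<dots> \<le> norm a * e" using False by (intro mult_left_mono) auto
          finally show ?thesis using ae False by simp
        qed
      qed
      also have "\<dots> = r / 2 + 2 * P n"
        by (subst Bochner_Integration.integral_add)
          (auto simp: prob_space P_def emeasure_eq_measure intro!: integrable_real_indicator arg_cong[where f = prob])
      finally show ?thesis .
    qed
    have "P \<longlonglongrightarrow> 0" using close[OF e] by (simp add: P_def[abs_def])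
    then have "\<forall>\<^sub>F n in sequentially. P n < r / 4" using r by (intro order_tendstoD) auto
    then have "\<forall>\<^sub>F n in sequentially. norm (?d n - 0) < r"
    proof eventually_elim
      case (elim n)
      with bound[of n] r show ?case by simp
    qed
    then show "\<exists>no. \<forall>n\<ge>no. norm (?d n - 0) < r"
      by (simp add: eventually_sequentially)
  qed
  from tendsto_add[OF this lim] show ?thesis by simp
qed

section \<open>Gaussian laws with prescribed covariance\<close>

lemma matrix_minus_outer_product:
  fixes A :: "real^'m^'m"
  shows "(\<chi> k l. A $ k $ l - v $ k * v $ l) *v x = A *v x - (v \<bullet> x) *\<^sub>R v"
  by (simp add: vec_eq_iff matrix_vector_mult_def inner_vec_def sum_subtractf
      sum_distrib_left algebra_simps)

lemma symmetric_matrix_inner: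
  fixes A :: "real^'m^'m"
  assumes "transpose A = A"
  shows "x \<bullet> (A *v y) = (A *v x) \<bullet> y"
  using dot_lmul_matrix[of x A y] vector_transpose_matrix[of x A] assms by simp

text \<open>The rank-one step in the construction of normal laws: the form in the exponent gains \<open>(a \<bullet> v)\<^sup>2\<close>.\<close>
lemma char_vec_normal_shift:
  fixes N :: "'a::euclidean_space measure"
  assumes N: "prob_space N" "sets N = sets borel"
  shows "char_vec (distr (N \<Otimes>\<^sub>M std_normal_distribution) borel (\<lambda>(x, y). x + y *\<^sub>R v)) a =
    char_vec N a * exp (- (a \<bullet> v)\<^sup>2 / 2)"
proof -
  interpret N: prob_space N by fact
  interpret G: real_distribution std_normal_distribution by (rule real_dist_normal_dist)
  interpret P: pair_prob_space N std_normal_distribution ..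
  have [measurable_cong]: "sets N = sets borel" by fact
  have "char_vec (distr (N \<Otimes>\<^sub>M std_normal_distribution) borel (\<lambda>(x, y). x + y *\<^sub>R v)) a =
    (CLINT p|N \<Otimes>\<^sub>M std_normal_distribution. iexp (a \<bullet> (fst p + snd p *\<^sub>R v)))"
    unfolding char_vec_def by (subst integral_distr) (auto simp: case_prod_unfold)
  also have "\<dots> = (CLINT p|N \<Otimes>\<^sub>M std_normal_distribution. iexp (a \<bullet> fst p) * iexp ((a \<bullet> v) * snd p))"
    by (rule Bochner_Integration.integral_cong)
      (auto simp: inner_add_right exp_add[symmetric] algebra_simps)
  also have "\<dots> = (CLINT x|N. CLINT y|std_normal_distribution. iexp (a \<bullet> x) * iexp ((a \<bullet> v) * y))"
  proof -
    have "complex_integrable (N \<Otimes>\<^sub>M std_normal_distribution) (\<lambda>p. iexp (a \<bullet> fst p) * iexp ((a \<bullet> v) * snd p))"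
      by (intro P.integrable_const_bound[where B = 1]) (auto simp: norm_mult)
    from P.integral_fst'[OF this] show ?thesis by simp
  qed
  also have "\<dots> = char_vec N a * char std_normal_distribution (a \<bullet> v)"
    unfolding char_vec_def char_def by simp
  finally show ?thesis by (simp add: char_std_normal_distribution)
qed

text \<open>
  Induction on the set \<open>I\<close> of coordinates on which the form lives. If the diagonal entry at \<open>i\<close> is
  0, then positive semidefiniteness forces the whole row to vanish. Otherwise \<open>A = A' + v v\<^sup>T\<close>,
  where \<open>v\<close> is the \<open>i\<close>-th column divided by the root of its diagonal entry; the Schur complement
  \<open>A'\<close> is again positive semidefinite and lives on \<open>I - {i}\<close>, and a normal law for \<open>A'\<close> convolved
  with a normal law on the line spanned by \<open>v\<close> is a normal law for \<open>A\<close>.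
\<close>
lemma gaussian_exists_supported:
  fixes A :: "real^'m^'m" and I :: "'m set"
  assumes "finite I" "transpose A = A" "\<And>x. 0 \<le> x \<bullet> (A *v x)"
    and "\<And>k l. k \<notin> I \<Longrightarrow> A $ k $ l = 0"
  shows "\<exists>N. prob_space N \<and> sets N = sets borel \<and>
    (\<forall>a. char_vec N a = exp (- (a \<bullet> (A *v a)) / 2))"
  using assms
proof (induction I arbitrary: A rule: finite_induct)
  case empty
  have "A = 0" using empty by (simp add: vec_eq_iff)
  moreover have "char_vec (return borel (0::real^'m)) a = 1" for a
    by (simp add: char_vec_def integral_return)
  ultimately show ?case
    by (intro exI[of _ "return borel 0"]) (auto simp: prob_space_return)
next
  case (insert i I)
  let ?e = "axis i (1::real)"
  define c where "c = A *v ?e"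
  note sym = symmetric_matrix_inner[OF insert.prems(1)]
  have ck: "c $ k = A $ k $ i" for k
    by (simp add: c_def matrix_vector_mult_basis column_def)
  have Asym: "A $ k $ l = A $ l $ k" for k l
    using arg_cong[OF insert.prems(1), of "\<lambda>B. B $ l $ k"] by (simp add: transpose_def)
  have ceq: "c $ i = ?e \<bullet> (A *v ?e)" by (simp add: c_def inner_axis')
  have ci: "c \<bullet> ?e = c $ i" by (simp add: inner_axis)
  have q: "(x + t *\<^sub>R ?e) \<bullet> (A *v (x + t *\<^sub>R ?e)) = x \<bullet> (A *v x) + 2 * t * (c \<bullet> x) + t\<^sup>2 * c $ i" for x t
    using sym[of x ?e] sym[of ?e x]
    by (simp add: matrix_vector_right_distrib matrix_vector_mult_scaleR inner_add_left inner_add_right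
        ceq[symmetric] c_def[symmetric] power2_eq_square algebra_simps inner_commute ci)
  show ?case
  proof (cases "c $ i = 0")
    case True
    have "A $ i $ j = 0" for j
    proof (rule ccontr)
      assume nz: "A $ i $ j \<noteq> 0"
      have cj: "c \<bullet> axis j 1 = A $ i $ j" using Asym ck by (simp add: inner_axis)
      define w where "w = axis j (1::real) \<bullet> (A *v axis j 1)"
      have "0 \<le> w + 2 * t * A $ i $ j" for t
        using insert.prems(2)[of "axis j 1 + t *\<^sub>R ?e"] unfolding q True cj w_def by simp
      \<comment> \<open>An affine function of \<open>t\<close> with nonzero slope is negative somewhere; at this \<open>t\<close> it equals -1.\<close>
      from this[of "- (w + 1) / (2 * A $ i $ j)"] nz show False by (simp add: field_simps)
    qed
    then show ?thesis using insert.prems by (intro insert.IH) (auto, metis insertE)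
  next
    case False
    then have pos: "0 < c $ i" using insert.prems(2)[of ?e] ceq by linarith
    define v where "v = (1 / sqrt (c $ i)) *\<^sub>R c"
    define A' where "A' = (\<chi> k l. A $ k $ l - v $ k * v $ l)"
    have A'x: "A' *v x = A *v x - (v \<bullet> x) *\<^sub>R v" for x
      unfolding A'_def by (rule matrix_minus_outer_product)
    have v2: "(v \<bullet> x)\<^sup>2 = (c \<bullet> x)\<^sup>2 / c $ i" for x
      using pos by (simp add: v_def power_divide)
    have vv: "v $ k * v $ l = c $ k * c $ l / c $ i" for k l
      using pos by (simp add: v_def)
    have xA'x: "x \<bullet> (A' *v x) = x \<bullet> (A *v x) - (v \<bullet> x)\<^sup>2" for x
      by (simp add: A'x inner_diff_right power2_eq_square inner_commute)
    have "\<exists>N. prob_space N \<and> sets N = sets borel \<and> (\<forall>a. char_vec N a = exp (- (a \<bullet> (A' *v a)) / 2))"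
    proof (rule insert.IH)
      show "transpose A' = A'" using Asym by (simp add: A'_def transpose_def vec_eq_iff mult.commute)
      show "0 \<le> x \<bullet> (A' *v x)" for x
      proof -
        \<comment> \<open>The form \<open>A\<close> at \<open>x + t e\<^sub>i\<close>, minimised over \<open>t\<close>.\<close>
        have "0 \<le> x \<bullet> (A *v x) + 2 * (- (c \<bullet> x) / c $ i) * (c \<bullet> x) + (- (c \<bullet> x) / c $ i)\<^sup>2 * c $ i"
          using insert.prems(2)[of "x + (- (c \<bullet> x) / c $ i) *\<^sub>R ?e"] unfolding q .
        also have "\<dots> = x \<bullet> (A *v x) - (c \<bullet> x)\<^sup>2 / c $ i"
          using pos by (simp add: field_simps power2_eq_square)
        finally show ?thesis by (simp add: xA'x v2)
      qed
      show "A' $ k $ l = 0" if "k \<notin> I" for k l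
      proof (cases "k = i")
        case True
        then show ?thesis using pos Asym[of i l] by (simp add: A'_def vv ck)
      next
        case False
        then have "A $ k $ m = 0" for m using insert.prems(3) that by simp
        then show ?thesis by (simp add: A'_def vv ck)
      qed
    qed
    then obtain N where N: "prob_space N" "sets N = sets borel"
      and chN: "\<And>a. char_vec N a = exp (- (a \<bullet> (A' *v a)) / 2)" by blast
    let ?N = "distr (N \<Otimes>\<^sub>M std_normal_distribution) borel (\<lambda>(x, y). x + y *\<^sub>R v)"
    have [measurable_cong]: "sets N = sets borel" by fact
    interpret N: prob_space N by fact
    interpret G: real_distribution std_normal_distribution by (rule real_dist_normal_dist)
    interpret P: pair_prob_space N std_normal_distribution ..
    have "prob_space ?N" by (rule P.prob_space_distr) measurable
    moreover have "char_vec ?N a = exp (- (a \<bullet> (A *v a)) / 2)" for a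
    proof -
      have "char_vec ?N a = of_real (exp (- (a \<bullet> (A' *v a)) / 2) * exp (- (a \<bullet> v)\<^sup>2 / 2))"
        by (simp add: char_vec_normal_shift[OF N] chN exp_of_real)
      also have "exp (- (a \<bullet> (A' *v a)) / 2) * exp (- (a \<bullet> v)\<^sup>2 / 2) = exp (- (a \<bullet> (A *v a)) / 2)"
        by (simp add: xA'x exp_add[symmetric] inner_commute field_simps)
      finally show ?thesis by (simp add: exp_of_real)
    qed
    ultimately show ?thesis by (intro exI[of _ ?N]) simp
  qed
qed

lemma char_vec_gaussian_marginal:
  fixes N :: "'a::euclidean_space measure"
  assumes N: "prob_space N" "sets N = sets borel"
    and q: "\<And>t. char_vec N (t *\<^sub>R a) = exp (- (t\<^sup>2 * q) / 2)" "0 \<le> q"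
  shows "distr N borel (\<lambda>x. a \<bullet> x) = distr std_normal_distribution borel (\<lambda>y. sqrt q * y)"
proof (rule Levy_uniqueness)
  interpret N: prob_space N by fact
  interpret G: real_distribution std_normal_distribution by (rule real_dist_normal_dist)
  have [measurable_cong]: "sets N = sets borel" by fact
  show "real_distribution (distr N borel (\<lambda>x. a \<bullet> x))"
    by (rule N.real_distribution_distr) measurable
  show "real_distribution (distr std_normal_distribution borel (\<lambda>y. sqrt q * y))"
    by (rule G.real_distribution_distr) measurable
  show "char (distr N borel (\<lambda>x. a \<bullet> x)) = char (distr std_normal_distribution borel (\<lambda>y. sqrt q * y))"
  proof
    fix t
    have "char (distr std_normal_distribution borel (\<lambda>y. sqrt q * y)) t = char std_normal_distribution (t * sqrt q)"
      unfolding char_def by (subst integral_distr) (auto simp: mult_ac)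
    also have "\<dots> = exp (- (t\<^sup>2 * q) / 2)"
      using q(2) by (simp add: char_std_normal_distribution power_mult_distrib)
    also have "\<dots> = char (distr N borel (\<lambda>x. a \<bullet> x)) t"
      using q(1)[of t] char_vec_eq_char[OF N(2)] by (simp add: exp_of_real)
    finally show "char (distr N borel (\<lambda>x. a \<bullet> x)) t = char (distr std_normal_distribution borel (\<lambda>y. sqrt q * y)) t"
      by simp
  qed
qed

lemma univariate_normal_scaled:
  assumes "0 \<le> \<sigma>"
  shows "univariate_normal (distr std_normal_distribution borel (\<lambda>y. \<sigma> * y))"
proof (cases "\<sigma> = 0")
  case True
  interpret G: real_distribution std_normal_distribution by (rule real_dist_normal_dist)
  have "distr std_normal_distribution borel (\<lambda>y. \<sigma> * y) = return borel 0"
    using True G.distr_const[of 0 borel] by simp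
  then show ?thesis unfolding univariate_normal_def by blast
next
  case False
  with assms have pos: "0 < \<sigma>" by simp
  interpret G: real_distribution std_normal_distribution by (rule real_dist_normal_dist)
  have "distributed std_normal_distribution lborel (\<lambda>y. y) std_normal_density"
    by (simp add: distributed_def distr_id2)
  from G.normal_density_affine[OF this, of \<sigma> 0] pos
  have "distributed std_normal_distribution lborel (\<lambda>y. \<sigma> * y) (normal_density 0 \<sigma>)" by simp
  then have "distr std_normal_distribution lborel (\<lambda>y. \<sigma> * y) = density lborel (normal_density 0 \<sigma>)"
    by (simp add: distributed_def)
  moreover have "distr std_normal_distribution borel (\<lambda>y. \<sigma> * y) = distr std_normal_distribution lborel (\<lambda>y. \<sigma> * y)"
    by (rule distr_cong) auto
  ultimately show ?thesis unfolding univariate_normal_def using pos by auto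
qed

text \<open>
  All one-dimensional marginals are scaled standard normal laws by uniqueness of characteristic
  functions. The mixed second moments follow from the second moments of the marginals by
  polarisation.
\<close>
theorem gaussian_exists:
  fixes A :: "real^'m^'m"
  assumes sym: "transpose A = A" and psd: "\<And>x. 0 \<le> x \<bullet> (A *v x)"
  obtains N where "multivariate_normal N 0 A" "\<And>a. char_vec N a = exp (- (a \<bullet> (A *v a)) / 2)"
proof -
  obtain N where N: "prob_space N" "sets N = sets borel"
    and ch: "\<And>a. char_vec N a = exp (- (a \<bullet> (A *v a)) / 2)"
    using gaussian_exists_supported[of UNIV A] assms by auto
  interpret prob_space N by fact
  interpret G: real_distribution std_normal_distribution by (rule real_dist_normal_dist)
  have [measurable_cong]: "sets N = sets borel" by fact
  define q where "q a = a \<bullet> (A *v a)" for a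
  have marg: "distr N borel (\<lambda>x. a \<bullet> x) = distr std_normal_distribution borel (\<lambda>y. sqrt (q a) * y)" for a
    by (rule char_vec_gaussian_marginal[OF N])
      (auto simp: ch q_def psd matrix_vector_mult_scaleR power2_eq_square mult_ac)
  have int2: "integrable N (\<lambda>x. (a \<bullet> x)\<^sup>2)" and e2: "(LINT x|N. (a \<bullet> x)\<^sup>2) = q a"
    and int1: "integrable N (\<lambda>x. a \<bullet> x)" and e1: "(LINT x|N. a \<bullet> x) = 0" for a
  proof -
    have t: "integrable N (\<lambda>x. h (a \<bullet> x)) \<longleftrightarrow> integrable std_normal_distribution (\<lambda>y. h (sqrt (q a) * y))"
      "(LINT x|N. h (a \<bullet> x)) = (LINT y|std_normal_distribution. h (sqrt (q a) * y))"
      if [measurable]: "h \<in> borel_measurable borel" for h :: "real \<Rightarrow> real"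
    proof -
      have "integrable N (\<lambda>x. h (a \<bullet> x)) \<longleftrightarrow> integrable (distr N borel (\<lambda>x. a \<bullet> x)) h"
        by (subst integrable_distr_eq) auto
      also have "\<dots> \<longleftrightarrow> integrable std_normal_distribution (\<lambda>y. h (sqrt (q a) * y))"
        unfolding marg by (subst integrable_distr_eq) auto
      finally show "integrable N (\<lambda>x. h (a \<bullet> x)) \<longleftrightarrow> integrable std_normal_distribution (\<lambda>y. h (sqrt (q a) * y))" .
      have "(LINT x|N. h (a \<bullet> x)) = integral\<^sup>L (distr N borel (\<lambda>x. a \<bullet> x)) h"
        by (subst integral_distr) auto
      also have "\<dots> = (LINT y|std_normal_distribution. h (sqrt (q a) * y))"
        unfolding marg by (subst integral_distr) auto
      finally show "(LINT x|N. h (a \<bullet> x)) = (LINT y|std_normal_distribution. h (sqrt (q a) * y))" .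
    qed
    have m: "integrable std_normal_distribution (\<lambda>y. y)" "(LINT y|std_normal_distribution. y) = 0"
      "integrable std_normal_distribution (\<lambda>y. y\<^sup>2)" "(LINT y|std_normal_distribution. y\<^sup>2) = 1"
      using integrable_std_normal_distribution_moment[of 1] integral_std_normal_distribution_moment_odd[of 1]
        integrable_std_normal_distribution_moment[of 2] std_normal_distribution_even_moments[of 1]
      by (auto simp: fact_numeral)
    have q0: "0 \<le> q a" using psd by (simp add: q_def)
    have sq: "(sqrt (q a) * y)\<^sup>2 = q a * y\<^sup>2" for y using q0 by (simp add: power_mult_distrib)
    show "integrable N (\<lambda>x. (a \<bullet> x)\<^sup>2)"
      by (subst t(1)[of "\<lambda>y. y\<^sup>2"], measurable)
        (unfold sq, rule integrable_mult_right, rule m)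
    show "(LINT x|N. (a \<bullet> x)\<^sup>2) = q a"
      by (subst t(2)[of "\<lambda>y. y\<^sup>2"], measurable) (simp only: sq integral_mult_right_zero m mult_1_right)
    show "integrable N (\<lambda>x. a \<bullet> x)"
      by (subst t(1)[of "\<lambda>y. y"], measurable) (rule integrable_mult_right, rule m)
    show "(LINT x|N. a \<bullet> x) = 0"
      by (subst t(2)[of "\<lambda>y. y"], measurable) (simp only: integral_mult_right_zero m mult_zero_right)
  qed
  have "multivariate_normal N 0 A"
    unfolding multivariate_normal_def
  proof (intro conjI allI N)
    show "univariate_normal (distr N borel (\<lambda>x. a \<bullet> x))" for a
      unfolding marg by (rule univariate_normal_scaled) (simp add: q_def psd)
    show "(LINT x|N. x $ k) = 0 $ k" for k
      using e1[of "axis k 1"] by (simp add: inner_axis')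
    fix k l :: 'm
    let ?k = "axis k (1::real)" and ?l = "axis l (1::real)"
    have eq: "(x $ k - 0 $ k) * (x $ l - 0 $ l) = (((?k + ?l) \<bullet> x)\<^sup>2 - (?k \<bullet> x)\<^sup>2 - (?l \<bullet> x)\<^sup>2) / 2" for x :: "real^'m"
      by (simp add: inner_add_left inner_axis' power2_eq_square algebra_simps)
    have "(LINT x|N. (x $ k - 0 $ k) * (x $ l - 0 $ l)) = (q (?k + ?l) - q ?k - q ?l) / 2"
      unfolding eq using int2 e2 by simp
    also have "\<dots> = A $ k $ l"
    proof -
      have "A $ i $ j = axis i 1 \<bullet> (A *v axis j 1)" for i j
        by (simp add: matrix_vector_mult_basis column_def inner_axis')
      moreover have "A $ k $ l = A $ l $ k"
        using arg_cong[OF sym, of "\<lambda>B. B $ l $ k"] by (simp add: transpose_def)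
      ultimately show ?thesis
        by (simp add: q_def matrix_vector_right_distrib inner_add_left inner_add_right)
    qed
    finally show "(LINT x|N. (x $ k - 0 $ k) * (x $ l - 0 $ l)) = A $ k $ l" .
  qed
  with ch that show ?thesis by blast
qed

section \<open>Limit theorems for superpositions\<close>

lemma char_vec_real: "char_vec N (t::real) = char N t"
  by (simp add: char_vec_def char_def inner_real_def)

text \<open>
  The form of the central limit theorem used below. It includes the degenerate case \<open>v = 0\<close>,
  where the centred variables vanish almost surely: a linear functional of the score may
  have variance 0 in one of the two samples.
\<close>
lemma (in prob_space) iid_sum_char_tendsto:
  fixes X :: "nat \<Rightarrow> 'a \<Rightarrow> real"
  assumes indep: "indep_vars (\<lambda>_. borel) X UNIV"
    and mean: "\<And>i. expectation (X i) = m"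
    and sq: "\<And>i. integrable M (\<lambda>\<omega>. (X i \<omega>)\<^sup>2)"
    and var: "\<And>i. variance (X i) = v"
    and ident: "\<And>i. distr M borel (X i) = \<mu>"
  shows "(\<lambda>n. char (distr M borel (\<lambda>\<omega>. (\<Sum>i<n. X i \<omega> - m) / sqrt n)) t)
    \<longlonglongrightarrow> exp (- (t\<^sup>2 * v) / 2)"
proof -
  have X[measurable]: "X i \<in> borel_measurable M" for i
    using indep unfolding indep_vars_def by auto
  have v0: "0 \<le> v" using variance_positive[of "X 0"] var by simp
  show ?thesis
  proof (cases "v = 0")
    case True
    have "AE \<omega> in M. X i \<omega> = m" for i
    proof -
      have ie: "integrable M (X i)" by (rule square_integrable_imp_integrable[OF X sq])
      have "integrable M (\<lambda>\<omega>. (X i \<omega> - m)\<^sup>2)"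
        using sq[of i] ie by (simp add: power2_diff)
      moreover have "expectation (\<lambda>\<omega>. (X i \<omega> - m)\<^sup>2) = 0" using var[of i] mean[of i] True by simp
      ultimately have "AE \<omega> in M. (X i \<omega> - m)\<^sup>2 = 0"
        by (subst (asm) integral_nonneg_eq_0_iff_AE) auto
      then show ?thesis by eventually_elim simp
    qed
    then have all: "AE \<omega> in M. \<forall>i. X i \<omega> = m" by (simp add: AE_all_countable)
    have "char (distr M borel (\<lambda>\<omega>. (\<Sum>i<n. X i \<omega> - m) / sqrt n)) t = 1" for n
    proof -
      have "char (distr M borel (\<lambda>\<omega>. (\<Sum>i<n. X i \<omega> - m) / sqrt n)) t =
        (CLINT \<omega>|M. iexp (t * ((\<Sum>i<n. X i \<omega> - m) / sqrt n)))"
        unfolding char_def by (subst integral_distr) auto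
      also have "\<dots> = (CLINT \<omega>|M. 1)"
      proof (rule integral_cong_AE)
        show "AE \<omega> in M. iexp (t * ((\<Sum>i<n. X i \<omega> - m) / sqrt n)) = 1"
          using all by eventually_elim simp
      qed auto
      finally show ?thesis by (simp add: prob_space)
    qed
    then show ?thesis using True by simp
  next
    case False
    then have pos: "0 < sqrt v" using v0 by simp
    let ?S = "\<lambda>n x. (\<Sum>i<n. X i x - m) / sqrt (n * (sqrt v)\<^sup>2)"
    have rd: "real_distribution (distr M borel (?S n))" for n
      by (rule real_distribution_distr) auto
    have wc: "weak_conv_m (\<lambda>n. distr M borel (?S n)) std_normal_distribution"
      by (rule central_limit_theorem[OF indep mean pos sq _ ident]) (use var v0 in simp)
    have "(\<lambda>n. char (distr M borel (?S n)) (t * sqrt v))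
        \<longlonglongrightarrow> char std_normal_distribution (t * sqrt v)"
      by (rule levy_continuity1[OF rd real_dist_normal_dist wc])
    moreover have "char (distr M borel (?S n)) (t * sqrt v) =
        char (distr M borel (\<lambda>\<omega>. (\<Sum>i<n. X i \<omega> - m) / sqrt n)) t" for n
    proof -
      have e: "t * sqrt v * ((\<Sum>i<n. X i x - m) / sqrt (n * (sqrt v)\<^sup>2)) = t * ((\<Sum>i<n. X i x - m) / sqrt n)" for x
        using pos by (simp add: real_sqrt_mult)
      show ?thesis unfolding char_def
        by (subst (1 2) integral_distr) (auto simp only: e, auto)
    qed
    ultimately show ?thesis
      using v0 by (simp add: char_std_normal_distribution power_mult_distrib exp_of_real)
  qed
qed

text \<open>
  The weak law of large numbers as a consequence of the central limit theorem: the centred sums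
  divided by \<open>sqrt n\<close> are tight, so dividing once more by \<open>sqrt n\<close> sends them to 0.
\<close>
lemma (in prob_space) iid_mean_tendsto_in_prob:
  fixes X :: "nat \<Rightarrow> 'a \<Rightarrow> real"
  assumes indep: "indep_vars (\<lambda>_. borel) X UNIV"
    and mean: "\<And>i. expectation (X i) = m"
    and sq: "\<And>i. integrable M (\<lambda>\<omega>. (X i \<omega>)\<^sup>2)"
    and var: "\<And>i. variance (X i) = v"
    and ident: "\<And>i. distr M borel (X i) = \<mu>"
    and e: "0 < e"
  shows "(\<lambda>n. prob {\<omega> \<in> space M. e < \<bar>(\<Sum>i<n. X i \<omega>) / n - m\<bar>}) \<longlonglongrightarrow> 0"
proof (rule tendstoI)
  fix d :: real assume d: "0 < d"
  have X[measurable]: "X i \<in> borel_measurable M" for i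
    using indep unfolding indep_vars_def by auto
  have v0: "0 \<le> v" using variance_positive[of "X 0"] var by simp
  interpret G: real_distribution std_normal_distribution by (rule real_dist_normal_dist)
  define N where "N = distr std_normal_distribution borel (\<lambda>y. sqrt v * y)"
  define \<nu> where "\<nu> n = distr M borel (\<lambda>\<omega>. (\<Sum>i<n. X i \<omega> - m) / sqrt n)" for n
  have "char N t = exp (- (t\<^sup>2 * v) / 2)" for t
  proof -
    have "char N t = char std_normal_distribution (t * sqrt v)"
      unfolding N_def char_def by (subst integral_distr) (auto simp: mult_ac)
    then show ?thesis using v0 by (simp add: char_std_normal_distribution power_mult_distrib exp_of_real)
  qed
  then have conv: "(\<lambda>n. char_vec (\<nu> n) a) \<longlonglongrightarrow> char_vec N a" for a
    using iid_sum_char_tendsto[OF indep mean sq var ident, of a] by (simp add: char_vec_real \<nu>_def)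
  obtain R where R: "0 < R" "\<forall>\<^sub>F n in sequentially. measure (\<nu> n) {x. R < norm x} < d"
  proof (rule tight_of_char_vec_tendsto[where \<mu> = \<nu> and N = N, OF _ _ _ _ conv d])
    show "prob_space (\<nu> n)" for n unfolding \<nu>_def by (rule prob_space_distr) auto
    show "prob_space N" unfolding N_def by (rule G.prob_space_distr) auto
  qed (auto simp: \<nu>_def N_def)
  have "\<forall>\<^sub>F n in sequentially. R < e * sqrt (real n)"
  proof -
    have "filterlim (\<lambda>n. e * sqrt (real n)) at_top sequentially"
      using e by (intro filterlim_tendsto_pos_mult_at_top[OF tendsto_const e]
          filterlim_compose[OF sqrt_at_top filterlim_real_sequentially])
    then show ?thesis by (simp add: filterlim_at_top_dense)
  qed
  with R(2) eventually_gt_at_top[of 0]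
  show "\<forall>\<^sub>F n in sequentially. dist (prob {\<omega> \<in> space M. e < \<bar>(\<Sum>i<n. X i \<omega>) / n - m\<bar>}) 0 < d"
  proof eventually_elim
    case (elim n)
    have "prob {\<omega> \<in> space M. e < \<bar>(\<Sum>i<n. X i \<omega>) / n - m\<bar>} \<le>
      prob {\<omega> \<in> space M. R < \<bar>(\<Sum>i<n. X i \<omega> - m) / sqrt n\<bar>}"
    proof (rule finite_measure_mono, safe)
      fix \<omega> assume w: "e < \<bar>(\<Sum>i<n. X i \<omega>) / n - m\<bar>"
      have "(\<Sum>i<n. X i \<omega> - m) / sqrt n = ((\<Sum>i<n. X i \<omega>) / n - m) * sqrt n"
        using elim by (simp add: sum_subtractf field_simps real_sqrt_mult_self flip: real_sqrt_mult)
      then have "e * sqrt n < \<bar>(\<Sum>i<n. X i \<omega> - m) / sqrt n\<bar>"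
        using w elim by (simp add: abs_mult)
      then show "R < \<bar>(\<Sum>i<n. X i \<omega> - m) / sqrt n\<bar>" using elim by simp
    qed measurable
    also have "\<dots> = measure (\<nu> n) {x. R < norm x}"
      unfolding \<nu>_def by (subst measure_distr) (auto intro!: arg_cong[where f = prob])
    finally show ?case using elim by (simp add: dist_real_def)
  qed
qed

lemma sum_mset_superposition:
  fixes f :: "'a \<Rightarrow> 'b::comm_monoid_add"
  shows "(\<Sum>x\<in>#superposition Z n \<omega>. f x) = (\<Sum>i<n. \<Sum>x\<in>Z i \<omega>. f x)"
proof -
  have "(\<Sum>x\<in>Z i \<omega>. f x) = (\<Sum>x\<in>#mset_set (Z i \<omega>). f x)" for i
    by (rule sum_unfold_sum_mset)
  then show ?thesis unfolding superposition_def by (induction n) simp_all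
qed

text \<open>
  A sum over the superposition of \<open>n\<close> processes is a sum of \<open>n\<close> independent, identically distributed
  variables, whose mean \<open>m\<close> and variance \<open>v\<close> are known from the pair correlation function.
\<close>
lemma superposition_limits:
  fixes \<kappa> f :: "'a::euclidean_space \<Rightarrow> real" and m v :: real and Z :: "nat \<Rightarrow> 'w \<Rightarrow> 'a set"
  assumes iid: "iid_point_processes M S Z" and Z: "\<And>i. pcf_process M S \<kappa> g (Z i)"
    and f: "f \<in> borel_measurable borel" "\<And>u. \<bar>f u\<bar> \<le> K"
  defines "m \<equiv> (LINT u:S|lborel. f u * \<kappa> u)"
    and "v \<equiv> (LINT u:S|lborel. (f u)\<^sup>2 * \<kappa> u) +
      (LINT u:S|lborel. LINT v:S|lborel. f u * f v * \<kappa> u * \<kappa> v * (g u v - 1))"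
  shows superposition_clt: "(\<lambda>n. char (distr M borel
      (\<lambda>\<omega>. ((\<Sum>x\<in>#superposition Z n \<omega>. f x) - n * m) / sqrt n)) t) \<longlonglongrightarrow> exp (- (t\<^sup>2 * v) / 2)"
    and superposition_lln: "0 < e \<Longrightarrow> (\<lambda>n. measure M {\<omega> \<in> space M.
      e < \<bar>(\<Sum>x\<in>#superposition Z n \<omega>. f x) / n - m\<bar>}) \<longlonglongrightarrow> 0"
proof -
  interpret prob_space M by (rule pcf_process.axioms(1)[OF Z])
  define F where "F A = (\<Sum>x\<in>A. f x)" for A
  have F[measurable]: "F \<in> borel_measurable (config_space S)"
    unfolding F_def[abs_def] by (rule measurable_sum_config_space[OF f(1)])
  define X where "X i \<omega> = F (Z i \<omega>)" for i \<omega>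
  have Zm: "Z i \<in> measurable M (config_space S)" for i
    using pcf_process.Z[OF Z] by (simp add: has_pair_correlation_def has_intensity_def point_process_def)
  have indep: "indep_vars (\<lambda>_. borel) X UNIV"
    unfolding X_def by (rule indep_vars_compose2[OF _ F]) (use iid in \<open>simp add: iid_point_processes_def\<close>)
  have ident: "distr M borel (X i) = distr (distr M (config_space S) (Z 0)) borel F" for i
  proof -
    have "distr M borel (X i) = distr (distr M (config_space S) (Z i)) borel F"
      using Zm F by (simp add: distr_distr X_def[abs_def] comp_def)
    then show ?thesis using iid unfolding iid_point_processes_def by metis
  qed
  note mom = pcf_process.pair_correlation_moments[OF Z f]
  have mean: "expectation (X i) = m" and sq: "integrable M (\<lambda>\<omega>. (X i \<omega>)\<^sup>2)" and var: "variance (X i) = v" for i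
    using mom[of i] by (simp_all add: X_def[abs_def] F_def[abs_def] m_def v_def)
  have eq: "(\<Sum>x\<in>#superposition Z n \<omega>. f x) = (\<Sum>i<n. X i \<omega>)" for n \<omega>
    by (simp add: sum_mset_superposition X_def F_def)
  show "(\<lambda>n. char (distr M borel
      (\<lambda>\<omega>. ((\<Sum>x\<in>#superposition Z n \<omega>. f x) - n * m) / sqrt n)) t) \<longlonglongrightarrow> exp (- (t\<^sup>2 * v) / 2)"
    using iid_sum_char_tendsto[OF indep mean sq var ident, of t] by (simp add: eq sum_subtractf)
  show "(\<lambda>n. measure M {\<omega> \<in> space M.
      e < \<bar>(\<Sum>x\<in>#superposition Z n \<omega>. f x) / n - m\<bar>}) \<longlonglongrightarrow> 0" if "0 < e"
    using iid_mean_tendsto_in_prob[OF indep mean sq var ident that] by (simp add: eq)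
qed

section \<open>Zeros of monotone maps close to a linear map\<close>

lemma coercive_linear_bij:
  fixes A :: "'a::euclidean_space \<Rightarrow> 'a"
  assumes A: "linear A" and c: "0 < c" and coer: "\<And>x. c * (norm x)\<^sup>2 \<le> x \<bullet> A x"
  obtains B where "linear B" "\<And>x. A (B x) = x" "\<And>x. B (A x) = x" "\<And>x. norm (B x) \<le> norm x / c"
proof -
  have inj: "inj A"
  proof (rule linear_injective_0[OF A, THEN iffD2], safe)
    fix x assume "A x = 0"
    then show "x = 0" using coer[of x] c by (simp add: mult_le_0_iff not_le[symmetric])
  qed
  obtain B where B: "linear B" "\<forall>x. B (A x) = x" "\<forall>x. A (B x) = x"
    using linear_injective_isomorphism[OF A inj] by blast
  have "norm (B x) \<le> norm x / c" for x
  proof (cases "B x = 0")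
    case False
    have "c * (norm (B x))\<^sup>2 \<le> B x \<bullet> x" using coer[of "B x"] B by simp
    also have "\<dots> \<le> norm (B x) * norm x" by (rule norm_cauchy_schwarz)
    finally have "norm (B x) * (c * norm (B x)) \<le> norm (B x) * norm x"
      by (simp add: power2_eq_square mult_ac)
    then show ?thesis using False c by (simp add: pos_le_divide_eq mult.commute)
  qed (use c in simp)
  with B that show ?thesis by blast
qed

text \<open>
  Zeros of \<open>F\<close> are fixed points of \<open>y \<mapsto> y + A\<^sup>-\<^sup>1 F(y)\<close>, and coercivity bounds the inverse by
  \<open>1/c\<close>, so this map sends the ball into itself and Brouwer's theorem applies. On the sphere \<open>F\<close>
  points strictly inwards; a zero beyond the sphere would contradict monotonicity along the
  segment that joins it to the centre.
\<close>
lemma zero_of_monotone_near_linear: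
  fixes A F :: "'a::euclidean_space \<Rightarrow> 'a"
  assumes A: "linear A" and c: "0 < c" and coer: "\<And>x. c * (norm x)\<^sup>2 \<le> x \<bullet> A x"
    and e: "0 < e" and F: "continuous_on (cball y0 e) F"
    and near: "\<And>y. y \<in> cball y0 e \<Longrightarrow> norm (F y + A (y - y0)) < c * e"
    and mono: "\<And>x y. (x - y) \<bullet> (F x - F y) \<le> 0"
  shows "\<exists>y\<in>cball y0 e. F y = 0" and "F y = 0 \<Longrightarrow> y \<in> cball y0 e"
proof -
  obtain B where B: "linear B" "\<And>x. A (B x) = x" "\<And>x. B (A x) = x" "\<And>x. norm (B x) \<le> norm x / c"
    using coercive_linear_bij[OF A c coer] by blast
  define G where "G y = y + B (F y)" for y
  have "continuous_on (cball y0 e) G"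
    unfolding G_def
    by (intro continuous_intros F linear_continuous_on_compose[OF F B(1)])
  moreover have "G \<in> cball y0 e \<rightarrow> cball y0 e"
  proof
    fix y assume y: "y \<in> cball y0 e"
    have "G y - y0 = B (F y + A (y - y0))"
      using B(3)[of "y - y0"] by (simp add: G_def linear_add[OF B(1)])
    then have "norm (G y - y0) \<le> norm (F y + A (y - y0)) / c" using B(4) by metis
    also have "\<dots> \<le> e" using near[OF y] c by (simp add: pos_divide_le_eq mult.commute)
    finally show "G y \<in> cball y0 e" by (simp add: dist_norm norm_minus_commute)
  qed
  ultimately obtain y where y: "y \<in> cball y0 e" "G y = y"
    using e by (auto intro: brouwer[OF compact_cball convex_cball, of y0 e G])
  then have "B (F y) = 0" by (simp add: G_def)
  then have "F y = 0" using B(2)[of "F y"] linear_0[OF A] by simp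
  with y show "\<exists>y\<in>cball y0 e. F y = 0" by blast
  show "y \<in> cball y0 e" if 0: "F y = 0" for y
  proof (rule ccontr)
    assume "\<not> ?thesis"
    then have r: "e < norm (y - y0)" by (simp add: dist_norm norm_minus_commute)
    define s where "s = e / norm (y - y0)"
    define x where "x = y0 + s *\<^sub>R (y - y0)"
    have np: "0 < norm (y - y0)" using e r by linarith
    have s: "0 < s" "s < 1"
      using divide_pos_pos[OF e np] pos_divide_less_eq[OF np, of e 1] r by (simp_all add: s_def)
    have nx: "norm (x - y0) = e" using e np by (simp add: x_def s_def)
    have "y - x = (1 - s) *\<^sub>R (y - y0)" by (simp add: x_def algebra_simps)
    with mono[of y x] 0 s have "0 \<le> (y - y0) \<bullet> F x"
      by (simp add: mult_le_0_iff zero_le_mult_iff)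
    then have "0 \<le> (x - y0) \<bullet> F x" using s by (simp add: x_def)
    moreover have "(x - y0) \<bullet> F x = (x - y0) \<bullet> (F x + A (x - y0)) - (x - y0) \<bullet> A (x - y0)"
      by (simp add: inner_add_right)
    moreover have "(x - y0) \<bullet> (F x + A (x - y0)) \<le> e * norm (F x + A (x - y0))"
      using norm_cauchy_schwarz[of "x - y0" "F x + A (x - y0)"] nx by simp
    moreover have "e * norm (F x + A (x - y0)) < e * (c * e)"
      using near[of x] nx e by (simp add: dist_norm norm_minus_commute)
    moreover have "c * e\<^sup>2 \<le> (x - y0) \<bullet> A (x - y0)" using coer[of "x - y0"] nx by simp
    ultimately show False by (simp add: power2_eq_square mult_ac)
  qed
qed

section \<open>The logistic score\<close>

text \<open>
  As a function of \<open>t = \<theta> \<bullet> z(x)\<close>, with \<open>\<beta> = b(x)\<close> and \<open>r = \<rho>(x)\<close>, this is the probability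
  \<open>\<lambda>(x; \<theta>)/(\<lambda>(x; \<theta>) + \<rho>(x))\<close> of the logistic regression.
\<close>
definition sigmoid :: "real \<Rightarrow> real \<Rightarrow> real \<Rightarrow> real" where
  "sigmoid \<beta> r t = \<beta> * exp t / (\<beta> * exp t + r)"

context
  fixes \<beta> r :: real assumes pos: "0 < \<beta>" "0 < r"
begin

lemma sigmoid_bounds: "0 < sigmoid \<beta> r t" "sigmoid \<beta> r t < 1"
  using pos by (auto simp: sigmoid_def add_pos_pos intro!: divide_pos_pos)

lemma one_minus_sigmoid: "1 - sigmoid \<beta> r t = r / (\<beta> * exp t + r)"
proof -
  have "\<beta> * exp t + r > 0" using pos by (simp add: add_pos_pos)
  then show ?thesis by (simp add: sigmoid_def field_simps)
qed

lemma sigmoid_deriv: "(sigmoid \<beta> r has_real_derivative sigmoid \<beta> r t * (1 - sigmoid \<beta> r t)) (at t within A)"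
proof -
  have p: "\<beta> * exp t + r > 0" using pos by (simp add: add_pos_pos)
  have "((\<lambda>t. \<beta> * exp t / (\<beta> * exp t + r)) has_real_derivative
    (\<beta> * exp t * (\<beta> * exp t + r) - \<beta> * exp t * (\<beta> * exp t)) / ((\<beta> * exp t + r) * (\<beta> * exp t + r))) (at t within A)"
    using p by (auto intro!: derivative_eq_intros)
  moreover have "(\<beta> * exp t * (\<beta> * exp t + r) - \<beta> * exp t * (\<beta> * exp t)) / ((\<beta> * exp t + r) * (\<beta> * exp t + r)) =
    sigmoid \<beta> r t * (1 - sigmoid \<beta> r t)"
    unfolding one_minus_sigmoid using p by (simp add: sigmoid_def field_simps)
  ultimately show ?thesis by (simp add: sigmoid_def[abs_def])
qed

lemma sigmoid_mono: "s \<le> t \<Longrightarrow> sigmoid \<beta> r s \<le> sigmoid \<beta> r t"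
  by (rule DERIV_nonneg_imp_nondecreasing[of s t "sigmoid \<beta> r"])
    (auto intro!: exI sigmoid_deriv mult_nonneg_nonneg simp: less_imp_le[OF sigmoid_bounds(1)] less_imp_le[OF sigmoid_bounds(2)])

text \<open>
  The first derivative is \<open>w = s(1 - s)\<close> and the second is \<open>w(1 - 2s)\<close>, both at most 1 in
  absolute value; two applications of the mean value inequality give the quadratic remainder.
\<close>
lemma sigmoid_taylor: "\<bar>sigmoid \<beta> r (t + d) - sigmoid \<beta> r t - sigmoid \<beta> r t * (1 - sigmoid \<beta> r t) * d\<bar> \<le> d\<^sup>2"
proof -
  let ?w = "\<lambda>t. sigmoid \<beta> r t * (1 - sigmoid \<beta> r t)"
  have w01: "0 \<le> ?w s" "?w s \<le> 1" for s
    using sigmoid_bounds[of s] by (auto intro!: mult_nonneg_nonneg mult_le_one)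
  have wd: "(?w has_real_derivative ?w s * (1 - 2 * sigmoid \<beta> r s)) (at s within A)" for s A
    by (auto intro!: derivative_eq_intros sigmoid_deriv simp: algebra_simps)
  have wl: "\<bar>?w s - ?w t\<bar> \<le> \<bar>s - t\<bar>" for s
  proof -
    have "norm (?w s - ?w t) \<le> 1 * norm (s - t)"
    proof (rule field_differentiable_bound[OF convex_UNIV])
      show "(?w has_real_derivative ?w s * (1 - 2 * sigmoid \<beta> r s)) (at s within UNIV)" for s by (rule wd)
      fix s
      have "\<bar>1 - 2 * sigmoid \<beta> r s\<bar> \<le> 1" using sigmoid_bounds[of s] by linarith
      then show "norm (?w s * (1 - 2 * sigmoid \<beta> r s)) \<le> 1"
        using w01[of s] by (simp only: real_norm_def abs_mult) (intro mult_le_one; simp)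
    qed auto
    then show ?thesis by simp
  qed
  have "norm ((sigmoid \<beta> r (t + d) - ?w t * (t + d)) - (sigmoid \<beta> r t - ?w t * t)) \<le> \<bar>d\<bar> * norm ((t + d) - t)"
  proof (rule field_differentiable_bound[of "cball t \<bar>d\<bar>"])
    show "((\<lambda>s. sigmoid \<beta> r s - ?w t * s) has_real_derivative ?w s - ?w t) (at s within cball t \<bar>d\<bar>)" for s
      by (auto intro!: derivative_eq_intros sigmoid_deriv)
    show "norm (?w s - ?w t) \<le> \<bar>d\<bar>" if "s \<in> cball t \<bar>d\<bar>" for s
      using wl[of s] that by (simp add: dist_real_def)
  qed (auto simp: dist_real_def)
  then show ?thesis by (simp add: algebra_simps power2_eq_square abs_mult_self_eq flip: abs_mult)
qed

end

lemma norm_sum_mset_le: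
  fixes f :: "'a \<Rightarrow> 'b::real_normed_vector" and C :: real
  assumes "\<And>x. x \<in># X \<Longrightarrow> norm (f x) \<le> C"
  shows "norm (\<Sum>x\<in>#X. f x) \<le> size X * C"
  using assms
proof (induction X)
  case (add x X)
  have "norm (\<Sum>x\<in>#add_mset x X. f x) \<le> norm (f x) + norm (\<Sum>x\<in>#X. f x)"
    by (simp add: norm_triangle_ineq)
  also have "\<dots> \<le> C + size X * C" using add by (intro add_mono) auto
  finally show ?case by (simp add: algebra_simps)
qed simp

lemma sum_mset_diff:
  fixes f g :: "'a \<Rightarrow> 'b::ab_group_add"
  shows "(\<Sum>x\<in>#X. f x - g x) = (\<Sum>x\<in>#X. f x) - (\<Sum>x\<in>#X. g x)"
  by (induction X) simp_all

lemma inner_sum_mset_right: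
  fixes f :: "'a \<Rightarrow> 'b::real_inner"
  shows "a \<bullet> (\<Sum>x\<in>#X. f x) = (\<Sum>x\<in>#X. a \<bullet> f x)"
  by (induction X) (simp_all add: inner_add_right)

lemma sum_mset_nonneg_real:
  fixes f :: "'a \<Rightarrow> real"
  shows "(\<And>x. x \<in># X \<Longrightarrow> 0 \<le> f x) \<Longrightarrow> 0 \<le> (\<Sum>x\<in>#X. f x)"
  by (induction X) auto

text \<open>The derivative of the sigmoid at \<open>\<theta> \<bullet> z(u)\<close>; it weights the observed information matrix.\<close>
definition logistic_weight :: "('a \<Rightarrow> real) \<Rightarrow> ('a \<Rightarrow> real^'m) \<Rightarrow> ('a \<Rightarrow> real) \<Rightarrow> real^'m \<Rightarrow> 'a \<Rightarrow> real" where
  "logistic_weight b z \<rho> \<theta> u = loglin b z \<theta> u * \<rho> u / (loglin b z \<theta> u + \<rho> u)\<^sup>2"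

context
  fixes b \<rho> :: "'a \<Rightarrow> real" and z :: "'a \<Rightarrow> real^'m" and X D :: "'a multiset"
  assumes pos: "\<And>x. x \<in># X + D \<Longrightarrow> 0 < b x" "\<And>x. x \<in># X + D \<Longrightarrow> 0 < \<rho> x"
begin

lemma loglin_sigmoid: "loglin b z \<theta> x / (loglin b z \<theta> x + \<rho> x) = sigmoid (b x) (\<rho> x) (\<theta> \<bullet> z x)"
  by (simp add: loglin_def sigmoid_def)

text \<open>
  Only the second sum depends on \<open>\<theta>\<close>, and it treats data and dummy points alike. Monotonicity,
  continuity and the Taylor expansion of the score all reduce to the sigmoid through this form.
\<close>
lemma logistic_score_eq:
  "logistic_score b z \<rho> X D \<theta> =
    (\<Sum>x\<in>#X. z x) - (\<Sum>x\<in>#X + D. sigmoid (b x) (\<rho> x) (\<theta> \<bullet> z x) *\<^sub>R z x)"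
proof -
  have "(\<Sum>x\<in>#X. (\<rho> x / (loglin b z \<theta> x + \<rho> x)) *\<^sub>R z x) =
      (\<Sum>x\<in>#X. z x - sigmoid (b x) (\<rho> x) (\<theta> \<bullet> z x) *\<^sub>R z x)"
  proof (rule arg_cong[where f = sum_mset], rule image_mset_cong)
    fix x assume "x \<in># X"
    then have "0 < b x" "0 < \<rho> x" using pos[of x] by auto
    from one_minus_sigmoid[OF this, of "\<theta> \<bullet> z x"]
    show "(\<rho> x / (loglin b z \<theta> x + \<rho> x)) *\<^sub>R z x = z x - sigmoid (b x) (\<rho> x) (\<theta> \<bullet> z x) *\<^sub>R z x"
      by (simp add: loglin_def[symmetric] scaleR_left_diff_distrib[symmetric] flip: scaleR_one)
        (metis scaleR_left_diff_distrib scaleR_one)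
  qed
  then show ?thesis by (simp add: logistic_score_def sum_mset_diff loglin_sigmoid)
qed

text \<open>The concavity of the logistic log-likelihood, expressed by its gradient.\<close>
lemma logistic_score_monotone:
  "(\<theta> - \<theta>') \<bullet> (logistic_score b z \<rho> X D \<theta> - logistic_score b z \<rho> X D \<theta>') \<le> 0"
proof -
  let ?\<phi> = "\<lambda>\<theta> x. sigmoid (b x) (\<rho> x) (\<theta> \<bullet> z x)"
  have "(\<theta> - \<theta>') \<bullet> (logistic_score b z \<rho> X D \<theta> - logistic_score b z \<rho> X D \<theta>') =
    - (\<Sum>x\<in>#X + D. (\<theta> - \<theta>') \<bullet> (?\<phi> \<theta> x *\<^sub>R z x - ?\<phi> \<theta>' x *\<^sub>R z x))"
    unfolding logistic_score_eq inner_sum_mset_right[symmetric] sum_mset_diff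
    by (simp add: inner_diff_right inner_add_right)
  moreover have "0 \<le> (\<Sum>x\<in>#X + D. (\<theta> - \<theta>') \<bullet> (?\<phi> \<theta> x *\<^sub>R z x - ?\<phi> \<theta>' x *\<^sub>R z x))"
  proof (rule sum_mset_nonneg_real)
    fix x assume x: "x \<in># X + D"
    have "(\<theta> - \<theta>') \<bullet> (?\<phi> \<theta> x *\<^sub>R z x - ?\<phi> \<theta>' x *\<^sub>R z x) = (?\<phi> \<theta> x - ?\<phi> \<theta>' x) * (\<theta> \<bullet> z x - \<theta>' \<bullet> z x)"
      by (simp add: inner_diff_left inner_diff_right algebra_simps)
    also have "\<dots> \<ge> 0"
      using sigmoid_mono[OF pos(1)[OF x] pos(2)[OF x]]
      by (cases "\<theta> \<bullet> z x \<le> \<theta>' \<bullet> z x") (auto intro: mult_nonpos_nonpos mult_nonneg_nonneg)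
    finally show "0 \<le> (\<theta> - \<theta>') \<bullet> (?\<phi> \<theta> x *\<^sub>R z x - ?\<phi> \<theta>' x *\<^sub>R z x)" .
  qed
  ultimately show ?thesis by simp
qed

lemma logistic_score_continuous: "continuous_on A (logistic_score b z \<rho> X D)"
proof -
  have "continuous_on A (\<lambda>\<theta>. \<Sum>x\<in>#Y. sigmoid (b x) (\<rho> x) (\<theta> \<bullet> z x) *\<^sub>R z x)" if "set_mset Y \<subseteq> set_mset (X + D)" for Y
    using that
  proof (induction Y)
    case (add x Y)
    then have x: "0 < b x" "0 < \<rho> x" using pos[of x] by auto
    have "continuous_on UNIV (sigmoid (b x) (\<rho> x))"
      by (rule DERIV_continuous_on[OF sigmoid_deriv[OF x]])
    then have "continuous_on A (\<lambda>\<theta>. sigmoid (b x) (\<rho> x) (\<theta> \<bullet> z x))"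
      by (rule continuous_on_compose2) (auto intro!: continuous_intros)
    with add show ?case by (auto intro!: continuous_intros)
  qed simp
  then have "continuous_on A (\<lambda>\<theta>. \<Sum>x\<in>#X + D. sigmoid (b x) (\<rho> x) (\<theta> \<bullet> z x) *\<^sub>R z x)"
    by blast
  then show ?thesis
    unfolding logistic_score_eq[abs_def] by (intro continuous_on_diff continuous_on_const)
qed

lemma logistic_score_taylor:
  fixes \<theta> h :: "real^'m"
  assumes K: "\<And>x. x \<in># X + D \<Longrightarrow> norm (z x) \<le> K"
  defines "J \<equiv> (\<chi> k l. \<Sum>x\<in>#X + D. logistic_weight b z \<rho> \<theta> x * z x $ k * z x $ l)"
  shows "norm (logistic_score b z \<rho> X D (\<theta> + h) - logistic_score b z \<rho> X D \<theta> + J *v h)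
    \<le> size (X + D) * (K ^ 3 * (norm h)\<^sup>2)"
proof -
  let ?\<phi> = "\<lambda>\<theta> x. sigmoid (b x) (\<rho> x) (\<theta> \<bullet> z x)"
  have J: "J *v h = (\<Sum>x\<in>#X + D. (logistic_weight b z \<rho> \<theta> x * (z x \<bullet> h)) *\<^sub>R z x)"
  proof -
    have "(\<chi> k l. \<Sum>x\<in>#Y. logistic_weight b z \<rho> \<theta> x * z x $ k * z x $ l) *v h =
        (\<Sum>x\<in>#Y. (logistic_weight b z \<rho> \<theta> x * (z x \<bullet> h)) *\<^sub>R z x)" for Y
    proof (induction Y)
      case (add x Y)
      have "(\<chi> k l. \<Sum>x\<in>#add_mset x Y. logistic_weight b z \<rho> \<theta> x * z x $ k * z x $ l) =
        (\<chi> k l. logistic_weight b z \<rho> \<theta> x * z x $ k * z x $ l) + (\<chi> k l. \<Sum>x\<in>#Y. logistic_weight b z \<rho> \<theta> x * z x $ k * z x $ l)"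
        by (simp add: vec_eq_iff)
      moreover have "(\<chi> k l. logistic_weight b z \<rho> \<theta> x * z x $ k * z x $ l) *v h = (logistic_weight b z \<rho> \<theta> x * (z x \<bullet> h)) *\<^sub>R z x"
        by (simp add: vec_eq_iff matrix_vector_mult_def inner_vec_def sum_distrib_left sum_distrib_right mult_ac)
      ultimately show ?case using add by (simp add: matrix_vector_mult_add_rdistrib)
    qed (simp add: vec_eq_iff matrix_vector_mult_def)
    then show ?thesis unfolding J_def .
  qed
  have "logistic_score b z \<rho> X D (\<theta> + h) - logistic_score b z \<rho> X D \<theta> + J *v h =
    - (\<Sum>x\<in>#X + D. (?\<phi> (\<theta> + h) x - ?\<phi> \<theta> x - logistic_weight b z \<rho> \<theta> x * (z x \<bullet> h)) *\<^sub>R z x)"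
    unfolding logistic_score_eq J scaleR_left_diff_distrib sum_mset_diff by simp
  also have "norm \<dots> \<le> size (X + D) * (K ^ 3 * (norm h)\<^sup>2)"
    unfolding norm_minus_cancel
  proof (rule norm_sum_mset_le)
    fix x assume x: "x \<in># X + D"
    note p = pos(1)[OF x] pos(2)[OF x]
    have K0: "0 \<le> K" using K[OF x] norm_ge_zero[of "z x"] by linarith
    have w: "logistic_weight b z \<rho> \<theta> x = ?\<phi> \<theta> x * (1 - ?\<phi> \<theta> x)"
      unfolding one_minus_sigmoid[OF p] by (simp add: logistic_weight_def sigmoid_def loglin_def power2_eq_square)
    have zh: "\<bar>z x \<bullet> h\<bar> \<le> K * norm h"
      using Cauchy_Schwarz_ineq2[of "z x" h] mult_right_mono[OF K[OF x], of "norm h"] by simp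
    have "\<bar>?\<phi> (\<theta> + h) x - ?\<phi> \<theta> x - logistic_weight b z \<rho> \<theta> x * (z x \<bullet> h)\<bar> \<le> (z x \<bullet> h)\<^sup>2"
      using sigmoid_taylor[OF p, of "\<theta> \<bullet> z x" "z x \<bullet> h"] unfolding w
      by (simp add: inner_add_left inner_commute[of "z x" h])
    also have "\<dots> \<le> (K * norm h)\<^sup>2"
      using zh by (metis abs_ge_zero power2_abs power_mono)
    finally have "norm ((?\<phi> (\<theta> + h) x - ?\<phi> \<theta> x - logistic_weight b z \<rho> \<theta> x * (z x \<bullet> h)) *\<^sub>R z x) \<le> (K * norm h)\<^sup>2 * K"
      unfolding norm_scaleR using K[OF x] by (intro mult_mono) auto
    then show "norm ((?\<phi> (\<theta> + h) x - ?\<phi> \<theta> x - logistic_weight b z \<rho> \<theta> x * (z x \<bullet> h)) *\<^sub>R z x) \<le> K ^ 3 * (norm h)\<^sup>2"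
      by (simp add: power_mult_distrib power2_eq_square power3_eq_cube mult_ac)
  qed
  finally show ?thesis .
qed

end

text \<open>The constant is the minimum of the form on the unit sphere.\<close>
lemma positive_definite_coercive:
  fixes A :: "real^'m^'m"
  assumes "positive_definite A"
  obtains c where "0 < c" "\<And>x. c * (norm x)\<^sup>2 \<le> x \<bullet> (A *v x)"
proof -
  have pd: "x \<noteq> 0 \<Longrightarrow> 0 < x \<bullet> (A *v x)" for x using assms by (simp add: positive_definite_def)
  have "continuous_on (sphere 0 1) (\<lambda>x. x \<bullet> (A *v x))"
    by (intro continuous_intros matrix_vector_mult_linear_continuous_on)
  moreover have "axis undefined 1 \<in> sphere (0::real^'m) 1" by simp
  ultimately obtain x0 where x0: "x0 \<in> sphere 0 1" "\<And>x. x \<in> sphere 0 1 \<Longrightarrow> x0 \<bullet> (A *v x0) \<le> x \<bullet> (A *v x)"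
    using continuous_attains_inf[OF compact_sphere, of 0 1] by blast
  have c: "0 < x0 \<bullet> (A *v x0)" using x0(1) by (intro pd) auto
  have "x0 \<bullet> (A *v x0) * (norm x)\<^sup>2 \<le> x \<bullet> (A *v x)" for x
  proof (cases "x = 0")
    case False
    define y where "y = (1 / norm x) *\<^sub>R x"
    have x: "x = norm x *\<^sub>R y" using False by (simp add: y_def)
    have "y \<in> sphere 0 1" using False by (simp add: y_def)
    then have "x0 \<bullet> (A *v x0) * (norm x)\<^sup>2 \<le> y \<bullet> (A *v y) * (norm x)\<^sup>2"
      by (intro mult_right_mono x0(2)) auto
    also have "\<dots> = x \<bullet> (A *v x)"
      by (subst (2 3) x) (simp add: matrix_vector_mult_scaleR power2_eq_square)
    finally show ?thesis .
  qed simp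
  with c that show ?thesis by blast
qed

lemma positive_definite_matrix_inv:
  fixes A :: "real^'m^'m"
  assumes "positive_definite A"
  shows "A ** matrix_inv A = mat 1" "matrix_inv A ** A = mat 1"
proof -
  have "x = 0" if "A *v x = 0" for x
    using assms that by (metis positive_definite_def inner_zero_right less_irrefl)
  then have "invertible A" by (simp add: invertible_left_inverse matrix_left_invertible_ker)
  then show "A ** matrix_inv A = mat 1" "matrix_inv A ** A = mat 1"
    unfolding invertible_def matrix_inv_def by (metis (mono_tags, lifting) someI_ex)+
qed

lemma quadratic_form_sum:
  fixes A :: "real^'m^'m"
  shows "c \<bullet> (A *v c) = (\<Sum>k\<in>UNIV. \<Sum>l\<in>UNIV. c $ k * c $ l * A $ k $ l)"
  by (simp add: inner_vec_def matrix_vector_mult_def sum_distrib_left mult_ac)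

text \<open>
  The deterministic core. The map \<open>s\<^sub>n / n\<close> is compared with the linear map of matrix \<open>-U\<close> on the
  ball of radius \<open>\<epsilon>/sqrt n\<close> around \<open>\<theta>\<^sub>0 + B/sqrt n\<close>, where the affine approximation vanishes. The
  hypothesis \<open>small\<close> adds up the two errors, both multiplied by \<open>sqrt n\<close>: the deviation of the
  normalised information matrix from \<open>U\<close>, and the Taylor remainder.
\<close>
lemma logistic_score_zero_near:
  fixes b \<rho> :: "'a \<Rightarrow> real" and z :: "'a \<Rightarrow> real^'m" and X D :: "'a multiset"
    and U U' :: "real^'m^'m" and n :: nat and C :: real and \<theta>0 :: "real^'m"
  assumes pos: "\<And>x. x \<in># X + D \<Longrightarrow> 0 < b x" "\<And>x. x \<in># X + D \<Longrightarrow> 0 < \<rho> x"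
    and K: "0 \<le> K" "\<And>x. x \<in># X + D \<Longrightarrow> norm (z x) \<le> K"
    and c: "0 < c" "\<And>x. c * (norm x)\<^sup>2 \<le> x \<bullet> (U *v x)" and inv: "U ** U' = mat 1"
    and n: "0 < n" and \<epsilon>: "0 < \<epsilon>"
  defines "B \<equiv> (1 / sqrt n) *\<^sub>R (U' *v logistic_score b z \<rho> X D \<theta>0)"
  assumes R: "norm B \<le> R"
    and J: "\<And>k l. \<bar>(\<Sum>x\<in>#X + D. logistic_weight b z \<rho> \<theta>0 x * z x $ k * z x $ l) / n - U $ k $ l\<bar> \<le> \<eta>"
    and C: "size (X + D) \<le> C * n"
    and small: "real CARD('m) * real CARD('m) * \<eta> * (R + \<epsilon>) + C * K ^ 3 * (R + \<epsilon>)\<^sup>2 / sqrt n < c * \<epsilon>"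
  shows "\<exists>\<theta>. logistic_score b z \<rho> X D \<theta> = 0 \<and> norm (\<theta> - \<theta>0) \<le> (R + \<epsilon>) / sqrt n"
    and "logistic_score b z \<rho> X D \<theta> = 0 \<Longrightarrow> norm (sqrt n *\<^sub>R (\<theta> - \<theta>0) - B) \<le> \<epsilon>"
proof -
  let ?s = "logistic_score b z \<rho> X D"
  let ?m = "real CARD('m) * real CARD('m)"
  define J where "J = (\<chi> k l. \<Sum>x\<in>#X + D. logistic_weight b z \<rho> \<theta>0 x * z x $ k * z x $ l)"
  let ?r = "\<lambda>h. ?s (\<theta>0 + h) - ?s \<theta>0 + J *v h"
  define y0 where "y0 = \<theta>0 + (1 / sqrt n) *\<^sub>R B"
  define e where "e = \<epsilon> / sqrt n"
  define F where "F \<theta> = (1 / real n) *\<^sub>R ?s \<theta>" for \<theta>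
  have sn: "0 < sqrt (real n)" using n by simp
  have e: "0 < e" using \<epsilon> sn by (simp add: e_def)
  have UB: "U *v ((1 / sqrt n) *\<^sub>R B) = F \<theta>0"
  proof -
    have "U *v (U' *v w) = w" for w using inv by (simp add: matrix_vector_mul_assoc)
    then show ?thesis using n by (simp add: B_def F_def matrix_vector_mult_scaleR flip: real_sqrt_mult)
  qed
  have hbound: "norm (y - \<theta>0) \<le> (R + \<epsilon>) / sqrt n" if "y \<in> cball y0 e" for y
  proof -
    have "norm (y - \<theta>0) \<le> norm (y - y0) + norm ((1 / sqrt n) *\<^sub>R B)"
      using norm_triangle_ineq[of "y - y0" "(1 / sqrt n) *\<^sub>R B"] by (simp add: y0_def)
    also have "\<dots> \<le> e + R / sqrt n"
      using that R sn by (intro add_mono) (auto simp: dist_norm norm_minus_commute divide_right_mono)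
    finally show ?thesis by (simp add: e_def add_divide_distrib)
  qed
  have near: "norm (F y + U *v (y - y0)) < c * e" if y: "y \<in> cball y0 e" for y
  proof -
    define h where "h = y - \<theta>0"
    have h: "norm h \<le> (R + \<epsilon>) / sqrt n" using hbound[OF y] by (simp add: h_def)
    have RE: "0 \<le> R + \<epsilon>" using R norm_ge_zero[of B] \<epsilon> by linarith
    have C0: "0 \<le> C"
    proof -
      have "0 \<le> C * n" by (rule order_trans[OF of_nat_0_le_iff C])
      then show ?thesis using n by (simp add: zero_le_mult_iff)
    qed
    have \<eta>0: "0 \<le> \<eta>" by (rule order_trans[OF abs_ge_zero J])
    have "y - y0 = h - (1 / sqrt n) *\<^sub>R B" by (simp add: y0_def h_def)
    then have Uy: "U *v (y - y0) = U *v h - F \<theta>0"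
      by (simp only: matrix_vector_mult_diff_distrib UB)
    have eq: "F y + U *v (y - y0) = (1 / real n) *\<^sub>R ?r h + (U - (1 / real n) *\<^sub>R J) *v h"
      unfolding Uy matrix_vector_mult_diff_rdistrib scaleR_matrix_vector_assoc[symmetric]
      by (simp add: F_def h_def scaleR_diff_right scaleR_add_right)
    have "norm (F y + U *v (y - y0)) \<le> norm ((1 / real n) *\<^sub>R ?r h)
        + norm ((U - (1 / real n) *\<^sub>R J) *v h)"
      unfolding eq by (rule norm_triangle_ineq)
    also have "norm ((1 / real n) *\<^sub>R ?r h) \<le> C * K ^ 3 * (R + \<epsilon>)\<^sup>2 / sqrt n / sqrt n"
    proof -
      have "norm (?r h) \<le> size (X + D) * (K ^ 3 * (norm h)\<^sup>2)"
        unfolding J_def by (rule logistic_score_taylor[OF pos K(2)])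
      also have "\<dots> \<le> (C * n) * (K ^ 3 * ((R + \<epsilon>) / sqrt n)\<^sup>2)"
        using C C0 K h by (intro mult_mono power_mono) auto
      finally have "norm (?r h) \<le> (C * n) * (K ^ 3 * ((R + \<epsilon>) / sqrt n)\<^sup>2)" .
      then have "norm ((1 / real n) *\<^sub>R ?r h) \<le> (1 / real n) * ((C * n) * (K ^ 3 * ((R + \<epsilon>) / sqrt n)\<^sup>2))"
        unfolding norm_scaleR by (intro mult_mono) auto
      also have "\<dots> = C * K ^ 3 * (R + \<epsilon>)\<^sup>2 / sqrt n / sqrt n"
        using n by (simp add: power_divide flip: real_sqrt_mult)
      finally show ?thesis .
    qed
    also have "norm ((U - (1 / real n) *\<^sub>R J) *v h) \<le> ?m * \<eta> * (R + \<epsilon>) / sqrt n"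
    proof -
      have "norm ((U - (1 / real n) *\<^sub>R J) *v h) \<le> onorm ((*v) (U - (1 / real n) *\<^sub>R J)) * norm h"
        by (rule onorm) (rule matrix_vector_mul_bounded_linear)
      also have "\<dots> \<le> (?m * \<eta>) * ((R + \<epsilon>) / sqrt n)"
      proof (intro mult_mono onorm_le_matrix_component h)
        show "\<bar>(U - (1 / real n) *\<^sub>R J) $ i $ j\<bar> \<le> \<eta>" for i j
          using J[of i j] by (simp add: J_def abs_minus_commute)
      qed (use \<eta>0 in auto)
      finally show ?thesis by simp
    qed
    also have "C * K ^ 3 * (R + \<epsilon>)\<^sup>2 / sqrt n / sqrt n + ?m * \<eta> * (R + \<epsilon>) / sqrt n
        = (?m * \<eta> * (R + \<epsilon>) + C * K ^ 3 * (R + \<epsilon>)\<^sup>2 / sqrt n) / sqrt n"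
      by (simp add: add_divide_distrib)
    also have "\<dots> < c * \<epsilon> / sqrt n" using small sn by (rule divide_strict_right_mono)
    finally show ?thesis by (simp add: e_def)
  qed
  have lin: "linear ((*v) U)" by simp
  have cont: "continuous_on (cball y0 e) F"
    unfolding F_def by (intro continuous_intros logistic_score_continuous[OF pos])
  have mono: "(x - y) \<bullet> (F x - F y) \<le> 0" for x y
  proof -
    have "(x - y) \<bullet> (F x - F y) = ((x - y) \<bullet> (?s x - ?s y)) / n"
      by (simp add: F_def inner_diff_right diff_divide_distrib)
    moreover have "(x - y) \<bullet> (?s x - ?s y) \<le> 0" by (rule logistic_score_monotone[OF pos])
    ultimately show ?thesis using n by (simp add: divide_nonpos_pos)
  qed
  note Z = zero_of_monotone_near_linear[OF lin c(1) c(2) e cont near mono]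
  have F0: "F \<theta> = 0 \<longleftrightarrow> ?s \<theta> = 0" for \<theta> using n by (simp add: F_def)
  show "\<exists>\<theta>. ?s \<theta> = 0 \<and> norm (\<theta> - \<theta>0) \<le> (R + \<epsilon>) / sqrt n"
    using Z(1) hbound F0 by blast
  show "norm (sqrt n *\<^sub>R (\<theta> - \<theta>0) - B) \<le> \<epsilon>" if "?s \<theta> = 0" for \<theta>
  proof -
    have "\<theta> \<in> cball y0 e" using Z(2) F0 that by blast
    then have le: "norm (\<theta> - y0) \<le> \<epsilon> / sqrt n" by (simp add: dist_norm norm_minus_commute e_def)
    have "sqrt n *\<^sub>R (\<theta> - \<theta>0) - B = sqrt n *\<^sub>R (\<theta> - y0)"
      using sn by (simp add: y0_def algebra_simps)
    then have "norm (sqrt n *\<^sub>R (\<theta> - \<theta>0) - B) = sqrt n * norm (\<theta> - y0)" by simp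
    also have "\<dots> \<le> sqrt n * (\<epsilon> / sqrt n)" using le sn by (intro mult_left_mono) auto
    finally show ?thesis using sn by simp
  qed
qed

section \<open>Asymptotic normality of the logistic estimator\<close>

text \<open>
  The sampling model at the true parameter. The window \<open>S\<close> is any Borel set of a Euclidean space,
  and \<open>K\<close> is a bound for the covariates.
\<close>
locale logistic_sampling = prob_space M for M :: "'w measure" +
  fixes S :: "'a::euclidean_space set" and Y E :: "nat \<Rightarrow> 'w \<Rightarrow> 'a set"
    and b \<rho> :: "'a \<Rightarrow> real" and z :: "'a \<Rightarrow> real^'m" and g :: "'a \<Rightarrow> 'a \<Rightarrow> real"
    and \<theta>0 :: "real^'m" and K :: real
  assumes S[measurable]: "S \<in> sets borel"
    and iid_Y: "iid_point_processes M S Y" and iid_E: "iid_point_processes M S E"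
    and indep: "indep_var (Pi\<^sub>M UNIV (\<lambda>_. config_space S)) (\<lambda>\<omega> i. Y i \<omega>)
        (Pi\<^sub>M UNIV (\<lambda>_. config_space S)) (\<lambda>\<omega> i. E i \<omega>)"
    and b_int: "set_integrable lborel S b" and b_pos: "\<And>u. u \<in> S \<Longrightarrow> 0 < b u"
    and z_meas: "set_borel_measurable borel S z"
    and K0: "0 \<le> K" and z_bound: "\<And>u. u \<in> S \<Longrightarrow> norm (z u) \<le> K"
    and Y_poisson: "\<And>i. poisson_process M S (loglin b z \<theta>0) (Y i)"
    and rho_int: "set_integrable lborel S \<rho>" and rho_pos: "\<And>u. u \<in> S \<Longrightarrow> 0 < \<rho> u"
    and E_pcf: "\<And>i. has_pair_correlation M S \<rho> g (E i)"
    and g_bounded: "bdd_above ((\<lambda>(u, v). g u v) ` (S \<times> S))"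
    and U_posdef: "positive_definite (U_matrix S b z \<rho> \<theta>0)"
begin

abbreviation "lam \<equiv> loglin b z \<theta>0"
abbreviation "U \<equiv> U_matrix S b z \<rho> \<theta>0"
abbreviation "V \<equiv> V_matrix S b z \<rho> g \<theta>0"
abbreviation "X n \<omega> \<equiv> superposition Y n \<omega>"
abbreviation "D n \<omega> \<equiv> superposition E n \<omega>"
abbreviation "score n \<omega> \<equiv> logistic_score b z \<rho> (X n \<omega>) (D n \<omega>)"

text \<open>
  The functions of the model are constrained on \<open>S\<close> only. Cutting them off outside \<open>S\<close> makes them
  measurable on the whole space and leaves all sums over points in \<open>S\<close> unchanged.
\<close>
definition zS :: "'a \<Rightarrow> real^'m" where "zS u = indicator S u *\<^sub>R z u"
definition pY :: "'a \<Rightarrow> real" where "pY u = indicator S u * (\<rho> u / (lam u + \<rho> u))"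
definition pE :: "'a \<Rightarrow> real" where "pE u = indicator S u * (lam u / (lam u + \<rho> u))"

lemma lam_pos: "u \<in> S \<Longrightarrow> 0 < lam u"
  using b_pos by (simp add: loglin_def)

lemma lam_int: "set_integrable lborel S lam"
  using Y_poisson[of 0] by (simp add: poisson_process_def)

lemma measurable_S [measurable]:
  "zS \<in> borel_measurable borel"
  "(\<lambda>u. indicator S u * lam u) \<in> borel_measurable borel"
  "(\<lambda>u. indicator S u * \<rho> u) \<in> borel_measurable borel"
  "pY \<in> borel_measurable borel" "pE \<in> borel_measurable borel"
proof -
  show "zS \<in> borel_measurable borel"
    using z_meas by (simp add: set_borel_measurable_def zS_def[abs_def])
  show l[measurable]: "(\<lambda>u. indicator S u * lam u) \<in> borel_measurable borel"
    using lam_int by (auto simp: set_integrable_def dest: borel_measurable_integrable)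
  show r[measurable]: "(\<lambda>u. indicator S u * \<rho> u) \<in> borel_measurable borel"
    using rho_int by (auto simp: set_integrable_def dest: borel_measurable_integrable)
  have eq: "pY = (\<lambda>u. indicator S u * \<rho> u / (indicator S u * lam u + indicator S u * \<rho> u))"
    "pE = (\<lambda>u. indicator S u * lam u / (indicator S u * lam u + indicator S u * \<rho> u))"
    by (auto simp: pY_def pE_def indicator_def fun_eq_iff)
  show "pY \<in> borel_measurable borel" "pE \<in> borel_measurable borel"
    unfolding eq by measurable
qed

lemma zS_bound: "norm (zS u) \<le> K"
  using z_bound[of u] K0 by (simp add: zS_def indicator_def)

lemma p_bounds: "0 \<le> pY u" "pY u \<le> 1" "0 \<le> pE u" "pE u \<le> 1"
  using lam_pos[of u] rho_pos[of u] by (auto simp: pY_def pE_def indicator_def divide_simps)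

lemma bounded_weighted_inner:
  assumes "0 \<le> p" "p \<le> (1::real)"
  shows "\<bar>p * (c \<bullet> zS u)\<bar> \<le> norm c * K"
proof -
  have "\<bar>p * (c \<bullet> zS u)\<bar> \<le> 1 * (norm c * norm (zS u))"
    unfolding abs_mult using assms by (intro mult_mono Cauchy_Schwarz_ineq2) auto
  also have "\<dots> \<le> norm c * K" using zS_bound[of u] by (simp add: mult_left_mono)
  finally show ?thesis .
qed

lemma p_inner_bound:
  "\<bar>pY u * (c \<bullet> zS u)\<bar> \<le> norm c * K" "\<bar>pE u * (c \<bullet> zS u)\<bar> \<le> norm c * K"
  by (intro bounded_weighted_inner p_bounds)+

lemma Y_pcf: "has_pair_correlation M S lam (\<lambda>u v. 1) (Y i)"
  by (rule poisson_process_pair_correlation[OF prob_space_axioms Y_poisson S lam_pos])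

lemma Y_process: "pcf_process M S lam (\<lambda>u v. 1) (Y i)"
  by unfold_locales (auto intro: S Y_pcf lam_int lam_pos)

lemma E_process: "pcf_process M S \<rho> g (E i)"
  by unfold_locales (auto intro: S E_pcf rho_int rho_pos g_bounded)

lemma Y_meas: "Y i \<in> measurable M (config_space S)" and E_meas: "E i \<in> measurable M (config_space S)"
  using Y_pcf[of i] E_pcf[of i]
  by (simp_all add: has_pair_correlation_def has_intensity_def point_process_def)

lemma superposition_subset:
  assumes "\<omega> \<in> space M"
  shows "x \<in># X n \<omega> \<Longrightarrow> x \<in> S" "x \<in># D n \<omega> \<Longrightarrow> x \<in> S"
proof -
  have "finite (Y i \<omega>) \<and> Y i \<omega> \<subseteq> S" "finite (E i \<omega>) \<and> E i \<omega> \<subseteq> S" for i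
    using measurable_space[OF Y_meas assms] measurable_space[OF E_meas assms]
    by (auto simp: space_config_space Fpow_def)
  then show "x \<in># X n \<omega> \<Longrightarrow> x \<in> S" "x \<in># D n \<omega> \<Longrightarrow> x \<in> S"
    by (auto simp: superposition_def set_mset_sum)
qed

text \<open>
  A linear functional of the score is a difference of sums of bounded functions over the two
  superpositions, which is the form that the limit theorems handle.
\<close>
lemma inner_score_eq:
  assumes w: "\<omega> \<in> space M"
  shows "c \<bullet> score n \<omega> \<theta>0 =
    (\<Sum>x\<in>#X n \<omega>. pY x * (c \<bullet> zS x)) - (\<Sum>x\<in>#D n \<omega>. pE x * (c \<bullet> zS x))"
proof -
  have 1: "(\<Sum>x\<in>#X n \<omega>. c \<bullet> (\<rho> x / (lam x + \<rho> x)) *\<^sub>R z x) = (\<Sum>x\<in>#X n \<omega>. pY x * (c \<bullet> zS x))"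
    by (rule arg_cong[where f = sum_mset], rule image_mset_cong)
      (use superposition_subset(1)[OF w] in \<open>simp add: pY_def zS_def\<close>)
  have 2: "(\<Sum>x\<in>#D n \<omega>. c \<bullet> (lam x / (lam x + \<rho> x)) *\<^sub>R z x) = (\<Sum>x\<in>#D n \<omega>. pE x * (c \<bullet> zS x))"
    by (rule arg_cong[where f = sum_mset], rule image_mset_cong)
      (use superposition_subset(2)[OF w] in \<open>simp add: pE_def zS_def\<close>)
  show ?thesis
    unfolding logistic_score_def inner_diff_right inner_sum_mset_right 1 2 ..
qed

text \<open>Both integrands are \<open>\<lambda>\<rho>/(\<lambda> + \<rho>)\<close> times \<open>c \<bullet> z\<close> on \<open>S\<close>; hence the score is centred at \<open>\<theta>\<^sub>0\<close>.\<close>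
lemma mean_eq: "(LINT u:S|lborel. pY u * (c \<bullet> zS u) * lam u) = (LINT u:S|lborel. pE u * (c \<bullet> zS u) * \<rho> u)"
  by (rule set_lebesgue_integral_cong) (auto simp: pY_def pE_def)

text \<open>
  The variance of \<open>c \<bullet> s\<^sub>1(\<theta>\<^sub>0)\<close>: the first summand comes from the Poisson process, for which the
  pair correlation term is 0, and the others from the dummy process.
\<close>
definition avar :: "real^'m \<Rightarrow> real" where
  "avar c = (LINT u:S|lborel. (pY u * (c \<bullet> zS u))\<^sup>2 * lam u) +
    ((LINT u:S|lborel. (pE u * (c \<bullet> zS u))\<^sup>2 * \<rho> u) +
     (LINT u:S|lborel. LINT v:S|lborel. (pE u * (c \<bullet> zS u)) * (pE v * (c \<bullet> zS v)) * \<rho> u * \<rho> v * (g u v - 1)))"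

abbreviation q :: "'a \<times> 'a \<Rightarrow> real" where
  "q p \<equiv> indicator (S \<times> S) p * (\<rho> (fst p) * \<rho> (snd p) * (g (fst p) (snd p) - 1))"

lemma pE_component:
  "(\<lambda>u. pE u * zS u $ k) \<in> borel_measurable borel" "\<bar>pE u * zS u $ k\<bar> \<le> K"
proof -
  have "(\<lambda>u. pE u * (axis k 1 \<bullet> zS u)) \<in> borel_measurable borel" by measurable
  then show "(\<lambda>u. pE u * zS u $ k) \<in> borel_measurable borel" by (simp add: inner_axis')
  show "\<bar>pE u * zS u $ k\<bar> \<le> K"
    using p_inner_bound(2)[of u "axis k 1"] by (simp add: inner_axis')
qed

lemma double_integral:
  "integrable lborel (\<lambda>p. (pE (fst p) * zS (fst p) $ k) * (pE (snd p) * zS (snd p) $ l) * q p)"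
  "(LINT u:S|lborel. LINT v:S|lborel. (pE u * zS u $ k) * (pE v * zS v $ l) * \<rho> u * \<rho> v * (g u v - 1)) =
   (LINT p|lborel. (pE (fst p) * zS (fst p) $ k) * (pE (snd p) * zS (snd p) $ l) * q p)"
  using pcf_process.pair_correlation_double_integral[OF E_process
      pE_component[where k = k] pE_component[where k = l]] by simp_all

lemma U_component:
  "integrable lborel (\<lambda>u. (pY u * zS u $ k * zS u $ l) * (indicator S u * lam u))"
  "U $ k $ l = (LINT u|lborel. (pY u * zS u $ k * zS u $ l) * (indicator S u * lam u))"
proof -
  have "integrable lborel (\<lambda>u. indicator S u * lam u)" using lam_int by (simp add: set_integrable_def)
  then show "integrable lborel (\<lambda>u. (pY u * zS u $ k * zS u $ l) * (indicator S u * lam u))"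
  proof (rule integrable_mult_bounded)
    have "(\<lambda>u. pY u * (axis k 1 \<bullet> zS u) * (axis l 1 \<bullet> zS u)) \<in> borel_measurable borel" by measurable
    then show "(\<lambda>u. pY u * zS u $ k * zS u $ l) \<in> borel_measurable lborel" by (simp add: inner_axis')
    show "\<bar>pY u * zS u $ k * zS u $ l\<bar> \<le> 1 * K * K" for u
      unfolding abs_mult
      by (intro mult_mono) (use p_bounds[of u] K0 order_trans[OF component_le_norm_cart zS_bound] in auto)
  qed
  show "U $ k $ l = (LINT u|lborel. (pY u * zS u $ k * zS u $ l) * (indicator S u * lam u))"
    unfolding U_matrix_def set_lebesgue_integral_def
    by (auto intro!: Bochner_Integration.integral_cong simp: pY_def zS_def indicator_def)
qed

lemma V_component:
  "V $ k $ l = U $ k $ l +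
    (LINT p|lborel. (pE (fst p) * zS (fst p) $ k) * (pE (snd p) * zS (snd p) $ l) * q p)"
proof -
  let ?l = "\<lambda>u v. lam u * lam v * \<rho> u * \<rho> v * z u $ k * z v $ l / ((lam u + \<rho> u) * (lam v + \<rho> v)) * (g u v - 1)"
    and ?r = "\<lambda>u v. (pE u * zS u $ k) * (pE v * zS v $ l) * \<rho> u * \<rho> v * (g u v - 1)"
  have "(LINT u:S|lborel. LINT v:S|lborel.
        ?l u v) =
    (LINT u:S|lborel. LINT v:S|lborel. ?r u v)"
    unfolding set_lebesgue_integral_def
  proof (intro Bochner_Integration.integral_cong refl)
    fix u
    have eq: "indicator S u *\<^sub>R (indicator S v *\<^sub>R (?l u v))
      = indicator S u *\<^sub>R (indicator S v *\<^sub>R (?r u v))" for v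
      by (simp add: pE_def zS_def indicator_def)
    show "indicator S u *\<^sub>R (LINT v|lborel. indicator S v *\<^sub>R (?l u v))
      = indicator S u *\<^sub>R (LINT v|lborel. indicator S v *\<^sub>R (?r u v))"
      unfolding integral_scaleR_right[symmetric] eq ..
  qed
  then show ?thesis by (simp add: V_matrix_def double_integral)
qed

lemma inner_cart: "c \<bullet> x = (\<Sum>k\<in>UNIV. c $ k * x $ k)" for c x :: "real^'m"
  by (simp add: inner_vec_def)

lemma double_sum_components:
  "(\<Sum>k\<in>UNIV. \<Sum>l\<in>UNIV. c $ k * c $ l * (a * x $ k * (a' * y $ l) * r)) = a * (c \<bullet> x) * (a' * (c \<bullet> y)) * r"
  for c x y :: "real^'m" and a a' r :: real
proof -
  have "a * (c \<bullet> x) * (a' * (c \<bullet> y)) * r = a * a' * r * ((c \<bullet> x) * (c \<bullet> y))" by simp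
  also have "\<dots> = (\<Sum>k\<in>UNIV. \<Sum>l\<in>UNIV. a * a' * r * ((c $ k * x $ k) * (c $ l * y $ l)))"
    unfolding inner_cart sum_product by (simp only: sum_distrib_left)
  finally show ?thesis by (simp add: mult_ac)
qed

text \<open>
  Expanding \<open>c \<bullet> z\<close> in coordinates under the integrals gives the entries of \<open>V\<close>; the
  two single integrals merge because \<open>\<rho>\<^sup>2\<lambda> + \<lambda>\<^sup>2\<rho> = \<lambda>\<rho>(\<lambda> + \<rho>)\<close>.
\<close>
lemma quadratic_form_V: "c \<bullet> (V *v c) = avar c"
proof -
  let ?h = "\<lambda>k l u. (pY u * zS u $ k * zS u $ l) * (indicator S u * lam u)"
  let ?d = "\<lambda>k l p. (pE (fst p) * zS (fst p) $ k) * (pE (snd p) * zS (snd p) $ l) * q p"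
  have "c \<bullet> (V *v c) = (\<Sum>k\<in>UNIV. \<Sum>l\<in>UNIV. c $ k * c $ l * (LINT u|lborel. ?h k l u)) +
     (\<Sum>k\<in>UNIV. \<Sum>l\<in>UNIV. c $ k * c $ l * (LINT p|lborel. ?d k l p))"
    unfolding quadratic_form_sum V_component U_component(2) by (simp add: distrib_left sum.distrib)
  also have "(\<Sum>k\<in>UNIV. \<Sum>l\<in>UNIV. c $ k * c $ l * (LINT u|lborel. ?h k l u)) =
     (LINT u|lborel. (\<Sum>k\<in>UNIV. \<Sum>l\<in>UNIV. c $ k * c $ l * ?h k l u))"
    using U_component(1) by (simp add: Bochner_Integration.integral_sum)
  also have "\<dots> = (LINT u|lborel. indicator S u * ((pY u * (c \<bullet> zS u))\<^sup>2 * lam u) + indicator S u * ((pE u * (c \<bullet> zS u))\<^sup>2 * \<rho> u))"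
  proof (rule Bochner_Integration.integral_cong[OF refl])
    fix u
    have "(\<Sum>k\<in>UNIV. \<Sum>l\<in>UNIV. c $ k * c $ l * ?h k l u) = pY u * (c \<bullet> zS u) * (1 * (c \<bullet> zS u)) * (indicator S u * lam u)"
      unfolding double_sum_components[symmetric] by (simp add: mult_ac)
    also have "\<dots> = indicator S u * ((pY u * (c \<bullet> zS u))\<^sup>2 * lam u) + indicator S u * ((pE u * (c \<bullet> zS u))\<^sup>2 * \<rho> u)"
    proof (cases "u \<in> S")
      case True
      have s: "0 < lam u + \<rho> u" using lam_pos[OF True] rho_pos[OF True] by simp
      have "\<rho> u / (lam u + \<rho> u) * x * x * lam u =
        (\<rho> u / (lam u + \<rho> u) * x)\<^sup>2 * lam u + (lam u / (lam u + \<rho> u) * x)\<^sup>2 * \<rho> u" for x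
        using s by (simp add: divide_simps power2_eq_square) (simp add: algebra_simps)
      from this[of "c \<bullet> zS u"] True show ?thesis by (simp add: pY_def pE_def)
    qed simp
    finally show "(\<Sum>k\<in>UNIV. \<Sum>l\<in>UNIV. c $ k * c $ l * ?h k l u) =
      indicator S u * ((pY u * (c \<bullet> zS u))\<^sup>2 * lam u) + indicator S u * ((pE u * (c \<bullet> zS u))\<^sup>2 * \<rho> u)" .
  qed
  also have "\<dots> = (LINT u:S|lborel. (pY u * (c \<bullet> zS u))\<^sup>2 * lam u) + (LINT u:S|lborel. (pE u * (c \<bullet> zS u))\<^sup>2 * \<rho> u)"
  proof -
    have i: "integrable lborel (\<lambda>u. indicator S u * ((p u * (c \<bullet> zS u))\<^sup>2 * w u))"
      if w: "set_integrable lborel S w" and p[measurable]: "p \<in> borel_measurable borel" and pb: "\<And>u. 0 \<le> p u" "\<And>u. p u \<le> 1"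
      for p w :: "'a \<Rightarrow> real"
    proof -
      have "integrable lborel (\<lambda>u. (p u * (c \<bullet> zS u))\<^sup>2 * (indicator S u * w u))"
      proof (rule integrable_mult_bounded)
        show "integrable lborel (\<lambda>u. indicator S u * w u)" using w by (simp add: set_integrable_def)
        show "\<bar>(p u * (c \<bullet> zS u))\<^sup>2\<bar> \<le> (norm c * K)\<^sup>2" for u
          using bounded_weighted_inner[OF pb, of u c u] by (metis abs_ge_zero abs_power2 power2_abs power_mono)
      qed measurable
      then show ?thesis by (simp add: mult_ac)
    qed
    show ?thesis
      using i[OF lam_int] i[OF rho_int] p_bounds by (simp add: set_lebesgue_integral_def)
  qed
  also have "(\<Sum>k\<in>UNIV. \<Sum>l\<in>UNIV. c $ k * c $ l * (LINT p|lborel. ?d k l p)) =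
     (LINT p|lborel. (\<Sum>k\<in>UNIV. \<Sum>l\<in>UNIV. c $ k * c $ l * ?d k l p))"
    using double_integral(1) by (simp add: Bochner_Integration.integral_sum)
  also have "\<dots> = (LINT p|lborel. pE (fst p) * (c \<bullet> zS (fst p)) * (pE (snd p) * (c \<bullet> zS (snd p))) * q p)"
    unfolding double_sum_components ..
  also have "\<dots> = (LINT u:S|lborel. LINT v:S|lborel. (pE u * (c \<bullet> zS u)) * (pE v * (c \<bullet> zS v)) * \<rho> u * \<rho> v * (g u v - 1))"
  proof (rule pcf_process.pair_correlation_double_integral(2)[OF E_process, symmetric])
  qed (measurable, rule p_inner_bound, measurable, rule p_inner_bound)
  finally show ?thesis by (simp add: avar_def)
qed

text \<open>
  The process determines its pair correlation function only up to null sets, so \<open>g\<close> need not be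
  symmetric pointwise. The double integrals are symmetric, since they are determined by covariances
  of sums over the process.
\<close>
lemma V_symmetric: "transpose V = V"
proof -
  have "U $ l $ k = U $ k $ l" for k l unfolding U_component(2) by (simp add: mult_ac)
  moreover have "(LINT p|lborel. (pE (fst p) * zS (fst p) $ l) * (pE (snd p) * zS (snd p) $ k) * q p) =
    (LINT p|lborel. (pE (fst p) * zS (fst p) $ k) * (pE (snd p) * zS (snd p) $ l) * q p)" for k l
    using pcf_process.pair_correlation_covariance(4)[OF E_process[of 0]
        pE_component[where k = k] pE_component[where k = l]]
      pcf_process.pair_correlation_covariance(4)[OF E_process[of 0]
        pE_component[where k = l] pE_component[where k = k]]
    unfolding double_integral(2) by (simp add: mult_ac)
  ultimately show ?thesis by (simp add: vec_eq_iff transpose_def V_component)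
qed

text \<open>As a sum of two variances.\<close>
lemma avar_nonneg: "0 \<le> avar c"
proof -
  have m: "(\<lambda>u. pY u * (c \<bullet> zS u)) \<in> borel_measurable borel" "(\<lambda>u. pE u * (c \<bullet> zS u)) \<in> borel_measurable borel"
    by measurable
  note bd = p_inner_bound[of _ c]
  show ?thesis
    using pcf_process.pair_correlation_moments(3)[OF Y_process[of 0] m(1) bd(1)]
      pcf_process.pair_correlation_moments(3)[OF E_process[of 0] m(2) bd(2)]
      variance_positive[of "\<lambda>\<omega>. \<Sum>x\<in>Y 0 \<omega>. pY x * (c \<bullet> zS x)"]
      variance_positive[of "\<lambda>\<omega>. \<Sum>x\<in>E 0 \<omega>. pE x * (c \<bullet> zS x)"]
    unfolding avar_def by simp
qed

text \<open>
  The sums over the data and over the dummy points are functions of the two independent sequences,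
  so the characteristic function of the normalised score is a product of two factors, each
  covered by the central limit theorem for superpositions.
\<close>
lemma score_char_tendsto:
  "(\<lambda>n. char (distr M borel (\<lambda>\<omega>. (c \<bullet> score n \<omega> \<theta>0) / sqrt n)) t)
    \<longlonglongrightarrow> exp (- (t\<^sup>2 * avar c) / 2)"
proof -
  define m where "m = (LINT u:S|lborel. pY u * (c \<bullet> zS u) * lam u)"
  define fY where "fY u = pY u * (c \<bullet> zS u)" for u
  define fE where "fE u = - (pE u * (c \<bullet> zS u))" for u
  have fm[measurable]: "fY \<in> borel_measurable borel" "fE \<in> borel_measurable borel"
    unfolding fY_def fE_def by measurable
  have bd: "\<bar>fY u\<bar> \<le> norm c * K" "\<bar>fE u\<bar> \<le> norm c * K" for u
    using p_inner_bound[of u c]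
    by (simp_all add: fY_def fE_def)
  define A where "A n \<omega> = ((\<Sum>x\<in>#X n \<omega>. fY x) - n * m) / sqrt n" for n \<omega>
  define B where "B n \<omega> = ((\<Sum>x\<in>#D n \<omega>. fE x) - n * (- m)) / sqrt n" for n \<omega>
  let ?vY = "LINT u:S|lborel. (fY u)\<^sup>2 * lam u"
    and ?vE = "(LINT u:S|lborel. (fE u)\<^sup>2 * \<rho> u) +
      (LINT u:S|lborel. LINT v:S|lborel. fE u * fE v * \<rho> u * \<rho> v * (g u v - 1))"
  have mE: "(LINT u:S|lborel. fE u * \<rho> u) = - m"
    unfolding m_def mean_eq fE_def by (simp add: set_lebesgue_integral_def)
  have mY: "(LINT u:S|lborel. fY u * lam u) = m" by (simp add: m_def fY_def)
  have limA: "(\<lambda>n. char (distr M borel (A n)) t) \<longlonglongrightarrow> exp (- (t\<^sup>2 * ?vY) / 2)"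
    using superposition_clt[OF iid_Y Y_process fm(1) bd(1), of t]
    unfolding mY A_def[abs_def] by simp
  have limB: "(\<lambda>n. char (distr M borel (B n)) t) \<longlonglongrightarrow> exp (- (t\<^sup>2 * ?vE) / 2)"
    using superposition_clt[OF iid_E E_process fm(2) bd(2), of t]
    unfolding mE B_def[abs_def] .
  have "char (distr M borel (\<lambda>\<omega>. (c \<bullet> score n \<omega> \<theta>0) / sqrt n)) t =
      char (distr M borel (A n)) t * char (distr M borel (B n)) t" for n
  proof -
    let ?P = "Pi\<^sub>M UNIV (\<lambda>_::nat. config_space S)"
    define F where "F f r y = ((\<Sum>i<n. \<Sum>x\<in>y i. f x) - r) / sqrt n" for f :: "'a \<Rightarrow> real" and r and y :: "nat \<Rightarrow> 'a set"
    have Fm: "F f r \<in> borel_measurable ?P" if "f \<in> borel_measurable borel" for f r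
    proof -
      have "(\<lambda>y. \<Sum>x\<in>y i. f x) \<in> borel_measurable ?P" for i
      proof (rule measurable_compose[where f = "\<lambda>y. y i" and g = "\<lambda>A. \<Sum>x\<in>A. f x"])
        show "(\<lambda>y. y i) \<in> measurable ?P (config_space S)" by (rule measurable_component_singleton) simp
        show "(\<lambda>A. \<Sum>x\<in>A. f x) \<in> borel_measurable (config_space S)" by (rule measurable_sum_config_space[OF that])
      qed
      then show ?thesis unfolding F_def by measurable
    qed
    have "indep_var borel (F fY (n * m) \<circ> (\<lambda>\<omega> i. Y i \<omega>)) borel (F fE (n * (- m)) \<circ> (\<lambda>\<omega> i. E i \<omega>))"
      by (rule indep_var_compose[OF indep Fm Fm]) (rule fm)+
    moreover have "F fY (n * m) \<circ> (\<lambda>\<omega> i. Y i \<omega>) = A n" "F fE (n * (- m)) \<circ> (\<lambda>\<omega> i. E i \<omega>) = B n"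
      by (simp_all add: fun_eq_iff F_def A_def B_def sum_mset_superposition)
    ultimately have ind: "indep_var borel (A n) borel (B n)" by simp
    have eq: "(c \<bullet> score n \<omega> \<theta>0) / sqrt n = A n \<omega> + B n \<omega>" if "\<omega> \<in> space M" for \<omega>
    proof -
      have "(\<Sum>x\<in>#D n \<omega>. fE x) = - (\<Sum>x\<in>#D n \<omega>. pE x * (c \<bullet> zS x))"
        unfolding fE_def sum_mset_superposition by (simp add: sum_negf)
      then show ?thesis
        unfolding inner_score_eq[OF that] A_def B_def by (simp add: fY_def[abs_def] add_divide_distrib diff_divide_distrib)
    qed
    have "distr M borel (\<lambda>\<omega>. (c \<bullet> score n \<omega> \<theta>0) / sqrt n) = distr M borel (\<lambda>\<omega>. A n \<omega> + B n \<omega>)"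
      using eq by (rule distr_cong[OF refl refl])
    then show ?thesis by (simp only: char_distr_add[OF ind])
  qed
  moreover have "(\<lambda>n. char (distr M borel (A n)) t * char (distr M borel (B n)) t) \<longlonglongrightarrow> exp (- (t\<^sup>2 * avar c) / 2)"
  proof -
    have "complex_of_real (exp (- (t\<^sup>2 * ?vY) / 2)) *
      complex_of_real (exp (- (t\<^sup>2 * ?vE) / 2)) =
      complex_of_real (exp (- (t\<^sup>2 * avar c) / 2))"
      unfolding of_real_mult[symmetric] exp_add[symmetric]
      by (simp add: avar_def fY_def fE_def field_simps)
    then show ?thesis using tendsto_mult[OF limA limB] by simp
  qed
  ultimately show ?thesis by simp
qed

lemma sum_superposition_measurable:
  assumes f: "f \<in> borel_measurable borel"
  shows "(\<lambda>\<omega>. \<Sum>x\<in>#X n \<omega>. f x :: real) \<in> borel_measurable M" "(\<lambda>\<omega>. \<Sum>x\<in>#D n \<omega>. f x :: real) \<in> borel_measurable M"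
  unfolding sum_mset_superposition
  using measurable_compose[OF Y_meas measurable_sum_config_space[OF f]]
    measurable_compose[OF E_meas measurable_sum_config_space[OF f]] by measurable

lemma score_measurable: "(\<lambda>\<omega>. score n \<omega> \<theta>0) \<in> borel_measurable M"
proof (rule borel_measurable_euclidean_space[THEN iffD2], rule ballI)
  fix c :: "real^'m"
  have m: "(\<lambda>u. pY u * (c \<bullet> zS u)) \<in> borel_measurable borel" "(\<lambda>u. pE u * (c \<bullet> zS u)) \<in> borel_measurable borel"
    by measurable
  have eq: "score n \<omega> \<theta>0 \<bullet> c =
      (\<Sum>x\<in>#X n \<omega>. pY x * (c \<bullet> zS x)) - (\<Sum>x\<in>#D n \<omega>. pE x * (c \<bullet> zS x))"
    if "\<omega> \<in> space M" for \<omega>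
    using inner_score_eq[OF that] by (metis inner_commute)
  show "(\<lambda>\<omega>. score n \<omega> \<theta>0 \<bullet> c) \<in> borel_measurable M"
    by (rule measurable_cong[THEN iffD2, OF eq])
      (assumption, rule borel_measurable_diff[OF sum_superposition_measurable(1)[OF m(1)] sum_superposition_measurable(2)[OF m(2)]])
qed

lemma sum_both_tendsto:
  assumes f: "f \<in> borel_measurable borel" and B: "\<And>u. \<bar>f u\<bar> \<le> B" and e: "0 < e"
  shows "(\<lambda>n. prob {\<omega> \<in> space M. e < \<bar>(\<Sum>x\<in>#X n \<omega> + D n \<omega>. f x) / n -
      ((LINT u:S|lborel. f u * lam u) + (LINT u:S|lborel. f u * \<rho> u))\<bar>}) \<longlonglongrightarrow> 0"
proof -
  let ?a = "\<lambda>n \<omega>. \<bar>(\<Sum>x\<in>#X n \<omega>. f x) / n - (LINT u:S|lborel. f u * lam u)\<bar>"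
  let ?b = "\<lambda>n \<omega>. \<bar>(\<Sum>x\<in>#D n \<omega>. f x) / n - (LINT u:S|lborel. f u * \<rho> u)\<bar>"
  let ?A = "\<lambda>n. {\<omega> \<in> space M. e / 2 < ?a n \<omega>}" and ?B = "\<lambda>n. {\<omega> \<in> space M. e / 2 < ?b n \<omega>}"
  let ?F = "\<lambda>n. {\<omega> \<in> space M. e < \<bar>(\<Sum>x\<in>#X n \<omega> + D n \<omega>. f x) / n -
      ((LINT u:S|lborel. f u * lam u) + (LINT u:S|lborel. f u * \<rho> u))\<bar>}"
  have [measurable]: "(\<lambda>\<omega>. \<Sum>x\<in>#X n \<omega>. f x) \<in> borel_measurable M" "(\<lambda>\<omega>. \<Sum>x\<in>#D n \<omega>. f x) \<in> borel_measurable M" for n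
    using sum_superposition_measurable[OF f] by auto
  have e2: "0 < e / 2" using e by simp
  have lim: "(\<lambda>n. prob (?A n) + prob (?B n)) \<longlonglongrightarrow> 0 + 0"
    by (intro tendsto_add
        superposition_lln[OF iid_Y Y_process f B e2]
        superposition_lln[OF iid_E E_process f B e2])
  show ?thesis
  proof (rule tendsto_sandwich[OF _ _ tendsto_const])
    show "(\<lambda>n. prob (?A n) + prob (?B n)) \<longlonglongrightarrow> 0"
      using lim by simp
    show "\<forall>\<^sub>F n in sequentially. prob (?F n) \<le>
      prob (?A n) + prob (?B n)"
    proof (intro always_eventually allI)
      fix n
      have "prob (?F n) \<le>
        prob (?A n \<union> ?B n)"
      proof (rule finite_measure_mono)
        show "?F n \<subseteq>
          ?A n \<union> ?B n"
        proof safe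
          fix \<omega>
          assume far: "e < \<bar>(\<Sum>x\<in>#X n \<omega> + D n \<omega>. f x) / n -
              ((LINT u:S|lborel. f u * lam u) + (LINT u:S|lborel. f u * \<rho> u))\<bar>"
            and nb: "\<not> e / 2 < ?b n \<omega>"
          have "\<bar>x + y - (p + r)\<bar> \<le> \<bar>x - p\<bar> + \<bar>y - r\<bar>" for x y p r :: real by linarith
          from order.strict_trans2[OF far[unfolded image_mset_union sum_mset.union add_divide_distrib] this] nb
          show "e / 2 < ?a n \<omega>" by linarith
        qed
      qed measurable
      also have "\<dots> \<le> prob (?A n) + prob (?B n)"
        by (rule measure_Un_le) measurable
      finally show "prob (?F n) \<le>
        prob (?A n) + prob (?B n)" .
    qed
  qed simp
qed

text \<open>
  Data and dummy points together have intensity \<open>\<lambda> + \<rho>\<close>, which cancels one factor of the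
  denominator of the weight \<open>\<lambda>\<rho>/(\<lambda> + \<rho>)\<^sup>2\<close> and leaves the integrand of \<open>U\<close>.
\<close>
lemma information_lln:
  assumes e: "0 < e"
  shows "(\<lambda>n. prob {\<omega> \<in> space M. e <
    \<bar>(\<Sum>x\<in>#X n \<omega> + D n \<omega>. logistic_weight b z \<rho> \<theta>0 x * z x $ k * z x $ l) / n - U $ k $ l\<bar>}) \<longlonglongrightarrow> 0"
    and "(\<lambda>\<omega>. \<Sum>x\<in>#X n \<omega> + D n \<omega>. logistic_weight b z \<rho> \<theta>0 x * z x $ k * z x $ l) \<in> borel_measurable M"
proof -
  define f where "f u = pY u * pE u * zS u $ k * zS u $ l" for u
  have fm: "f \<in> borel_measurable borel"
  proof -
    have "(\<lambda>u. pY u * pE u * (axis k 1 \<bullet> zS u) * (axis l 1 \<bullet> zS u)) \<in> borel_measurable borel" by measurable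
    then show ?thesis by (simp add: inner_axis' f_def[abs_def])
  qed
  have fb: "\<bar>f u\<bar> \<le> 1 * 1 * K * K" for u
    unfolding f_def abs_mult
    by (intro mult_mono) (use p_bounds[of u] K0 order_trans[OF component_le_norm_cart zS_bound] in auto)
  have sum_eq: "(\<Sum>x\<in>#X n \<omega> + D n \<omega>. logistic_weight b z \<rho> \<theta>0 x * z x $ k * z x $ l) = (\<Sum>x\<in>#X n \<omega> + D n \<omega>. f x)"
    if "\<omega> \<in> space M" for n \<omega>
  proof (rule arg_cong[where f = sum_mset], rule image_mset_cong)
    fix x assume "x \<in># X n \<omega> + D n \<omega>"
    then have "x \<in> S" using superposition_subset[OF that] by auto
    then show "logistic_weight b z \<rho> \<theta>0 x * z x $ k * z x $ l = f x"
      by (simp add: f_def logistic_weight_def pY_def pE_def zS_def power2_eq_square mult_ac)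
  qed
  have "(LINT u:S|lborel. f u * lam u) + (LINT u:S|lborel. f u * \<rho> u) = (LINT u:S|lborel. f u * lam u + f u * \<rho> u)"
  proof (rule set_integral_add(2)[symmetric])
    have "set_integrable lborel S (\<lambda>u. f u * w u)" if w: "set_integrable lborel S w" for w
    proof -
      have "integrable lborel (\<lambda>u. f u * (indicator S u * w u))"
        by (rule integrable_mult_bounded[OF _ _ fb]) (use w fm in \<open>simp_all add: set_integrable_def\<close>)
      then show ?thesis by (simp add: set_integrable_def mult_ac)
    qed
    then show "set_integrable lborel S (\<lambda>u. f u * lam u)" "set_integrable lborel S (\<lambda>u. f u * \<rho> u)"
      using lam_int rho_int by auto
  qed
  also have "\<dots> = U $ k $ l"
    unfolding U_component(2) set_lebesgue_integral_def
  proof (rule Bochner_Integration.integral_cong[OF refl])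
    fix u
    have pE: "pE u * (lam u + \<rho> u) = lam u" if "u \<in> S"
      using lam_pos[OF that] rho_pos[OF that] that by (simp add: pE_def)
    have "f u * lam u + f u * \<rho> u = pY u * zS u $ k * zS u $ l * (pE u * (lam u + \<rho> u))"
      by (simp add: f_def algebra_simps)
    then have "f u * lam u + f u * \<rho> u = pY u * zS u $ k * zS u $ l * lam u" if "u \<in> S"
      unfolding pE[OF that] .
    then show "indicator S u *\<^sub>R (f u * lam u + f u * \<rho> u) = pY u * zS u $ k * zS u $ l * (indicator S u * lam u)"
      by (simp add: indicator_def)
  qed
  finally have mean: "(LINT u:S|lborel. f u * lam u) + (LINT u:S|lborel. f u * \<rho> u) = U $ k $ l" .
  have "{\<omega> \<in> space M. e < \<bar>(\<Sum>x\<in>#X n \<omega> + D n \<omega>. logistic_weight b z \<rho> \<theta>0 x * z x $ k * z x $ l) / n - U $ k $ l\<bar>} =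
    {\<omega> \<in> space M. e < \<bar>(\<Sum>x\<in>#X n \<omega> + D n \<omega>. f x) / n - U $ k $ l\<bar>}" for n
    using sum_eq by auto
  then show "(\<lambda>n. prob {\<omega> \<in> space M. e <
    \<bar>(\<Sum>x\<in>#X n \<omega> + D n \<omega>. logistic_weight b z \<rho> \<theta>0 x * z x $ k * z x $ l) / n - U $ k $ l\<bar>}) \<longlonglongrightarrow> 0"
    using sum_both_tendsto[OF fm fb e] unfolding mean by simp
  have "(\<lambda>\<omega>. (\<Sum>x\<in>#X n \<omega>. f x) + (\<Sum>x\<in>#D n \<omega>. f x)) \<in> borel_measurable M"
    by (rule borel_measurable_add[OF sum_superposition_measurable[OF fm]])
  then have fsum: "(\<lambda>\<omega>. \<Sum>x\<in>#X n \<omega> + D n \<omega>. f x) \<in> borel_measurable M" by simp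
  show "(\<lambda>\<omega>. \<Sum>x\<in>#X n \<omega> + D n \<omega>. logistic_weight b z \<rho> \<theta>0 x * z x $ k * z x $ l) \<in> borel_measurable M"
    by (rule measurable_cong[THEN iffD2, OF sum_eq fsum])
qed

lemma count_lln:
  assumes e: "0 < e"
  shows "(\<lambda>n. prob {\<omega> \<in> space M. e < \<bar>real (size (X n \<omega> + D n \<omega>)) / n -
      ((LINT u:S|lborel. lam u) + (LINT u:S|lborel. \<rho> u))\<bar>}) \<longlonglongrightarrow> 0"
    and "(\<lambda>\<omega>. real (size (X n \<omega> + D n \<omega>))) \<in> borel_measurable M"
proof -
  have c: "(\<Sum>x\<in>#A. 1::real) = real (size A)" for A :: "'a multiset" by simp
  show "(\<lambda>n. prob {\<omega> \<in> space M. e < \<bar>real (size (X n \<omega> + D n \<omega>)) / n -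
      ((LINT u:S|lborel. lam u) + (LINT u:S|lborel. \<rho> u))\<bar>}) \<longlonglongrightarrow> 0"
    using sum_both_tendsto[of "\<lambda>_. 1" 1, OF _ _ e] unfolding c by simp
  have "(\<lambda>\<omega>. (\<Sum>x\<in>#X n \<omega>. 1::real) + (\<Sum>x\<in>#D n \<omega>. 1)) \<in> borel_measurable M"
    by (rule borel_measurable_add[OF sum_superposition_measurable]) simp_all
  then show "(\<lambda>\<omega>. real (size (X n \<omega> + D n \<omega>))) \<in> borel_measurable M" unfolding c by simp
qed

text \<open>The Newton step from \<open>\<theta>\<^sub>0\<close> with the limiting information \<open>nU\<close>, scaled by \<open>sqrt n\<close>.\<close>
definition newton_step :: "nat \<Rightarrow> 'w \<Rightarrow> real^'m" where
  "newton_step n \<omega> = (1 / sqrt n) *\<^sub>R (matrix_inv U *v score n \<omega> \<theta>0)"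

abbreviation "asymp_cov \<equiv> matrix_inv U ** V ** transpose (matrix_inv U)"

lemma asymp_cov_quadratic: "a \<bullet> (asymp_cov *v a) = avar (transpose (matrix_inv U) *v a)"
proof -
  have "a \<bullet> (asymp_cov *v a) = (transpose (matrix_inv U) *v a) \<bullet> (V *v (transpose (matrix_inv U) *v a))"
    by (simp add: matrix_vector_mul_assoc[symmetric] dot_lmul_matrix[symmetric])
  then show ?thesis by (simp only: quadratic_form_V)
qed

lemma newton_step_measurable [measurable]: "newton_step n \<in> borel_measurable M"
proof -
  have "(\<lambda>x. (1 / sqrt n) *\<^sub>R (matrix_inv U *v x)) \<in> borel_measurable borel"
    by (intro borel_measurable_continuous_onI continuous_intros matrix_vector_mult_linear_continuous_on)
  from measurable_compose[OF score_measurable this] show ?thesis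
    by (simp add: newton_step_def[abs_def])
qed

lemma newton_step_char_vec_tendsto:
  "(\<lambda>n. char_vec (distr M borel (newton_step n)) a) \<longlonglongrightarrow> exp (- (a \<bullet> (asymp_cov *v a)) / 2)"
proof -
  let ?c = "transpose (matrix_inv U) *v a"
  have "char_vec (distr M borel (newton_step n)) a =
    char (distr M borel (\<lambda>\<omega>. (?c \<bullet> score n \<omega> \<theta>0) / sqrt n)) 1" for n
  proof -
    have "a \<bullet> newton_step n \<omega> = (?c \<bullet> score n \<omega> \<theta>0) / sqrt n" for \<omega>
      by (simp add: newton_step_def dot_lmul_matrix[symmetric])
    moreover have "char_vec (distr M borel (newton_step n)) a = char (distr M borel (\<lambda>\<omega>. a \<bullet> newton_step n \<omega>)) 1"
      using char_vec_eq_char[of "distr M borel (newton_step n)" 1 a] by (simp add: distr_distr comp_def)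
    ultimately show ?thesis by simp
  qed
  then show ?thesis using score_char_tendsto[of ?c 1] by (simp add: asymp_cov_quadratic)
qed

text \<open>
  Outside three events of small probability (a large Newton step, an information matrix far from its
  limit, too many points) the deterministic comparison applies. It supplies a root that
  lies in \<open>\<Theta>\<close> because \<open>\<Theta>\<close> is open; so the estimator is then a root too, and every root is
  close to the Newton step. The law \<open>N\<close> enters through the tightness of the Newton
  steps.
\<close>
lemma estimator_newton_step_close:
  fixes \<Theta> :: "(real^'m) set" and \<theta>hat :: "nat \<Rightarrow> 'w \<Rightarrow> real^'m"
  assumes \<Theta>: "open \<Theta>" "\<theta>0 \<in> \<Theta>"
    and hat[measurable]: "\<And>n. \<theta>hat n \<in> borel_measurable M"
    and estimator: "\<And>n. AE \<omega> in M. (\<exists>\<theta>\<in>\<Theta>. score n \<omega> \<theta> = 0) \<longrightarrow>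
        \<theta>hat n \<omega> \<in> \<Theta> \<and> score n \<omega> (\<theta>hat n \<omega>) = 0"
    and N: "prob_space N" "sets N = sets borel" "\<And>a. char_vec N a = exp (- (a \<bullet> (asymp_cov *v a)) / 2)"
    and \<epsilon>: "0 < \<epsilon>"
  shows "(\<lambda>n. prob {\<omega> \<in> space M. \<epsilon> < norm (sqrt n *\<^sub>R (\<theta>hat n \<omega> - \<theta>0) - newton_step n \<omega>)}) \<longlonglongrightarrow> 0"
proof (rule tendstoI)
  fix d :: real assume d: "0 < d"
  then have d2: "0 < d / 2" by simp
  obtain c where c: "0 < c" "\<And>x. c * (norm x)\<^sup>2 \<le> x \<bullet> (U *v x)"
    using positive_definite_coercive[OF U_posdef] by blast
  obtain \<delta> where \<delta>: "0 < \<delta>" "cball \<theta>0 \<delta> \<subseteq> \<Theta>" using \<Theta> open_contains_cball by blast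
  obtain R where R: "0 < R" "\<forall>\<^sub>F n in sequentially. measure (distr M borel (newton_step n)) {x. R < norm x} < d / 2"
  proof (rule tight_of_char_vec_tendsto[where \<mu> = "\<lambda>n. distr M borel (newton_step n)" and N = N, OF _ _ N(1,2) _ d2])
    show "prob_space (distr M borel (newton_step n))" for n by (rule prob_space_distr) measurable
    show "(\<lambda>n. char_vec (distr M borel (newton_step n)) a) \<longlonglongrightarrow> char_vec N a" for a
      unfolding N(3) by (rule newton_step_char_vec_tendsto)
  qed simp
  have RE: "0 < R + \<epsilon>" using R \<epsilon> by simp
  \<comment> \<open>With this tolerance the error from the information matrix uses up half of \<open>c \<epsilon>\<close>, and the
    Taylor remainder stays below the other half for large \<open>n\<close>.\<close>
  define \<eta> where "\<eta> = c * \<epsilon> / (2 * (real CARD('m) * real CARD('m) * (R + \<epsilon>)))"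
  have \<eta>: "0 < \<eta>" using c \<epsilon> RE by (simp add: \<eta>_def)
  have \<eta>_eq: "real CARD('m) * real CARD('m) * \<eta> * (R + \<epsilon>) = c * \<epsilon> / 2"
  proof -
    have "N * (a / (2 * (N * r))) * r = a / 2" if "N \<noteq> 0" "r \<noteq> 0" for N a r :: real
      using that by simp
    from this[of "real CARD('m) * real CARD('m)" "R + \<epsilon>" "c * \<epsilon>"] RE show ?thesis
      unfolding \<eta>_def by simp
  qed
  define t where "t = (LINT u:S|lborel. lam u) + (LINT u:S|lborel. \<rho> u)"
  define J where "J n p \<omega> = (\<Sum>x\<in>#X n \<omega> + D n \<omega>. logistic_weight b z \<rho> \<theta>0 x * z x $ fst p * z x $ snd p)" for n p \<omega>
  have Jm[measurable]: "J n p \<in> borel_measurable M" for n p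
    unfolding J_def by (rule information_lln(2)[OF zero_less_one])
  have cm[measurable]: "(\<lambda>\<omega>. real (size (X n \<omega> + D n \<omega>))) \<in> borel_measurable M" for n
    by (rule count_lln(2)[OF zero_less_one])
  define A where "A n = {\<omega> \<in> space M. R < norm (newton_step n \<omega>)}" for n
  define G where "G n p = {\<omega> \<in> space M. \<eta> < \<bar>J n p \<omega> / n - U $ fst p $ snd p\<bar>}" for n p
  define H where "H n = {\<omega> \<in> space M. 1 < \<bar>real (size (X n \<omega> + D n \<omega>)) / n - t\<bar>}" for n
  have sets: "A n \<in> events" "G n p \<in> events" "H n \<in> events" for n p
    unfolding A_def G_def H_def by measurable
  have "(\<lambda>n. (\<Sum>p\<in>UNIV. prob (G n p)) + prob (H n)) \<longlonglongrightarrow> (\<Sum>p\<in>(UNIV :: ('m \<times> 'm) set). 0) + 0"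
    unfolding G_def H_def J_def t_def
    by (intro tendsto_add tendsto_sum information_lln(1)[OF \<eta>] count_lln(1)[OF zero_less_one])
  then have ev1: "\<forall>\<^sub>F n in sequentially. (\<Sum>p\<in>UNIV. prob (G n p)) + prob (H n) < d / 2"
    using d2 by (intro order_tendstoD) auto
  have ev2: "\<forall>\<^sub>F n in sequentially. prob (A n) < d / 2"
  proof -
    have "measure (distr M borel (newton_step n)) {x. R < norm x} = prob (A n)" for n
      unfolding A_def by (subst measure_distr) (auto intro!: arg_cong[where f = prob])
    then show ?thesis using R(2) by simp
  qed
  have inv_sqrt: "(\<lambda>n. a / sqrt (real n)) \<longlonglongrightarrow> 0" for a
    by (intro tendsto_divide_0[OF tendsto_const] filterlim_at_top_imp_at_infinity
        filterlim_compose[OF sqrt_at_top filterlim_real_sequentially])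
  have ev3: "\<forall>\<^sub>F n in sequentially. (\<bar>t\<bar> + 1) * K ^ 3 * (R + \<epsilon>)\<^sup>2 / sqrt n < c * \<epsilon> / 2"
    using inv_sqrt c \<epsilon> by (intro order_tendstoD) auto
  have ev4: "\<forall>\<^sub>F n in sequentially. (R + \<epsilon>) / sqrt n < \<delta>"
    using inv_sqrt \<delta> by (intro order_tendstoD) auto
  show "\<forall>\<^sub>F n in sequentially. dist (prob {\<omega> \<in> space M. \<epsilon> < norm (sqrt n *\<^sub>R (\<theta>hat n \<omega> - \<theta>0) - newton_step n \<omega>)}) 0 < d"
    using ev1 ev2 ev3 ev4 eventually_gt_at_top[of 0]
  proof eventually_elim
    case (elim n)
    have "AE \<omega> in M. \<omega> \<in> {\<omega> \<in> space M. \<epsilon> < norm (sqrt n *\<^sub>R (\<theta>hat n \<omega> - \<theta>0) - newton_step n \<omega>)} \<longrightarrow>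
      \<omega> \<in> A n \<union> ((\<Union>p. G n p) \<union> H n)"
      using estimator[of n]
    proof eventually_elim
      case est: (elim \<omega>)
      show ?case
      proof (rule impI, rule ccontr)
        assume "\<omega> \<in> {\<omega> \<in> space M. \<epsilon> < norm (sqrt n *\<^sub>R (\<theta>hat n \<omega> - \<theta>0) - newton_step n \<omega>)}"
        then have w: "\<omega> \<in> space M" and far: "\<epsilon> < norm (sqrt n *\<^sub>R (\<theta>hat n \<omega> - \<theta>0) - newton_step n \<omega>)" by auto
        assume "\<omega> \<notin> A n \<union> ((\<Union>p. G n p) \<union> H n)"
        then have nA: "\<omega> \<notin> A n" and nG: "\<omega> \<notin> (\<Union>p. G n p)" and nH: "\<omega> \<notin> H n" by blast+
        have inS: "x \<in> S" if "x \<in># X n \<omega> + D n \<omega>" for x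
          using that superposition_subset[OF w] by auto
        have cnt: "real (size (X n \<omega> + D n \<omega>)) \<le> (\<bar>t\<bar> + 1) * n"
        proof -
          have "real (size (X n \<omega> + D n \<omega>)) / n \<le> \<bar>t\<bar> + 1" using nH w by (simp add: H_def)
          then show ?thesis using elim(5) by (simp add: pos_divide_le_eq)
        qed
        have Jb: "\<bar>(\<Sum>x\<in>#X n \<omega> + D n \<omega>. logistic_weight b z \<rho> \<theta>0 x * z x $ k * z x $ l) / n - U $ k $ l\<bar> \<le> \<eta>" for k l
        proof -
          have "\<omega> \<notin> G n (k, l)" using nG by blast
          then show ?thesis using w unfolding G_def J_def by simp
        qed
        have small: "real CARD('m) * real CARD('m) * \<eta> * (R + \<epsilon>) + (\<bar>t\<bar> + 1) * K ^ 3 * (R + \<epsilon>)\<^sup>2 / sqrt n < c * \<epsilon>"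
          using elim(3) unfolding \<eta>_eq by linarith
        have nb: "norm ((1 / sqrt n) *\<^sub>R (matrix_inv U *v score n \<omega> \<theta>0)) \<le> R"
          using nA w by (simp add: A_def newton_step_def)
        note near = logistic_score_zero_near[OF b_pos[OF inS] rho_pos[OF inS] K0 z_bound[OF inS] c
            positive_definite_matrix_inv(1)[OF U_posdef] elim(5) \<epsilon> nb Jb cnt small]
        obtain \<theta> where \<theta>: "score n \<omega> \<theta> = 0" "norm (\<theta> - \<theta>0) \<le> (R + \<epsilon>) / sqrt n"
          using near(1) by blast
        have "\<theta> \<in> cball \<theta>0 \<delta>" using \<theta>(2) elim(4) by (simp add: dist_norm norm_minus_commute)
        then have "\<theta> \<in> \<Theta>" using \<delta> by blast
        with est \<theta>(1) have zero: "score n \<omega> (\<theta>hat n \<omega>) = 0" by blast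
        have "norm (sqrt n *\<^sub>R (\<theta>hat n \<omega> - \<theta>0) - newton_step n \<omega>) \<le> \<epsilon>"
          unfolding newton_step_def by (rule near(2)[OF _ _ _ zero])
        with far show False by simp
      qed
    qed
    then have "prob {\<omega> \<in> space M. \<epsilon> < norm (sqrt n *\<^sub>R (\<theta>hat n \<omega> - \<theta>0) - newton_step n \<omega>)} \<le>
      prob (A n \<union> ((\<Union>p. G n p) \<union> H n))"
      using sets by (intro finite_measure_mono_AE) auto
    also have "\<dots> \<le> prob (A n) + (prob (\<Union>p. G n p) + prob (H n))"
      using sets by (intro order_trans[OF measure_Un_le] add_mono order_refl measure_Un_le) auto
    also have "prob (\<Union>p. G n p) \<le> (\<Sum>p\<in>UNIV. prob (G n p))"
      using sets by (intro finite_measure_subadditive_finite) auto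
    finally show ?case using elim by (simp add: dist_real_def)
  qed
qed

theorem estimator_asymptotically_normal:
  fixes \<Theta> :: "(real^'m) set" and \<theta>hat :: "nat \<Rightarrow> 'w \<Rightarrow> real^'m"
  assumes \<Theta>: "open \<Theta>" "\<theta>0 \<in> \<Theta>"
    and hat[measurable]: "\<And>n. \<theta>hat n \<in> borel_measurable M"
    and estimator: "\<And>n. AE \<omega> in M. (\<exists>\<theta>\<in>\<Theta>. score n \<omega> \<theta> = 0) \<longrightarrow>
        \<theta>hat n \<omega> \<in> \<Theta> \<and> score n \<omega> (\<theta>hat n \<omega>) = 0"
  shows "\<exists>N. multivariate_normal N 0 asymp_cov \<and>
    converges_in_distribution (\<lambda>n. distr M borel (\<lambda>\<omega>. sqrt (real n) *\<^sub>R (\<theta>hat n \<omega> - \<theta>0))) N"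
proof -
  have "transpose asymp_cov = asymp_cov"
    by (simp add: matrix_transpose_mul V_symmetric matrix_mul_assoc)
  moreover have "0 \<le> a \<bullet> (asymp_cov *v a)" for a by (simp only: asymp_cov_quadratic avar_nonneg)
  ultimately obtain N where N: "multivariate_normal N 0 asymp_cov"
    and ch: "\<And>a. char_vec N a = exp (- (a \<bullet> (asymp_cov *v a)) / 2)"
    using gaussian_exists by blast
  have NP: "prob_space N" "sets N = sets borel" using N by (auto simp: multivariate_normal_def)
  let ?Xn = "\<lambda>n \<omega>. sqrt (real n) *\<^sub>R (\<theta>hat n \<omega> - \<theta>0)"
  have Xm: "?Xn n \<in> borel_measurable M" for n by measurable
  have "converges_in_distribution (\<lambda>n. distr M borel (?Xn n)) N"
  proof (rule char_vec_tendsto_imp_converges_in_distribution[OF _ _ NP])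
    show "prob_space (distr M borel (?Xn n))" for n by (rule prob_space_distr[OF Xm])
    show "(\<lambda>n. char_vec (distr M borel (?Xn n)) a) \<longlonglongrightarrow> char_vec N a" for a
      unfolding ch
      by (rule char_vec_tendsto_of_close[OF prob_space_axioms Xm newton_step_measurable
            estimator_newton_step_close[OF \<Theta> hat estimator NP ch] newton_step_char_vec_tendsto])
  qed simp
  with N show ?thesis by blast
qed

end

theorem theorem3p8:
  fixes M :: "'w measure"
    and W :: "(real^2) set" and T :: "real set"
    and Y E :: "nat \<Rightarrow> 'w \<Rightarrow> ((real^2) \<times> real) set"
    and b \<rho> :: "(real^2) \<times> real \<Rightarrow> real"
    and z :: "(real^2) \<times> real \<Rightarrow> real^'m"
    and g :: "(real^2) \<times> real \<Rightarrow> (real^2) \<times> real \<Rightarrow> real"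
    and \<Theta> :: "(real^'m) set" and \<theta>0 :: "real^'m"
    and \<theta>hat :: "nat \<Rightarrow> 'w \<Rightarrow> real^'m"
  assumes prob: "prob_space M"
    and window: "open (W \<times> T)" "bounded (W \<times> T)" "W \<times> T \<noteq> {}"
    and true_parameter: "\<theta>0 \<in> \<Theta>"
    and iid: "iid_point_processes M (W \<times> T) Y" "iid_point_processes M (W \<times> T) E"
    and indep: "prob_space.indep_var M
        (Pi\<^sub>M UNIV (\<lambda>_. config_space (W \<times> T))) (\<lambda>\<omega> i. Y i \<omega>)
        (Pi\<^sub>M UNIV (\<lambda>_. config_space (W \<times> T))) (\<lambda>\<omega> i. E i \<omega>)"
    and b: "set_integrable lborel (W \<times> T) b" "\<forall>u \<in> W \<times> T. 0 < b u"
    and z: "set_borel_measurable borel (W \<times> T) z"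
    and open_Theta: "open \<Theta>"
    and Y_poisson: "\<forall>i. poisson_process M (W \<times> T) (loglin b z \<theta>0) (Y i)"
    and rho: "set_integrable lborel (W \<times> T) \<rho>" "\<forall>u \<in> W \<times> T. 0 < \<rho> u"
    and E_intensity: "\<forall>i. has_intensity M (W \<times> T) \<rho> (E i)"
    and E_pcf: "\<forall>i. has_pair_correlation M (W \<times> T) \<rho> g (E i)"
    and g_bounded: "bdd_above ((\<lambda>(u, v). g u v) ` ((W \<times> T) \<times> (W \<times> T)))"
    and ratio: "\<forall>\<theta>\<in>\<Theta>. \<exists>\<epsilon>1>0. \<exists>\<epsilon>2>0.
        ereal \<epsilon>1 < (INF u \<in> W \<times> T. ereal (\<rho> u / loglin b z \<theta> u)) \<and>
        (SUP u \<in> W \<times> T. ereal (\<rho> u / loglin b z \<theta> u)) < ereal \<epsilon>2"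
    and z_bounded: "bdd_above ((\<lambda>u. norm (z u)) ` (W \<times> T))"
    and convex_Theta: "convex \<Theta>"
    and identifiable: "\<forall>\<theta>\<in>\<Theta>. \<forall>\<theta>'\<in>\<Theta>.
        (AE u in lborel. u \<in> W \<times> T \<longrightarrow> loglin b z \<theta> u = loglin b z \<theta>' u) \<longrightarrow> \<theta> = \<theta>'"
    and U_posdef: "positive_definite (U_matrix (W \<times> T) b z \<rho> \<theta>0)"
    and estimator_measurable: "\<forall>n. \<theta>hat n \<in> borel_measurable M"
    and estimator: "\<forall>n. AE \<omega> in M.
        (\<exists>\<theta>\<in>\<Theta>. logistic_score b z \<rho> (superposition Y n \<omega>) (superposition E n \<omega>) \<theta> = 0) \<longrightarrow>
        \<theta>hat n \<omega> \<in> \<Theta> \<and>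
        logistic_score b z \<rho> (superposition Y n \<omega>) (superposition E n \<omega>) (\<theta>hat n \<omega>) = 0"
  shows "\<exists>N. multivariate_normal N 0
        (matrix_inv (U_matrix (W \<times> T) b z \<rho> \<theta>0) ** V_matrix (W \<times> T) b z \<rho> g \<theta>0 **
         transpose (matrix_inv (U_matrix (W \<times> T) b z \<rho> \<theta>0))) \<and>
      converges_in_distribution
        (\<lambda>n. distr M borel (\<lambda>\<omega>. sqrt (real n) *\<^sub>R (\<theta>hat n \<omega> - \<theta>0))) N"
proof -
  have S: "W \<times> T \<in> sets borel" using window(1) by (rule borel_open)
  obtain C where C: "\<And>u. u \<in> W \<times> T \<Longrightarrow> norm (z u) \<le> C"
    using z_bounded unfolding bdd_above_def by blast
  interpret logistic_sampling M "W \<times> T" Y E b \<rho> z g \<theta>0 "max 0 C"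
  proof (rule logistic_sampling.intro[OF prob], rule logistic_sampling_axioms.intro[OF S iid indep b(1) b(2)[rule_format]
        z _ _ Y_poisson[rule_format] rho(1) rho(2)[rule_format] E_pcf[rule_format] g_bounded U_posdef])
    show "norm (z u) \<le> max 0 C" if "u \<in> W \<times> T" for u
      using C[OF that] by linarith
  qed simp_all
  show ?thesis
  proof (rule estimator_asymptotically_normal[OF open_Theta true_parameter])
    show "\<theta>hat n \<in> borel_measurable M" for n using estimator_measurable by blast
    show "AE \<omega> in M. (\<exists>\<theta>\<in>\<Theta>. logistic_score b z \<rho> (superposition Y n \<omega>) (superposition E n \<omega>) \<theta> = 0) \<longrightarrow>
        \<theta>hat n \<omega> \<in> \<Theta> \<and>
        logistic_score b z \<rho> (superposition Y n \<omega>) (superposition E n \<omega>) (\<theta>hat n \<omega>) = 0" for n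
      using estimator by blast
  qed
qed

end
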